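(* Let $G$ be a finite graph without loops and $k\ge1$ an integer. Then $\mathrm{B}(\Omega_{2k+1}(G))$ and $\mathrm{B}(\Omega_{2k-1}(G))$ are $\mathbb{Z}_2$-simple homotopy equivalent. Moreover, the homomorphism $\Omega_{2k+1}(G)\to\Omega_{2k-1}(G)$ given by $(A_0,\dots,A_{k-1},A_k)\mapsto(A_0,\dots,A_{k-1})$ induces a $\mathbb{Z}_2$-homotopy equivalence $|\mathrm{B}(\Omega_{2k+1}(G))|\to|\mathrm{B}(\Omega_{2k-1}(G))|$.
   Context: Graphs are finite with symmetric adjacency. For $A,B\subseteq V(G)$, $A\bowtie B$ means every vertex of $A$ is adjacent to every vertex of $B$; $\mathrm{CN}(A)$ is the common neighbourhood ($\mathrm{CN}(\emptyset)=V(G)$). For $k=2\ell+1$, $\Omega_k(G)$ has vertices the tuples $(A_0,\dots,A_\ell)$ of subsets of $V(G)$ with $|A_0|=1$ and $A_{i-1}\bowtie A_i$; $\mathbf{A},\mathbf{B}$ are adjacent iff $A_{i-1}\subseteq B_i$, $B_{i-1}\subseteq A_i$ ($i=1,\dots,\ell$) and $A_\ell\bowtie B_\ell$. Box complex: after deleting isolated vertices of a graph $H$, $\mathrm{B}(H)$ is the simplicial complex on $V(H)\times\{\circ,\bullet\}$ whose simplices are the nonempty $\sigma$ with $\sigma^\circ\bowtie\sigma^\bullet$ and $\mathrm{CN}(\sigma^\circ),\mathrm{CN}(\sigma^\bullet)\ne\emptyset$ ($\sigma^\circ=\{v:v^\circ\in\sigma\}$, $\sigma^\bullet=\{v:v^\bullet\in\sigma\}$),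 with involution $v^\circ\leftrightarrow v^\bullet$; $|\mathrm{B}(H)|$ is its geometric realization. A homomorphism $h$ induces $|h|$, the linear extension of $v^\circ\mapsto h(v)^\circ$, $v^\bullet\mapsto h(v)^\bullet$. If $\tau$ is a simplex of $K$ contained in exactly one other simplex $\sigma$, removing $\tau,\sigma$ is an elementary collapse (its inverse an elementary expansion). For complexes with free simplicial involutions, $\mathbb{Z}_2$-elementary collapses/expansions act on $\tau,\sigma,-\tau,-\sigma$ simultaneously; two such complexes are $\mathbb{Z}_2$-simple homotopy equivalent if one is obtained from the other (up to $\mathbb{Z}_2$-isomorphism) by a sequence of $\mathbb{Z}_2$-elementary collapses and expansions. A $\mathbb{Z}_2$-homotopy equivalence is a $\mathbb{Z}_2$-map (continuous, commuting with involutions) having a $\mathbb{Z}_2$-map inverse up to homotopies through $\mathbb{Z}_2$-maps. *)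

theory Defs
  imports "HOL-Analysis.Analysis" "Graph_Theory.Graph_Theory"
begin

section \<open>Graphs and the graphs $\Omega_k(G)$\<close>

definition complete_to :: "'v pair_pre_digraph \<Rightarrow> 'v set \<Rightarrow> 'v set \<Rightarrow> bool" where
  "complete_to G A B \<longleftrightarrow> (\<forall>a\<in>A. \<forall>b\<in>B. (a, b) \<in> parcs G)"

definition common_nbhd :: "'v pair_pre_digraph \<Rightarrow> 'v set \<Rightarrow> 'v set" where
  "common_nbhd G A = {v \<in> pverts G. \<forall>a\<in>A. (a, v) \<in> parcs G}"

definition graph_hom :: "'v pair_pre_digraph \<Rightarrow> 'w pair_pre_digraph \<Rightarrow> ('v \<Rightarrow> 'w) \<Rightarrow> bool" where
  "graph_hom G H h \<longleftrightarrow>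
     (\<forall>v\<in>pverts G. h v \<in> pverts H) \<and> (\<forall>(u, v)\<in>parcs G. (h u, h v) \<in> parcs H)"

text \<open>
  Tuples $(A_0,\dots,A_l)$ are lists of length $l + 1$.
\<close>

definition Omega_tuples :: "nat \<Rightarrow> 'v pair_pre_digraph \<Rightarrow> 'v set list set" where
  "Omega_tuples l G =
     {A. length A = l + 1 \<and> (\<forall>i\<le>l. A ! i \<subseteq> pverts G) \<and> card (A ! 0) = 1 \<and>
         (\<forall>i\<in>{1..l}. complete_to G (A ! (i - 1)) (A ! i))}"

definition Omega_adj :: "nat \<Rightarrow> 'v pair_pre_digraph \<Rightarrow> 'v set list \<Rightarrow> 'v set list \<Rightarrow> bool" where
  "Omega_adj l G A B \<longleftrightarrow>
     (\<forall>i\<in>{1..l}. A ! (i - 1) \<subseteq> B ! i \<and> B ! (i - 1) \<subseteq> A ! i) \<and> complete_to G (A ! l) (B ! l)"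

text \<open>
  The graph $\Omega_k(G)$ for odd $k = 2 l + 1$, so that \<open>k div 2\<close> is $l$.
  The value at even \<open>k\<close> carries no meaning.
\<close>

definition Omega :: "nat \<Rightarrow> 'v pair_pre_digraph \<Rightarrow> 'v set list pair_pre_digraph" where
  "Omega k G =
     (let l = k div 2
      in \<lparr>pverts = Omega_tuples l G,
          parcs = {(A, B). A \<in> Omega_tuples l G \<and> B \<in> Omega_tuples l G \<and> Omega_adj l G A B}\<rparr>)"


section \<open>Finite simplicial complexes with free involution\<close>

text \<open>
  A complex is its set of nonempty simplices. An involution is given by a function on vertices
  whose values outside the vertex set \<open>\<Union>K\<close> are irrelevant.
\<close>

definition finite_abstract_complex :: "'v set set \<Rightarrow> bool" where
  "finite_abstract_complex K \<longleftrightarrow>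
     finite K \<and> (\<forall>\<sigma>\<in>K. finite \<sigma> \<and> \<sigma> \<noteq> {} \<and> (\<forall>\<tau>. \<tau> \<noteq> {} \<and> \<tau> \<subseteq> \<sigma> \<longrightarrow> \<tau> \<in> K))"

text \<open>
  Freeness means that no simplex is mapped to itself: a point of the realization fixed by the
  involution has an invariant supporting simplex, and an invariant simplex has a fixed barycentre.
\<close>

definition free_Z2_complex :: "'v set set \<Rightarrow> ('v \<Rightarrow> 'v) \<Rightarrow> bool" where
  "free_Z2_complex K \<nu> \<longleftrightarrow>
     finite_abstract_complex K \<and> (\<forall>v\<in>\<Union>K. \<nu> (\<nu> v) = v) \<and> (\<forall>\<sigma>\<in>K. \<nu> ` \<sigma> \<in> K \<and> \<nu> ` \<sigma> \<noteq> \<sigma>)"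

definition Z2_isomorphic ::
    "'v set set \<times> ('v \<Rightarrow> 'v) \<Rightarrow> 'w set set \<times> ('w \<Rightarrow> 'w) \<Rightarrow> bool" where
  "Z2_isomorphic = (\<lambda>(K, \<nu>) (L, \<mu>).
     \<exists>f. bij_betw f (\<Union>K) (\<Union>L) \<and> (\<lambda>\<sigma>. f ` \<sigma>) ` K = L \<and> (\<forall>v\<in>\<Union>K. f (\<nu> v) = \<mu> (f v)))"

text \<open>
  The involution \<open>\<mu>\<close> of the smaller complex only has to agree with \<open>\<nu>\<close> on the remaining vertices,
  so the converse relation, elementary expansion, may add vertices and choose the involution on them.
\<close>

inductive Z2_elementary_collapse ::
    "'v set set \<times> ('v \<Rightarrow> 'v) \<Rightarrow> 'v set set \<times> ('v \<Rightarrow> 'v) \<Rightarrow> bool" where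
  "\<lbrakk>free_Z2_complex K \<nu>; \<tau> \<in> K; {\<rho> \<in> K. \<tau> \<subset> \<rho>} = {\<sigma>};
    L = K - {\<tau>, \<sigma>, \<nu> ` \<tau>, \<nu> ` \<sigma>}; \<forall>v\<in>\<Union>L. \<mu> v = \<nu> v\<rbrakk>
   \<Longrightarrow> Z2_elementary_collapse (K, \<nu>) (L, \<mu>)"

text \<open>
  Expansions may need vertices that the vertex types of \<open>K\<close> and \<open>L\<close> do not provide. All complexes in
  a sequence are finite, so they can be taken to have natural numbers as vertices; \<^const>\<open>equivclp\<close>
  then yields the finite sequences of collapses and expansions.
\<close>

definition Z2_simple_homotopy_equivalent ::
    "'v set set \<times> ('v \<Rightarrow> 'v) \<Rightarrow> 'w set set \<times> ('w \<Rightarrow> 'w) \<Rightarrow> bool" where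
  "Z2_simple_homotopy_equivalent X Y \<longleftrightarrow>
     free_Z2_complex (fst X) (snd X) \<and> free_Z2_complex (fst Y) (snd Y) \<and>
     (\<exists>P Q :: nat set set \<times> (nat \<Rightarrow> nat).
        Z2_isomorphic X P \<and> equivclp Z2_elementary_collapse P Q \<and> Z2_isomorphic Q Y)"


section \<open>Geometric realization and $\mathbb{Z}_2$-maps\<close>

text \<open>
  Points are given by barycentric coordinates, with the topology induced from the product topology
  on functions. For finite complexes this is the usual topology.
\<close>

definition realization :: "'v set set \<Rightarrow> ('v \<Rightarrow> real) set" where
  "realization K =
     {x. (\<forall>v. 0 \<le> x v) \<and> {v. x v \<noteq> 0} \<in> K \<and> (\<Sum>v | x v \<noteq> 0. x v) = 1}"

text \<open>The linear extension of a map \<open>f\<close> between vertices.\<close>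

definition realization_map :: "('v \<Rightarrow> 'w) \<Rightarrow> ('v \<Rightarrow> real) \<Rightarrow> 'w \<Rightarrow> real" where
  "realization_map f x = (\<lambda>w. \<Sum>v | x v \<noteq> 0 \<and> f v = w. x v)"

definition equivariant_on :: "'s set \<Rightarrow> ('s \<Rightarrow> 's) \<Rightarrow> ('t \<Rightarrow> 't) \<Rightarrow> ('s \<Rightarrow> 't) \<Rightarrow> bool" where
  "equivariant_on S \<nu> \<mu> f \<longleftrightarrow> (\<forall>x\<in>S. f (\<nu> x) = \<mu> (f x))"

definition Z2_map ::
    "'s::topological_space set \<Rightarrow> ('s \<Rightarrow> 's) \<Rightarrow> 't::topological_space set \<Rightarrow> ('t \<Rightarrow> 't) \<Rightarrow>
     ('s \<Rightarrow> 't) \<Rightarrow> bool" where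
  "Z2_map S \<nu> T \<mu> f \<longleftrightarrow> continuous_on S f \<and> f ` S \<subseteq> T \<and> equivariant_on S \<nu> \<mu> f"

definition Z2_homotopy_equivalence ::
    "'s::topological_space set \<Rightarrow> ('s \<Rightarrow> 's) \<Rightarrow> 't::topological_space set \<Rightarrow> ('t \<Rightarrow> 't) \<Rightarrow>
     ('s \<Rightarrow> 't) \<Rightarrow> bool" where
  "Z2_homotopy_equivalence S \<nu> T \<mu> f \<longleftrightarrow>
     Z2_map S \<nu> T \<mu> f \<and>
     (\<exists>g. Z2_map T \<mu> S \<nu> g \<and>
        homotopic_with_canon (equivariant_on S \<nu> \<nu>) S S (g \<circ> f) id \<and>
        homotopic_with_canon (equivariant_on T \<mu> \<mu>) T T (f \<circ> g) id)"


section \<open>Box complexes\<close>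

definition delete_isolated :: "'v pair_pre_digraph \<Rightarrow> 'v pair_pre_digraph" where
  "delete_isolated H = \<lparr>pverts = {v \<in> pverts H. \<exists>w. (v, w) \<in> parcs H}, parcs = parcs H\<rparr>"

text \<open>
  The vertex $v^\circ$ is \<open>(v, False)\<close> and the vertex $v^\bullet$ is \<open>(v, True)\<close>.
\<close>

definition box_complex :: "'v pair_pre_digraph \<Rightarrow> ('v \<times> bool) set set" where
  "box_complex H =
     (let H' = delete_isolated H; white = (\<lambda>\<sigma>. {v. (v, False) \<in> \<sigma>}); black = (\<lambda>\<sigma>. {v. (v, True) \<in> \<sigma>})
      in {\<sigma>. \<sigma> \<noteq> {} \<and> \<sigma> \<subseteq> pverts H' \<times> UNIV \<and> complete_to H' (white \<sigma>) (black \<sigma>) \<and>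
             common_nbhd H' (white \<sigma>) \<noteq> {} \<and> common_nbhd H' (black \<sigma>) \<noteq> {}})"

definition box_involution :: "'v \<times> bool \<Rightarrow> 'v \<times> bool" where
  "box_involution = apsnd Not"

definition box_Z2_complex ::
    "'v pair_pre_digraph \<Rightarrow> ('v \<times> bool) set set \<times> ('v \<times> bool \<Rightarrow> 'v \<times> bool)" where
  "box_Z2_complex H = (box_complex H, box_involution)"

text \<open>The map $|h|$ between realized box complexes induced by a graph homomorphism \<open>h\<close>.\<close>

definition box_map :: "('v \<Rightarrow> 'w) \<Rightarrow> ('v \<times> bool \<Rightarrow> real) \<Rightarrow> 'w \<times> bool \<Rightarrow> real" where
  "box_map h = realization_map (apfst h)"

end

theory Submission
  imports Defs
begin

text \<open>
  Truncation of tuples induces a simplicial map \<open>f\<close> from \<open>K\<close>, the box complex of $\Omega_{2k+1}(G)$, to \<open>L\<close>,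
  that of $\Omega_{2k-1}(G)$, and for every simplex \<open>\<tau>\<close> of \<open>L\<close> the simplices \<open>\<sigma>\<close> of \<open>K\<close> with
  \<open>f ` \<sigma> \<subseteq> \<tau>\<close>, together with the empty one, can be matched up and removed pair by pair.
  Glue \<open>K\<close> and \<open>L\<close> to the barycentric subdivision of \<open>L\<close>, joining \<open>\<sigma>\<close> to the chains above \<open>f ` \<sigma>\<close> for
  \<open>\<sigma>\<close> in \<open>K\<close> and to those above \<open>\<sigma>\<close> for \<open>\<sigma>\<close> in \<open>L\<close>.
  By the matchings the resulting complex \<open>M\<close> collapses equivariantly both to \<open>K\<close> and to \<open>L\<close>, so these are
  simple homotopy equivalent. The map \<open>r\<close> from \<open>|M|\<close> to \<open>|L|\<close> that sends \<open>v\<close> in \<open>K\<close> to \<open>f v\<close>, fixes \<open>L\<close>, and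
  sends each simplex to its barycentre is left inverse to the inclusion of \<open>|L|\<close>, hence a
  homotopy equivalence, and \<open>|f|\<close> is its restriction to \<open>|K|\<close>.
\<close>

section \<open>Matchings on families of finite sets\<close>

text \<open>Contractible fibres would only give a homotopy equivalence. Simple homotopy type needs
  explicit collapses, so the hypothesis on the fibres is a matching together with an order of
  removal.

  These matchings know nothing of the involutions. Symmetry enters through freeness: simplices of
  the glued complex are sorted by their intersection \<open>q\<close> with an invariant set of
  vertices; \<open>q\<close> is never its own mirror image, so the block of \<open>q\<close> is
  matched at will and the block of the mirror image follows along.

  Chains stand in the middle because the simplices of \<open>K\<close> that may be joined to a chain
  are those of the fibre over its least member, so each chain calls for one fibre. For the identity
  of \<open>L\<close> the fibres are full simplices, so both collapses of \<open>M\<close> are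
  instances of one lemma.

  Within a fibre of the truncation the last entries can be enlarged, but the common neighbours have
  to give way: replacing \<open>X\<close> by \<open>X \<union> N\<close> is paid for by cutting the
  last entry \<open>Z\<close> of a neighbour down to its part in the common neighbourhood of
  \<open>N\<close>. This exchange is the source of the dominated vertices.\<close>

lemma obtain_max_card:
  assumes "finite Q" "Q \<noteq> {}"
  obtains q where "q \<in> Q" "\<And>q'. q' \<in> Q \<Longrightarrow> card q' \<le> card q"
  using assms obtains_MAX[of Q card] by (metis Max_ge finite_imageI imageI)

text \<open>
  The family \<open>F\<close> may contain the empty set. A nonempty complex that collapses to a vertex is removable
  once the empty set has been added, because the latter is paired with that vertex.
\<close>

inductive removable :: "'v set set \<Rightarrow> bool" where
  empty: "removable {}"
| step: "\<lbrakk>\<tau> \<in> F; {\<rho> \<in> F. \<tau> \<subset> \<rho>} = {\<sigma>}; removable (F - {\<tau>, \<sigma>})\<rbrakk> \<Longrightarrow> removable F"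

text \<open>\<open>A\<close> goes first. A free face within \<open>A\<close> gains no coface in
  \<open>A \<union> B\<close>, because no member of \<open>B\<close> lies above one of
  \<open>A\<close>; once \<open>A\<close> is exhausted, \<open>B\<close> is left.\<close>

lemma removable_Un:
  assumes "removable A" "removable B" "A \<inter> B = {}" "\<And>\<rho> \<rho>'. \<rho> \<in> A \<Longrightarrow> \<rho>' \<in> B \<Longrightarrow> \<not> \<rho> \<subset> \<rho>'"
  shows "removable (A \<union> B)"
  using assms
proof (induction A rule: removable.induct)
  case (step \<tau> F \<sigma>)
  have 1: "{\<rho> \<in> F \<union> B. \<tau> \<subset> \<rho>} = {\<sigma>}"
  proof -
    have "{\<rho> \<in> B. \<tau> \<subset> \<rho>} = {}" using step.hyps(1) step.prems(3) by auto
    then show ?thesis using step.hyps(2) by blast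
  qed
  have "F \<union> B - {\<tau>, \<sigma>} = (F - {\<tau>, \<sigma>}) \<union> B"
    using step.hyps(1,2) step.prems(2) by blast
  moreover have "removable ((F - {\<tau>, \<sigma>}) \<union> B)"
    using step.prems by (intro step.IH) auto
  ultimately show ?case
    using removable.step[of \<tau> "F \<union> B" \<sigma>] 1 step.hyps by simp
qed simp

text \<open>The pairs are \<open>\<rho> - {v}\<close> and \<open>insert v \<rho>\<close>, taken by
  decreasing size. A member \<open>\<sigma>\<close> of maximal size contains the apex
  \<open>v\<close>, and then \<open>\<sigma>\<close> is the only member properly above
  \<open>\<sigma> - {v}\<close>.\<close>

lemma removable_cone:
  assumes "finite F" "\<And>\<rho>. \<rho> \<in> F \<Longrightarrow> finite \<rho>"
    and "\<And>\<rho>. \<rho> \<in> F \<Longrightarrow> insert v \<rho> \<in> F" "\<And>\<rho>. \<rho> \<in> F \<Longrightarrow> \<rho> - {v} \<in> F"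
  shows "removable F"
  using assms
proof (induction "card F" arbitrary: F rule: less_induct)
  case less
  show ?case
  proof (cases "F = {}")
    case False
    from obtain_max_card[OF less.prems(1) False]
    obtain \<sigma> where \<sigma>: "\<sigma> \<in> F" and max: "\<And>\<rho>. \<rho> \<in> F \<Longrightarrow> card \<rho> \<le> card \<sigma>"
      by blast
    have fin: "finite \<sigma>" using \<sigma> less.prems by blast
    have v: "v \<in> \<sigma>"
      using max[of "insert v \<sigma>"] less.prems(3)[OF \<sigma>] fin by (cases "v \<in> \<sigma>") auto
    define \<tau> where "\<tau> = \<sigma> - {v}"
    have \<tau>: "\<tau> \<in> F" unfolding \<tau>_def using less.prems \<sigma> by blast
    have up: "\<rho> = \<sigma>" if "\<rho> \<in> F" "\<tau> \<subset> \<rho>" for \<rho>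
    proof -
      \<comment> \<open>Adding the apex to \<open>\<rho>\<close> cannot exceed the maximal size, so
        \<open>insert v \<rho>\<close> is \<open>\<sigma>\<close>; if \<open>v\<close> were missing
        from \<open>\<rho>\<close>, then \<open>\<rho>\<close> would be \<open>\<tau>\<close>
        itself.\<close>
      have "\<sigma> \<subseteq> insert v \<rho>" using that v unfolding \<tau>_def by blast
      moreover have "card (insert v \<rho>) \<le> card \<sigma>" using that less.prems max by blast
      ultimately have eq: "insert v \<rho> = \<sigma>"
        using that less.prems(2) card_seteq[of "insert v \<rho>" \<sigma>] by blast
      have "v \<in> \<rho>"
      proof (rule ccontr)
        assume "v \<notin> \<rho>"
        then have "\<rho> = \<tau>" using eq unfolding \<tau>_def by blast
        then show False using that by blast
      qed
      then show ?thesis using eq by blast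
    qed
    have 1: "{\<rho> \<in> F. \<tau> \<subset> \<rho>} = {\<sigma>}"
      using up \<sigma> v unfolding \<tau>_def by blast
    have "removable (F - {\<tau>, \<sigma>})"
    proof (rule less.hyps)
      show "card (F - {\<tau>, \<sigma>}) < card F"
        using \<sigma> less.prems(1) by (intro psubset_card_mono) auto
      fix \<rho> assume \<rho>: "\<rho> \<in> F - {\<tau>, \<sigma>}"
      have "insert v \<rho> \<noteq> \<sigma>" "insert v \<rho> \<noteq> \<tau>" "\<rho> - {v} \<noteq> \<sigma>" "\<rho> - {v} \<noteq> \<tau>"
        using \<rho> v unfolding \<tau>_def by blast+
      then show "insert v \<rho> \<in> F - {\<tau>, \<sigma>}" "\<rho> - {v} \<in> F - {\<tau>, \<sigma>}"
        using less.prems \<rho> by auto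
      show "finite \<rho>" using less.prems \<rho> by auto
    qed (use less.prems in auto)
    then show ?thesis using removable.step[OF \<tau> 1] by blast
  qed (simp add: removable.empty)
qed

text \<open>The trace \<open>\<rho> \<inter> D\<close> grows with \<open>\<rho>\<close>, so the part
  belonging to a trace of maximal size is closed upwards in \<open>F\<close> and may be removed
  before all others.\<close>

lemma removable_parts:
  assumes "finite F" "\<And>\<rho>. \<rho> \<in> F \<Longrightarrow> finite \<rho>" "\<And>q. removable {\<rho> \<in> F. \<rho> \<inter> D = q}"
  shows "removable F"
  using assms
proof (induction "card F" arbitrary: F rule: less_induct)
  case less
  show ?case
  proof (cases "F = {}")
    case False
    have "finite ((\<lambda>\<rho>. \<rho> \<inter> D) ` F)" "(\<lambda>\<rho>. \<rho> \<inter> D) ` F \<noteq> {}"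
      using False less.prems(1) by auto
    from obtain_max_card[OF this]
    obtain q where q: "q \<in> (\<lambda>\<rho>. \<rho> \<inter> D) ` F"
      and max0: "\<And>q'. q' \<in> (\<lambda>\<rho>. \<rho> \<inter> D) ` F \<Longrightarrow> card q' \<le> card q"
      by blast
    have max: "card (\<rho> \<inter> D) \<le> card q" if "\<rho> \<in> F" for \<rho>
      by (rule max0) (use that in blast)
    define A where "A = {\<rho> \<in> F. \<rho> \<inter> D = q}"
    have "removable (F - A)"
    proof (rule less.hyps)
      show "card (F - A) < card F"
        using q less.prems(1) unfolding A_def by (intro psubset_card_mono) auto
      fix q'
      have "{\<rho> \<in> F - A. \<rho> \<inter> D = q'} = (if q' = q then {} else {\<rho> \<in> F. \<rho> \<inter> D = q'})"
        unfolding A_def by auto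
      then show "removable {\<rho> \<in> F - A. \<rho> \<inter> D = q'}"
        using less.prems(3) removable.empty by auto
    qed (use less.prems in auto)
    moreover have "\<not> \<rho> \<subset> \<rho>'" if "\<rho> \<in> A" "\<rho>' \<in> F - A" for \<rho> \<rho>'
    proof
      assume "\<rho> \<subset> \<rho>'"
      then have "q \<subseteq> \<rho>' \<inter> D" using that unfolding A_def by auto
      then have "q = \<rho>' \<inter> D" using max[of \<rho>'] that less.prems(2) card_seteq by (metis Diff_iff finite_Int)
      then show False using that unfolding A_def by auto
    qed
    moreover have "removable A" unfolding A_def using less.prems by blast
    ultimately have "removable (A \<union> (F - A))" by (intro removable_Un) auto
    moreover have "A \<union> (F - A) = F" unfolding A_def by auto
    ultimately show ?thesis by simp
  qed (simp add: removable.empty)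
qed

text \<open>\<open>d v\<close> dominates \<open>v\<close>: it may be added to or taken from every
  member containing \<open>v\<close>. As \<open>d v\<close> lies outside \<open>D\<close>, this
  keeps the trace \<open>q\<close> on \<open>D\<close>, so a part with nonempty trace is a cone with
  apex \<open>d v\<close> for any one \<open>v \<in> q\<close>. All dominated vertices thus go at
  once, and the members avoiding \<open>D\<close> remain.\<close>

lemma removable_dominated:
  assumes "finite F" "\<And>\<rho>. \<rho> \<in> F \<Longrightarrow> finite \<rho>"
    and "\<And>v. v \<in> D \<Longrightarrow> d v \<notin> D"
    and ins: "\<And>\<rho> v. \<rho> \<in> F \<Longrightarrow> v \<in> \<rho> \<Longrightarrow> v \<in> D \<Longrightarrow> insert (d v) \<rho> \<in> F"
    and del: "\<And>\<rho> v. \<rho> \<in> F \<Longrightarrow> v \<in> \<rho> \<Longrightarrow> v \<in> D \<Longrightarrow> \<rho> - {d v} \<in> F"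
    and "removable {\<rho> \<in> F. \<rho> \<inter> D = {}}"
  shows "removable F"
proof (rule removable_parts[of F D])
  fix q
  show "removable {\<rho> \<in> F. \<rho> \<inter> D = q}"
  proof (cases "q = {} \<or> \<not> q \<subseteq> D")
    case True
    then show ?thesis
    proof
      assume "\<not> q \<subseteq> D"
      then have "{\<rho> \<in> F. \<rho> \<inter> D = q} = {}" by auto
      then show ?thesis using removable.empty by metis
    qed (use assms in auto)
  next
    case False
    then obtain v where v: "v \<in> q" "q \<subseteq> D" by auto
    then have "d v \<notin> D" using assms(3) by auto
    then show ?thesis
      using v assms(1,2) ins del by (intro removable_cone[where v = "d v"]) auto
  qed
qed (use assms in auto)

lemma removable_image:
  assumes "removable F" "inj_on h F" "\<And>\<rho> \<rho>'. \<rho> \<in> F \<Longrightarrow> \<rho>' \<in> F \<Longrightarrow> h \<rho> \<subset> h \<rho>' \<longleftrightarrow> \<rho> \<subset> \<rho>'"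
  shows "removable (h ` F)"
  using assms
proof (induction F rule: removable.induct)
  case (step \<tau> F \<sigma>)
  have \<sigma>: "\<sigma> \<in> F" using step.hyps by blast
  have 1: "{\<rho> \<in> h ` F. h \<tau> \<subset> \<rho>} = {h \<sigma>}"
  proof -
    have "{\<rho> \<in> h ` F. h \<tau> \<subset> \<rho>} = h ` {\<rho> \<in> F. \<tau> \<subset> \<rho>}"
      using step.prems(2)[OF step.hyps(1)] by (intro set_eqI) (simp add: image_iff, blast)
    then show ?thesis using step.hyps by simp
  qed
  have "h ` F - {h \<tau>, h \<sigma>} = h ` (F - {\<tau>, \<sigma>})"
    using inj_on_image_set_diff[of h F F "{\<tau>, \<sigma>}"] step \<sigma> by auto
  moreover have "removable (h ` (F - {\<tau>, \<sigma>}))"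
    using step.prems by (intro step.IH) (auto intro: inj_on_subset)
  ultimately show ?case
    using removable.step[of "h \<tau>" "h ` F" "h \<sigma>"] step.hyps 1 by auto
qed (simp add: removable.empty)


section \<open>Equivariant collapses\<close>

definition Z2_collapses :: "('v \<Rightarrow> 'v) \<Rightarrow> 'v set set \<Rightarrow> 'v set set \<Rightarrow> bool" where
  "Z2_collapses \<nu> = (\<lambda>K L. Z2_elementary_collapse (K, \<nu>) (L, \<nu>))\<^sup>*\<^sup>*"

lemma Z2_collapses_trans: "Z2_collapses \<nu> K L \<Longrightarrow> Z2_collapses \<nu> L M \<Longrightarrow> Z2_collapses \<nu> K M"
  unfolding Z2_collapses_def by (rule rtranclp_trans)

lemma free_Z2_complex_involution:
  assumes "free_Z2_complex K \<nu>" "\<sigma> \<in> K"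
  shows "\<nu> ` \<nu> ` \<sigma> = \<sigma>" "\<nu> ` \<sigma> \<in> K" "\<nu> ` \<sigma> \<noteq> \<sigma>"
proof -
  have "\<nu> (\<nu> v) = v" if "v \<in> \<sigma>" for v using assms that unfolding free_Z2_complex_def by blast
  then show "\<nu> ` \<nu> ` \<sigma> = \<sigma>" by (force simp: image_iff)
qed (use assms in \<open>auto simp: free_Z2_complex_def\<close>)

text \<open>The four removed simplices are closed under passing to cofaces, so a complex remains,
  and they are permuted by \<open>\<nu>\<close>. For the mirrored pair the first claim is
  transported along the involution.\<close>

lemma free_Z2_complex_elementary_collapse:
  assumes "free_Z2_complex K \<nu>" "\<tau> \<in> K" "{\<rho> \<in> K. \<tau> \<subset> \<rho>} = {\<sigma>}"
  shows "free_Z2_complex (K - {\<tau>, \<sigma>, \<nu> ` \<tau>, \<nu> ` \<sigma>}) \<nu>"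
proof -
  note inv = free_Z2_complex_involution[OF assms(1)]
  have \<sigma>: "\<sigma> \<in> K" "\<tau> \<subset> \<sigma>" using assms(3) by blast+
  have up: "\<rho> = \<tau> \<or> \<rho> = \<sigma>" if "\<rho> \<in> K" "\<tau> \<subseteq> \<rho>" for \<rho> using that assms(3) by blast
  have up': "\<rho> = \<nu> ` \<tau> \<or> \<rho> = \<nu> ` \<sigma>" if "\<rho> \<in> K" "\<nu> ` \<tau> \<subseteq> \<rho>" for \<rho>
  proof -
    have "\<tau> \<subseteq> \<nu> ` \<rho>" using that inv assms(2) by (metis image_mono)
    then show ?thesis using up[of "\<nu> ` \<rho>"] inv that by metis
  qed
  let ?R = "{\<tau>, \<sigma>, \<nu> ` \<tau>, \<nu> ` \<sigma>}"
  have upR: "\<rho> \<in> ?R" if "\<rho> \<in> K" "\<rho>' \<in> ?R" "\<rho>' \<subseteq> \<rho>" for \<rho> \<rho>'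
  proof -
    have "\<nu> ` \<tau> \<subseteq> \<nu> ` \<sigma>" using \<sigma> by blast
    then have "\<tau> \<subseteq> \<rho> \<or> \<nu> ` \<tau> \<subseteq> \<rho>" using that(2,3) \<sigma>(2) by (elim insertE) auto
    then show ?thesis using up[OF that(1)] up'[OF that(1)] by blast
  qed
  have "finite_abstract_complex (K - ?R)"
    using assms(1) upR unfolding free_Z2_complex_def finite_abstract_complex_def by (metis DiffD1 DiffD2 DiffI finite_Diff)
  moreover have "\<nu> ` \<rho> \<in> K - ?R" if "\<rho> \<in> K - ?R" for \<rho>
  proof -
    have "image \<nu> ` ?R = ?R"
      using inv(1)[OF \<sigma>(1)] inv(1)[OF assms(2)] by (simp add: insert_commute)
    moreover have "\<nu> ` \<nu> ` \<rho> = \<rho>" "\<nu> ` \<rho> \<in> K" using inv that by blast+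
    ultimately have "\<nu> ` \<rho> \<notin> ?R" using that by (metis DiffD2 image_eqI)
    then show ?thesis using \<open>\<nu> ` \<rho> \<in> K\<close> by blast
  qed
  moreover have "\<nu> (\<nu> v) = v" if "v \<in> \<Union>(K - ?R)" for v
    using that assms(1) unfolding free_Z2_complex_def by blast
  moreover have "\<nu> ` \<rho> \<noteq> \<rho>" if "\<rho> \<in> K - ?R" for \<rho>
    using inv(3) that by blast
  ultimately show ?thesis unfolding free_Z2_complex_def by (metis (no_types, lifting))
qed

lemma Z2_collapses_free:
  assumes "Z2_collapses \<nu> K L" "free_Z2_complex K \<nu>"
  shows "free_Z2_complex L \<nu>"
  using assms unfolding Z2_collapses_def
proof (induction rule: rtranclp_induct)
  case (step L M)
  from step.hyps(2) show ?case
    by cases (simp add: free_Z2_complex_elementary_collapse)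
qed simp

text \<open>\<open>F\<close> is an upper set of \<open>K\<close>, so free within \<open>F\<close>
  means free within \<open>K\<close>. Disjointness from the mirror image guarantees that deleting
  the mirrored pair never takes anything out of \<open>F\<close>, and the plain matching of
  \<open>F\<close> can be followed to its end.\<close>

lemma Z2_collapses_removable:
  assumes "removable F" "free_Z2_complex K \<nu>" "F \<subseteq> K"
    and "\<And>\<rho> \<rho>'. \<rho> \<in> F \<Longrightarrow> \<rho>' \<in> K \<Longrightarrow> \<rho> \<subseteq> \<rho>' \<Longrightarrow> \<rho>' \<in> F"
    and "F \<inter> image \<nu> ` F = {}"
  shows "Z2_collapses \<nu> K (K - F - image \<nu> ` F)"
  using assms
proof (induction F arbitrary: K rule: removable.induct)
  case empty
  then show ?case by (simp add: Z2_collapses_def)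
next
  case (step \<tau> F \<sigma>)
  have \<sigma>: "\<sigma> \<in> F" "\<tau> \<subset> \<sigma>" using step.hyps(2) by blast+
  define K1 where "K1 = K - {\<tau>, \<sigma>, \<nu> ` \<tau>, \<nu> ` \<sigma>}"
  have "{\<rho> \<in> K. \<tau> \<subset> \<rho>} = {\<rho> \<in> F. \<tau> \<subset> \<rho>}"
    using step.prems(2) step.prems(3)[OF step.hyps(1)] by blast
  then have cof: "{\<rho> \<in> K. \<tau> \<subset> \<rho>} = {\<sigma>}" using step.hyps(2) by simp
  have \<tau>: "\<tau> \<in> K" using step.hyps(1) step.prems(2) by blast
  have "Z2_elementary_collapse (K, \<nu>) (K1, \<nu>)"
    by (rule Z2_elementary_collapse.intros[OF step.prems(1) \<tau> cof K1_def]) simp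
  then have 1: "Z2_collapses \<nu> K K1" unfolding Z2_collapses_def by blast
  have free: "free_Z2_complex K1 \<nu>"
    unfolding K1_def by (rule free_Z2_complex_elementary_collapse[OF step.prems(1) \<tau> cof])
  have "Z2_collapses \<nu> K1 (K1 - (F - {\<tau>, \<sigma>}) - image \<nu> ` (F - {\<tau>, \<sigma>}))"
  proof (rule step.IH[OF free])
    show "F - {\<tau>, \<sigma>} \<subseteq> K1" using step.prems step.hyps(1) \<sigma> unfolding K1_def by blast
    show "\<rho>' \<in> F - {\<tau>, \<sigma>}" if "\<rho> \<in> F - {\<tau>, \<sigma>}" "\<rho>' \<in> K1" "\<rho> \<subseteq> \<rho>'" for \<rho> \<rho>'
      using that step.prems(3)[of \<rho> \<rho>'] unfolding K1_def by blast
  qed (use step.prems in blast)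
  moreover have "K1 - (F - {\<tau>, \<sigma>}) - image \<nu> ` (F - {\<tau>, \<sigma>}) = K - F - image \<nu> ` F"
    using step.hyps(1) \<sigma> unfolding K1_def by blast
  ultimately show ?case using Z2_collapses_trans[OF 1] by simp
qed

text \<open>Equivariant counterpart of \<open>removable_parts\<close>. A nonempty trace
  \<open>q\<close> is itself a simplex, so freeness gives \<open>\<nu>\<close> applied to
  \<open>q\<close> different from \<open>q\<close>; the two blocks are therefore disjoint and go
  together. Blocks with large traces go first, being closed upwards.\<close>

lemma Z2_collapses_parts:
  assumes "free_Z2_complex K \<nu>" "\<And>v. v \<in> \<Union>K \<Longrightarrow> \<nu> v \<in> D \<longleftrightarrow> v \<in> D"
    and "\<And>q. q \<in> K \<Longrightarrow> q \<subseteq> D \<Longrightarrow> removable {\<rho> \<in> K. \<rho> \<inter> D = q}"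
  shows "Z2_collapses \<nu> K {\<rho> \<in> K. \<rho> \<inter> D = {}}"
  using assms
proof (induction "card K" arbitrary: K rule: less_induct)
  case less
  note free = less.prems(1)
  have K: "finite K" "\<And>\<rho>. \<rho> \<in> K \<Longrightarrow> finite \<rho>" "\<And>\<rho> q. \<rho> \<in> K \<Longrightarrow> q \<subseteq> \<rho> \<Longrightarrow> q \<noteq> {} \<Longrightarrow> q \<in> K"
    using free unfolding free_Z2_complex_def finite_abstract_complex_def by blast+
  note inv = free_Z2_complex_involution[OF free]
  show ?case
  proof (cases "{q \<in> K. q \<subseteq> D} = {}")
    case True
    then have "\<rho> \<inter> D = {}" if "\<rho> \<in> K" for \<rho> using K(3)[OF that, of "\<rho> \<inter> D"] by blast
    then have "{\<rho> \<in> K. \<rho> \<inter> D = {}} = K" by auto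
    then show ?thesis by (simp add: Z2_collapses_def)
  next
    case False
    have "finite {q \<in> K. q \<subseteq> D}" using K by auto
    from obtain_max_card[OF this False]
    obtain q where q': "q \<in> {q \<in> K. q \<subseteq> D}"
      and max': "\<And>q'. q' \<in> {q \<in> K. q \<subseteq> D} \<Longrightarrow> card q' \<le> card q" by blast
    have q: "q \<in> K" "q \<subseteq> D" using q' by auto
    have max: "card q' \<le> card q" if "q' \<in> K" "q' \<subseteq> D" for q'
      using max' that by blast
    have q0: "q \<noteq> {}" using q free unfolding free_Z2_complex_def finite_abstract_complex_def by auto
    define F where "F = {\<rho> \<in> K. \<rho> \<inter> D = q}"
    have Dn: "(\<nu> ` \<rho>) \<inter> D = \<nu> ` (\<rho> \<inter> D)" if "\<rho> \<in> K" for \<rho>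
      using less.prems(2) that by blast
    have up: "\<rho>' \<in> F" if "\<rho> \<in> F" "\<rho>' \<in> K" "\<rho> \<subseteq> \<rho>'" for \<rho> \<rho>'
    proof -
      have "q \<subseteq> \<rho>' \<inter> D" using that unfolding F_def by auto
      moreover have "card (\<rho>' \<inter> D) \<le> card q"
        using K(3)[OF that(2), of "\<rho>' \<inter> D"] calculation q0 by (intro max) auto
      moreover have "finite (\<rho>' \<inter> D)" using K(2) that by blast
      ultimately have "q = \<rho>' \<inter> D" by (intro card_seteq)
      then show ?thesis using that unfolding F_def by auto
    qed
    have nF: "image \<nu> ` F = {\<rho> \<in> K. \<rho> \<inter> D = \<nu> ` q}"
    proof (intro equalityI subsetI)
      fix \<rho> assume "\<rho> \<in> image \<nu> ` F"
      then obtain \<rho>' where "\<rho> = \<nu> ` \<rho>'" "\<rho>' \<in> K" "\<rho>' \<inter> D = q" unfolding F_def by blast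
      then show "\<rho> \<in> {\<rho> \<in> K. \<rho> \<inter> D = \<nu> ` q}"
        using inv(2) Dn by simp
    next
      fix \<rho> assume \<rho>: "\<rho> \<in> {\<rho> \<in> K. \<rho> \<inter> D = \<nu> ` q}"
      then have "\<nu> ` \<rho> \<in> F" using inv Dn q unfolding F_def by simp
      then show "\<rho> \<in> image \<nu> ` F" using inv \<rho> by (metis (mono_tags, lifting) image_eqI mem_Collect_eq)
    qed
    have disj: "F \<inter> image \<nu> ` F = {}" using nF inv(3)[OF q(1)] unfolding F_def by auto
    have rF: "removable F" unfolding F_def using less.prems q by blast
    define K1 where "K1 = K - F - image \<nu> ` F"
    have FK: "F \<subseteq> K" unfolding F_def by auto
    have c: "Z2_collapses \<nu> K K1" unfolding K1_def
      by (rule Z2_collapses_removable[OF rF free FK up disj])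
    have free1: "free_Z2_complex K1 \<nu>" using Z2_collapses_free[OF c free] .
    have "Z2_collapses \<nu> K1 {\<rho> \<in> K1. \<rho> \<inter> D = {}}"
    proof (rule less.hyps[OF _ free1])
      have "q \<in> F" using q unfolding F_def by auto
      then show "card K1 < card K" using q K(1) unfolding K1_def by (intro psubset_card_mono) auto
      fix v assume "v \<in> \<Union>K1"
      then show "\<nu> v \<in> D \<longleftrightarrow> v \<in> D" using less.prems(2) unfolding K1_def by auto
    next
      \<comment> \<open>Every block other than those of \<open>q\<close> and of its mirror image
        survives untouched, so its matching is still available in \<open>K1\<close>.\<close>
      fix q' assume q': "q' \<in> K1" "q' \<subseteq> D"
      then have "q' \<noteq> q" "q' \<noteq> \<nu> ` q" using q unfolding K1_def nF by (auto simp: F_def)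
      then have "{\<rho> \<in> K1. \<rho> \<inter> D = q'} = {\<rho> \<in> K. \<rho> \<inter> D = q'}"
        unfolding K1_def nF by (auto simp: F_def)
      then show "removable {\<rho> \<in> K1. \<rho> \<inter> D = q'}" using q' less.prems(3) unfolding K1_def by auto
    qed
    moreover have "{\<rho> \<in> K1. \<rho> \<inter> D = {}} = {\<rho> \<in> K. \<rho> \<inter> D = {}}"
      using q0 unfolding K1_def nF by (auto simp: F_def)
    ultimately show ?thesis using Z2_collapses_trans[OF c] by simp
  qed
qed


section \<open>Mapping cylinders\<close>

text \<open>An \<open>Inr\<close> vertex is a simplex of \<open>L\<close>, so the \<open>Inr\<close>
  part is a simplex of the barycentric subdivision of \<open>L\<close>. Working with preimages lets
  one formula cover the mixed members and both pure kinds: \<open>insert {} K\<close> admits bare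
  chains, and the quantifiers are vacuous for an empty chain.\<close>

definition cylinder :: "('u \<Rightarrow> 'w) \<Rightarrow> 'u set set \<Rightarrow> 'w set set \<Rightarrow> ('u + 'w set) set set" where
  "cylinder f K L =
     {\<rho>. \<rho> \<noteq> {} \<and> Inl -` \<rho> \<in> insert {} K \<and> Inr -` \<rho> \<subseteq> L \<and>
         (\<forall>\<tau>\<in>Inr -` \<rho>. f ` (Inl -` \<rho>) \<subseteq> \<tau> \<and> (\<forall>\<tau>'\<in>Inr -` \<rho>. \<tau> \<subseteq> \<tau>' \<or> \<tau>' \<subseteq> \<tau>))}"

definition cylinder_involution :: "('u \<Rightarrow> 'u) \<Rightarrow> ('w \<Rightarrow> 'w) \<Rightarrow> 'u + 'w set \<Rightarrow> 'u + 'w set" where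
  "cylinder_involution \<nu> \<mu> = map_sum \<nu> (image \<mu>)"

lemma cylinder_involution_simps [simp]:
  "cylinder_involution \<nu> \<mu> (Inl v) = Inl (\<nu> v)" "cylinder_involution \<nu> \<mu> (Inr \<tau>) = Inr (\<mu> ` \<tau>)"
  by (simp_all add: cylinder_involution_def)

lemma sum_set_decomp: "\<rho> = Inl ` (Inl -` \<rho>) \<union> Inr ` (Inr -` \<rho>)"
  by (intro set_eqI, rename_tac x, case_tac x) auto

lemma sum_vimage_simps [simp]:
  "Inl -` (Inl ` A \<union> Inr ` B) = A" "Inr -` (Inl ` A \<union> Inr ` B) = B"
  "Inl -` Inl ` A = A" "Inr -` Inr ` B = B" "Inl -` Inr ` B = {}" "Inr -` Inl ` A = {}"
  "Inl -` insert (Inr y) \<rho> = Inl -` \<rho>" "Inr -` insert (Inr y) \<rho> = insert y (Inr -` \<rho>)"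
  by auto

lemma vimage_cylinder_involution:
  "Inl -` cylinder_involution \<nu> \<mu> ` \<rho> = \<nu> ` (Inl -` \<rho>)"
  "Inr -` cylinder_involution \<nu> \<mu> ` \<rho> = image \<mu> ` (Inr -` \<rho>)"
proof -
  have "cylinder_involution \<nu> \<mu> ` \<rho> = Inl ` \<nu> ` (Inl -` \<rho>) \<union> Inr ` image \<mu> ` (Inr -` \<rho>)"
    by (subst sum_set_decomp[of \<rho>], simp only: image_Un image_image cylinder_involution_simps)
  then show "Inl -` cylinder_involution \<nu> \<mu> ` \<rho> = \<nu> ` (Inl -` \<rho>)"
    "Inr -` cylinder_involution \<nu> \<mu> ` \<rho> = image \<mu> ` (Inr -` \<rho>)" by simp_all
qed

lemma free_Z2_complexD:
  assumes "free_Z2_complex K \<nu>"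
  shows "finite K" "\<And>\<sigma>. \<sigma> \<in> K \<Longrightarrow> finite \<sigma>" "\<And>\<sigma>. \<sigma> \<in> K \<Longrightarrow> \<sigma> \<noteq> {}"
    "\<And>\<sigma> \<tau>. \<sigma> \<in> K \<Longrightarrow> \<tau> \<subseteq> \<sigma> \<Longrightarrow> \<tau> \<noteq> {} \<Longrightarrow> \<tau> \<in> K" "\<And>v. v \<in> \<Union>K \<Longrightarrow> \<nu> (\<nu> v) = v"
    "finite (\<Union>K)"
proof -
  have *: "finite K" "\<forall>\<sigma>\<in>K. finite \<sigma> \<and> \<sigma> \<noteq> {} \<and> (\<forall>\<tau>. \<tau> \<noteq> {} \<and> \<tau> \<subseteq> \<sigma> \<longrightarrow> \<tau> \<in> K)"
    "\<forall>v\<in>\<Union>K. \<nu> (\<nu> v) = v"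
    using assms unfolding free_Z2_complex_def finite_abstract_complex_def by blast+
  show "finite K" "\<And>\<sigma>. \<sigma> \<in> K \<Longrightarrow> finite \<sigma>" "\<And>\<sigma>. \<sigma> \<in> K \<Longrightarrow> \<sigma> \<noteq> {}" "finite (\<Union>K)"
    using *(1,2) by simp_all
  show "\<And>\<sigma> \<tau>. \<sigma> \<in> K \<Longrightarrow> \<tau> \<subseteq> \<sigma> \<Longrightarrow> \<tau> \<noteq> {} \<Longrightarrow> \<tau> \<in> K" using *(2) by blast
  show "\<And>v. v \<in> \<Union>K \<Longrightarrow> \<nu> (\<nu> v) = v" using *(3) by blast
qed

lemma cylinderD:
  assumes "\<rho> \<in> cylinder f K L"
  shows "\<rho> \<noteq> {}" "Inl -` \<rho> \<in> insert {} K" "Inr -` \<rho> \<subseteq> L" "Inl -` \<rho> \<subseteq> \<Union>K"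
    "\<And>\<tau>. \<tau> \<in> Inr -` \<rho> \<Longrightarrow> f ` (Inl -` \<rho>) \<subseteq> \<tau>"
    "\<And>\<tau> \<tau>'. \<tau> \<in> Inr -` \<rho> \<Longrightarrow> \<tau>' \<in> Inr -` \<rho> \<Longrightarrow> \<tau> \<subseteq> \<tau>' \<or> \<tau>' \<subseteq> \<tau>"
proof -
  show *: "\<rho> \<noteq> {}" "Inl -` \<rho> \<in> insert {} K" "Inr -` \<rho> \<subseteq> L"
    using assms unfolding cylinder_def mem_Collect_eq by - (elim conjE, assumption)+
  have "\<forall>\<tau>\<in>Inr -` \<rho>. f ` (Inl -` \<rho>) \<subseteq> \<tau> \<and> (\<forall>\<tau>'\<in>Inr -` \<rho>. \<tau> \<subseteq> \<tau>' \<or> \<tau>' \<subseteq> \<tau>)"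
    using assms unfolding cylinder_def mem_Collect_eq by (elim conjE)
  note chain = bspec[OF this]
  show "f ` (Inl -` \<rho>) \<subseteq> \<tau>" if "\<tau> \<in> Inr -` \<rho>" for \<tau>
    using chain[OF that] by (rule conjunct1)
  show "\<tau> \<subseteq> \<tau>' \<or> \<tau>' \<subseteq> \<tau>" if "\<tau> \<in> Inr -` \<rho>" "\<tau>' \<in> Inr -` \<rho>" for \<tau> \<tau>'
    using bspec[OF conjunct2[OF chain[OF that(1)]] that(2)] .
  show "Inl -` \<rho> \<subseteq> \<Union>K" using *(2) by auto
qed

lemma cylinderI:
  assumes "\<rho> \<noteq> {}" "Inl -` \<rho> \<in> insert {} K" "Inr -` \<rho> \<subseteq> L"
    "\<And>\<tau>. \<tau> \<in> Inr -` \<rho> \<Longrightarrow> f ` (Inl -` \<rho>) \<subseteq> \<tau>"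
    "\<And>\<tau> \<tau>'. \<tau> \<in> Inr -` \<rho> \<Longrightarrow> \<tau>' \<in> Inr -` \<rho> \<Longrightarrow> \<tau> \<subseteq> \<tau>' \<or> \<tau>' \<subseteq> \<tau>"
  shows "\<rho> \<in> cylinder f K L"
  unfolding cylinder_def by (intro CollectI conjI ballI assms)

text \<open>Freeness is the point. The part in \<open>K\<close> of an invariant member is invariant,
  hence empty. Then some \<open>\<tau>\<close> of the chain is comparable with its own image; both
  have the same size, so they coincide, against freeness of \<open>L\<close>.\<close>

lemma free_Z2_complex_cylinder:
  assumes K: "free_Z2_complex K \<nu>" and L: "free_Z2_complex L \<mu>"
    and eqv: "\<And>v. v \<in> \<Union>K \<Longrightarrow> f (\<nu> v) = \<mu> (f v)"
  shows "free_Z2_complex (cylinder f K L) (cylinder_involution \<nu> \<mu>)"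
proof -
  note KD = free_Z2_complexD[OF K] and LD = free_Z2_complexD[OF L]
  note Ki = free_Z2_complex_involution[OF K] and Li = free_Z2_complex_involution[OF L]
  let ?M = "cylinder f K L" and ?\<kappa> = "cylinder_involution \<nu> \<mu>"
  have "\<rho> \<subseteq> Inl ` \<Union>K \<union> Inr ` L" if "\<rho> \<in> ?M" for \<rho>
  proof -
    have "Inl ` (Inl -` \<rho>) \<union> Inr ` (Inr -` \<rho>) \<subseteq> Inl ` \<Union>K \<union> Inr ` L"
      using cylinderD(3,4)[OF that] by (intro Un_mono image_mono)
    then show ?thesis using sum_set_decomp[of \<rho>] by metis
  qed
  then have sub: "?M \<subseteq> Pow (Inl ` \<Union>K \<union> Inr ` L)" by blast
  have fin: "finite (Inl ` \<Union>K \<union> Inr ` L)" using KD LD by blast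
  have "finite_abstract_complex ?M"
    unfolding finite_abstract_complex_def
  proof (intro conjI ballI allI impI)
    show "finite ?M" using sub fin by (meson finite_Pow_iff finite_subset)
    fix \<rho> assume \<rho>: "\<rho> \<in> ?M"
    show "finite \<rho>" using \<rho> sub fin by (meson PowD finite_subset subsetD)
    show "\<rho> \<noteq> {}" using \<rho> by (simp add: cylinder_def)
    fix \<rho>' assume \<rho>': "\<rho>' \<noteq> {} \<and> \<rho>' \<subseteq> \<rho>"
    then have sub': "Inl -` \<rho>' \<subseteq> Inl -` \<rho>" "Inr -` \<rho>' \<subseteq> Inr -` \<rho>" by auto
    show "\<rho>' \<in> ?M"
    proof (rule cylinderI)
      show "\<rho>' \<noteq> {}" using \<rho>' by simp
      show "Inl -` \<rho>' \<in> insert {} K"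
      proof (cases "Inl -` \<rho>' = {}")
        case False
        then have "Inl -` \<rho> \<in> K" using sub' cylinderD(2)[OF \<rho>] by blast
        then show ?thesis using KD(4)[OF _ sub'(1)] False by simp
      qed simp
      show "Inr -` \<rho>' \<subseteq> L" using sub' cylinderD(3)[OF \<rho>] by blast
    next
      fix \<tau> assume \<tau>: "\<tau> \<in> Inr -` \<rho>'"
      then have \<tau>': "\<tau> \<in> Inr -` \<rho>" using sub' by blast
      show "f ` (Inl -` \<rho>') \<subseteq> \<tau>" using sub'(1) cylinderD(5)[OF \<rho> \<tau>'] by blast
      fix \<tau>2 assume "\<tau>2 \<in> Inr -` \<rho>'"
      then have "\<tau>2 \<in> Inr -` \<rho>" using sub' by blast
      then show "\<tau> \<subseteq> \<tau>2 \<or> \<tau>2 \<subseteq> \<tau>" by (rule cylinderD(6)[OF \<rho> \<tau>'])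
    qed
  qed
  moreover have "?\<kappa> (?\<kappa> x) = x" if "x \<in> \<rho>" "\<rho> \<in> ?M" for x \<rho>
  proof (cases x)
    case (Inl v)
    then have "v \<in> Inl -` \<rho>" using that by simp
    then have "v \<in> \<Union>K" using cylinderD(4)[OF that(2)] by blast
    then show ?thesis using KD(5) Inl by simp
  next
    case (Inr \<tau>)
    then have "\<tau> \<in> Inr -` \<rho>" using that by simp
    then have "\<tau> \<in> L" using cylinderD(3)[OF that(2)] by blast
    then show ?thesis using Li(1) Inr by simp
  qed
  moreover have "?\<kappa> ` \<rho> \<in> ?M" if \<rho>: "\<rho> \<in> ?M" for \<rho>
  proof -
    have f: "f ` \<nu> ` (Inl -` \<rho>) = \<mu> ` f ` (Inl -` \<rho>)"
    proof -
      show ?thesis unfolding image_image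
        by (intro image_cong refl eqv) (rule subsetD[OF cylinderD(4)[OF \<rho>]])
    qed
    show ?thesis
    proof (rule cylinderI, unfold vimage_cylinder_involution)
      show "?\<kappa> ` \<rho> \<noteq> {}" using cylinderD(1)[OF \<rho>] by simp
      show "\<nu> ` (Inl -` \<rho>) \<in> insert {} K"
        using cylinderD(2)[OF \<rho>] Ki(2)[of "Inl -` \<rho>"] by (elim insertE) simp_all
      show "image \<mu> ` (Inr -` \<rho>) \<subseteq> L"
        using cylinderD(3)[OF \<rho>] Li(2) by (intro image_subsetI) blast
    next
      fix \<tau> assume "\<tau> \<in> image \<mu> ` (Inr -` \<rho>)"
      then obtain \<tau>1 where \<tau>1: "\<tau> = \<mu> ` \<tau>1" "\<tau>1 \<in> Inr -` \<rho>" by (rule imageE)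
      show "f ` \<nu> ` (Inl -` \<rho>) \<subseteq> \<tau>"
        unfolding f \<tau>1(1) by (intro image_mono cylinderD(5)[OF \<rho> \<tau>1(2)])
      fix \<tau>' assume "\<tau>' \<in> image \<mu> ` (Inr -` \<rho>)"
      then obtain \<tau>2 where \<tau>2: "\<tau>' = \<mu> ` \<tau>2" "\<tau>2 \<in> Inr -` \<rho>" by (rule imageE)
      show "\<tau> \<subseteq> \<tau>' \<or> \<tau>' \<subseteq> \<tau>"
        using cylinderD(6)[OF \<rho> \<tau>1(2) \<tau>2(2)] unfolding \<tau>1(1) \<tau>2(1) by (meson image_mono)
    qed
  qed
  moreover have "?\<kappa> ` \<rho> \<noteq> \<rho>" if \<rho>: "\<rho> \<in> ?M" for \<rho>
  proof
    assume eq: "?\<kappa> ` \<rho> = \<rho>"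
    then have eq': "\<nu> ` (Inl -` \<rho>) = Inl -` \<rho>" "image \<mu> ` (Inr -` \<rho>) = Inr -` \<rho>"
      using vimage_cylinder_involution[of \<nu> \<mu> \<rho>] by simp_all
    show False
    proof (cases "Inl -` \<rho> = {}")
      case False
      then have "Inl -` \<rho> \<in> K" using cylinderD(2)[OF \<rho>] by blast
      then show False using eq'(1) Ki(3) by blast
    next
      case True
      then have "Inr -` \<rho> \<noteq> {}"
        using cylinderD(1)[OF \<rho>] sum_set_decomp[of \<rho>] by (metis Un_empty image_empty)
      then obtain \<tau> where \<tau>: "\<tau> \<in> Inr -` \<rho>" by blast
      then have "\<mu> ` \<tau> \<in> Inr -` \<rho>" using eq'(2) by blast
      then have cmp: "\<tau> \<subseteq> \<mu> ` \<tau> \<or> \<mu> ` \<tau> \<subseteq> \<tau>"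
        by (rule cylinderD(6)[OF \<rho> \<tau>])
      have "\<tau> \<in> L" using cylinderD(3)[OF \<rho>] \<tau> by blast
      then have "card \<tau> \<le> card (\<mu> ` \<tau>)" "card (\<mu> ` \<tau>) \<le> card \<tau>" "finite \<tau>"
        using LD(2) Li(1,2) card_image_le[of "\<mu> ` \<tau>" \<mu>] card_image_le[of \<tau> \<mu>] by auto
      then have "\<tau> = \<mu> ` \<tau>" using cmp by (metis card_seteq finite_imageI)
      then show False using Li(3) \<open>\<tau> \<in> L\<close> by metis
    qed
  qed
  ultimately show ?thesis unfolding free_Z2_complex_def by (metis (no_types, lifting) UnionE)
qed

text \<open>By \<open>split\<close>, \<open>V\<close> selects a union of components of
  \<open>K\<close>. First all members meeting the other components are removed: with the part
  \<open>\<sigma>\<close> outside \<open>V\<close> fixed, they form a cone over the image of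
  \<open>\<sigma>\<close>. Then all nonempty chains are removed: with the chain fixed, the possible
  parts in \<open>V\<close> form a fibre. The \<open>V\<close> part of \<open>K\<close>
  remains.\<close>

lemma Z2_collapses_cylinder:
  assumes K: "free_Z2_complex K \<nu>" and L: "free_Z2_complex L \<mu>"
    and eqv: "\<And>v. v \<in> \<Union>K \<Longrightarrow> f (\<nu> v) = \<mu> (f v)"
    and simplicial: "\<And>\<sigma>. \<sigma> \<in> K \<Longrightarrow> f ` \<sigma> \<in> L"
    and inv: "\<And>v. v \<in> \<Union>K \<Longrightarrow> \<nu> v \<in> V \<longleftrightarrow> v \<in> V"
    and split: "\<And>\<sigma>. \<sigma> \<in> K \<Longrightarrow> \<sigma> \<subseteq> V \<or> \<sigma> \<inter> V = {}"
    and fibres: "\<And>\<tau>. \<tau> \<in> L \<Longrightarrow> removable {\<sigma> \<in> insert {} K. \<sigma> \<subseteq> V \<and> f ` \<sigma> \<subseteq> \<tau>}"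
  shows "Z2_collapses (cylinder_involution \<nu> \<mu>) (cylinder f K L) (image Inl ` {\<sigma> \<in> K. \<sigma> \<subseteq> V})"
proof -
  let ?M = "cylinder f K L" and ?\<kappa> = "cylinder_involution \<nu> \<mu>"
  have free: "free_Z2_complex ?M ?\<kappa>" by (rule free_Z2_complex_cylinder[OF K L]) (rule eqv)
  note MD = free_Z2_complexD[OF free]
  have vK: "v \<in> \<Union>K" if "Inl v \<in> \<Union>?M" for v
  proof -
    from that obtain \<rho> where "\<rho> \<in> ?M" "v \<in> Inl -` \<rho>" by blast
    then show ?thesis using cylinderD(4) by blast
  qed
  define D where "D = (Inl ` (- V) :: ('a + 'b set) set)"
  define M1 where "M1 = {\<rho> \<in> ?M. \<rho> \<inter> D = {}}"
  have c1: "Z2_collapses ?\<kappa> ?M M1"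
    unfolding M1_def
  proof (rule Z2_collapses_parts[OF free])
    fix x assume "x \<in> \<Union>?M"
    then show "?\<kappa> x \<in> D \<longleftrightarrow> x \<in> D"
      using vK inv by (cases x) (auto simp: D_def)
  next
    fix q assume q: "q \<in> ?M" "q \<subseteq> D"
    define \<sigma> where "\<sigma> = Inl -` q"
    have q_eq: "q = Inl ` \<sigma>" using q(2) unfolding \<sigma>_def D_def by auto
    have "\<sigma> \<noteq> {}" using q q_eq MD(3) by auto
    then have \<sigma>: "\<sigma> \<in> K" "\<sigma> \<inter> V = {}" "\<sigma> \<noteq> {}"
      using q cylinderD(2)[OF q(1)] unfolding q_eq by (auto simp: D_def)
    have Inl: "Inl -` \<rho> = \<sigma>" if "\<rho> \<in> ?M" "\<rho> \<inter> D = q" for \<rho>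
    proof -
      have sub: "\<sigma> \<subseteq> Inl -` \<rho>" using that unfolding q_eq by auto
      then have "Inl -` \<rho> \<in> K" using \<sigma>(3) cylinderD(2)[OF that(1)] by blast
      then have "Inl -` \<rho> \<inter> V = {}" using split \<sigma> sub by blast
      then have "Inl ` (Inl -` \<rho>) \<subseteq> q" using that unfolding D_def by blast
      then show ?thesis using sub unfolding q_eq by blast
    qed
    have "Inr y \<notin> D" for y by (auto simp: D_def)
    then have Dins: "insert (Inr y) \<rho> \<inter> D = \<rho> \<inter> D" "(\<rho> - {Inr y}) \<inter> D = \<rho> \<inter> D" for y \<rho> by auto
    show "removable {\<rho> \<in> ?M. \<rho> \<inter> D = q}"
    \<comment> \<open>The image of \<open>\<sigma>\<close> is the least simplex of \<open>L\<close>
      that may be joined to \<open>\<sigma>\<close>, so it is comparable with every member of the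
      chain and can be added freely.\<close>
    proof (rule removable_cone[where v = "Inr (f ` \<sigma>)"])
      fix \<rho> assume \<rho>: "\<rho> \<in> {\<rho> \<in> ?M. \<rho> \<inter> D = q}"
      then have l: "Inl -` \<rho> = \<sigma>" using Inl by blast
      have \<rho>M: "\<rho> \<in> ?M" using \<rho> by simp
      have "insert (Inr (f ` \<sigma>)) \<rho> \<in> ?M"
      proof (rule cylinderI, simp_all only: sum_vimage_simps l)
        show "\<sigma> \<in> insert {} K" using \<sigma> by simp
        show "insert (f ` \<sigma>) (Inr -` \<rho>) \<subseteq> L"
          using cylinderD(3)[OF \<rho>M] simplicial[OF \<sigma>(1)] by simp
      next
        fix \<tau> assume \<tau>: "\<tau> \<in> insert (f ` \<sigma>) (Inr -` \<rho>)"
        have sub: "f ` \<sigma> \<subseteq> \<tau>" if "\<tau> \<in> insert (f ` \<sigma>) (Inr -` \<rho>)" for \<tau>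
          using cylinderD(5)[OF \<rho>M, of \<tau>] that unfolding l by blast
        show "f ` \<sigma> \<subseteq> \<tau>" using sub \<tau> .
        fix \<tau>' assume \<tau>': "\<tau>' \<in> insert (f ` \<sigma>) (Inr -` \<rho>)"
        show "\<tau> \<subseteq> \<tau>' \<or> \<tau>' \<subseteq> \<tau>"
          using \<tau> \<tau>' sub[OF \<tau>] sub[OF \<tau>'] cylinderD(6)[OF \<rho>M, of \<tau> \<tau>'] by (elim insertE) simp_all
      qed simp
      then show "insert (Inr (f ` \<sigma>)) \<rho> \<in> {\<rho> \<in> ?M. \<rho> \<inter> D = q}" using \<rho> Dins by simp
      have "Inl ` \<sigma> \<subseteq> \<rho> - {Inr (f ` \<sigma>)}" using l by auto
      then have "\<rho> - {Inr (f ` \<sigma>)} \<in> ?M"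
        using \<rho> \<sigma>(3) MD(4)[of \<rho> "\<rho> - {Inr (f ` \<sigma>)}"] by blast
      then show "\<rho> - {Inr (f ` \<sigma>)} \<in> {\<rho> \<in> ?M. \<rho> \<inter> D = q}" using \<rho> Dins by simp
    qed (use MD in auto)
  qed
  have M1: "\<rho> \<in> M1 \<longleftrightarrow> \<rho> \<in> ?M \<and> Inl -` \<rho> \<subseteq> V" for \<rho>
    unfolding M1_def D_def by auto
  have free1: "free_Z2_complex M1 ?\<kappa>" using Z2_collapses_free[OF c1 free] .
  note M1D = free_Z2_complexD[OF free1]
  have "Z2_collapses ?\<kappa> M1 {\<rho> \<in> M1. \<rho> \<inter> range Inr = {}}"
  proof (rule Z2_collapses_parts[OF free1])
    fix x assume "x \<in> \<Union>M1"
    show "?\<kappa> x \<in> range Inr \<longleftrightarrow> x \<in> range Inr" by (cases x) auto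
  next
    fix q assume q: "q \<in> M1" "q \<subseteq> range Inr"
    define c where "c = Inr -` q"
    have q_eq: "q = Inr ` c" using q(2) unfolding c_def by auto
    have "q \<noteq> {}" "finite q" using q M1D by auto
    then have "c \<noteq> {}" "finite c" using q_eq by (auto dest: finite_imageD simp: inj_Inr)
    then obtain \<tau>0 where \<tau>0: "\<tau>0 \<in> c" and min: "\<And>\<tau>. \<tau> \<in> c \<Longrightarrow> \<tau> \<subseteq> \<tau>0 \<Longrightarrow> \<tau>0 = \<tau>"
      using finite_has_minimal[of c] by blast
    have c: "c \<subseteq> L" "\<And>\<tau> \<tau>'. \<tau> \<in> c \<Longrightarrow> \<tau>' \<in> c \<Longrightarrow> \<tau> \<subseteq> \<tau>' \<or> \<tau>' \<subseteq> \<tau>"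
      using q(1) cylinderD(3,6)[of q f K L] unfolding M1 c_def by blast+
    have least: "\<tau>0 \<subseteq> \<tau>" if "\<tau> \<in> c" for \<tau> using c(2)[OF that \<tau>0] min[OF that] by blast
    \<comment> \<open>Containment of the image of \<open>\<sigma>\<close> in all members of
      \<open>c\<close> reduces to containment in the least one, so the block is a copy of the fibre
      over \<open>\<tau>0\<close>. The empty \<open>\<sigma>\<close> corresponds to the bare chain,
      which is why fibres include the empty set.\<close>
    have "{\<rho> \<in> M1. \<rho> \<inter> range Inr = q} =
      (\<lambda>\<sigma>. Inl ` \<sigma> \<union> Inr ` c) ` {\<sigma> \<in> insert {} K. \<sigma> \<subseteq> V \<and> f ` \<sigma> \<subseteq> \<tau>0}"
    proof (intro equalityI subsetI)
      fix \<rho> assume \<rho>: "\<rho> \<in> {\<rho> \<in> M1. \<rho> \<inter> range Inr = q}"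
      then have "Inr -` \<rho> = c" unfolding q_eq by auto
      then have eq: "\<rho> = Inl ` (Inl -` \<rho>) \<union> Inr ` c" using sum_set_decomp[of \<rho>] by simp
      have "f ` (Inl -` \<rho>) \<subseteq> \<tau>0" "Inl -` \<rho> \<subseteq> V" "Inl -` \<rho> \<in> insert {} K"
        using \<rho> \<open>Inr -` \<rho> = c\<close> \<tau>0 cylinderD(2,5)[of \<rho> f K L] unfolding M1 by blast+
      then have "Inl -` \<rho> \<in> {\<sigma> \<in> insert {} K. \<sigma> \<subseteq> V \<and> f ` \<sigma> \<subseteq> \<tau>0}" by simp
      then show "\<rho> \<in> (\<lambda>\<sigma>. Inl ` \<sigma> \<union> Inr ` c) ` {\<sigma> \<in> insert {} K. \<sigma> \<subseteq> V \<and> f ` \<sigma> \<subseteq> \<tau>0}"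
        using eq by (rule rev_image_eqI)
    next
      fix \<rho> assume "\<rho> \<in> (\<lambda>\<sigma>. Inl ` \<sigma> \<union> Inr ` c) ` {\<sigma> \<in> insert {} K. \<sigma> \<subseteq> V \<and> f ` \<sigma> \<subseteq> \<tau>0}"
      then obtain \<sigma> where \<sigma>: "\<rho> = Inl ` \<sigma> \<union> Inr ` c" "\<sigma> \<in> insert {} K" "\<sigma> \<subseteq> V" "f ` \<sigma> \<subseteq> \<tau>0"
        by auto
      have "f ` \<sigma> \<subseteq> \<tau>" if "\<tau> \<in> c" for \<tau> using \<sigma>(4) least[OF that] by blast
      moreover have "\<rho> \<noteq> {}" unfolding \<sigma>(1) using \<open>c \<noteq> {}\<close> by simp
      ultimately have "\<rho> \<in> ?M" unfolding \<sigma>(1) using \<sigma>(2) c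
        by (intro cylinderI) (simp_all only: sum_vimage_simps not_False_eq_True)
      then have "\<rho> \<in> M1" unfolding M1 unfolding \<sigma>(1) using \<sigma>(3) by simp
      moreover have "\<rho> \<inter> range Inr = q" unfolding q_eq \<sigma>(1) by auto
      ultimately show "\<rho> \<in> {\<rho> \<in> M1. \<rho> \<inter> range Inr = q}" by simp
    qed
    moreover have "removable ((\<lambda>\<sigma>. Inl ` \<sigma> \<union> Inr ` c) ` {\<sigma> \<in> insert {} K. \<sigma> \<subseteq> V \<and> f ` \<sigma> \<subseteq> \<tau>0})"
    proof (rule removable_image)
      have inj: "Inl ` \<sigma> \<union> Inr ` c \<subseteq> Inl ` \<sigma>' \<union> Inr ` c \<longleftrightarrow> \<sigma> \<subseteq> \<sigma>'" for \<sigma> \<sigma>' :: "'a set"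
        by auto
      show "removable {\<sigma> \<in> insert {} K. \<sigma> \<subseteq> V \<and> f ` \<sigma> \<subseteq> \<tau>0}" using fibres \<tau>0 c by blast
      show "inj_on (\<lambda>\<sigma>. Inl ` \<sigma> \<union> Inr ` c) {\<sigma> \<in> insert {} K. \<sigma> \<subseteq> V \<and> f ` \<sigma> \<subseteq> \<tau>0}"
        by (intro inj_onI subset_antisym) (simp_all only: inj[symmetric] subset_refl)
      show "Inl ` \<sigma> \<union> Inr ` c \<subset> Inl ` \<sigma>' \<union> Inr ` c \<longleftrightarrow> \<sigma> \<subset> \<sigma>'" for \<sigma> \<sigma>' :: "'a set"
        by (simp only: less_le_not_le inj)
    qed
    ultimately show "removable {\<rho> \<in> M1. \<rho> \<inter> range Inr = q}" by simp
  qed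
  moreover have "{\<rho> \<in> M1. \<rho> \<inter> range Inr = {}} = image Inl ` {\<sigma> \<in> K. \<sigma> \<subseteq> V}"
  proof (intro equalityI subsetI)
    fix \<rho> assume \<rho>: "\<rho> \<in> {\<rho> \<in> M1. \<rho> \<inter> range Inr = {}}"
    then have "Inr -` \<rho> = {}" by auto
    then have eq: "\<rho> = Inl ` (Inl -` \<rho>)" using sum_set_decomp[of \<rho>] by simp
    have "\<rho> \<noteq> {}" using \<rho> M1D(3) by blast
    then have "Inl -` \<rho> \<noteq> {}" using eq by (metis image_empty)
    then have "Inl -` \<rho> \<in> {\<sigma> \<in> K. \<sigma> \<subseteq> V}"
      using \<rho> cylinderD(2)[of \<rho> f K L] unfolding M1 by blast
    then show "\<rho> \<in> image Inl ` {\<sigma> \<in> K. \<sigma> \<subseteq> V}" using eq by (rule rev_image_eqI)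
  next
    fix \<rho> :: "('a + 'b set) set" assume "\<rho> \<in> image Inl ` {\<sigma> \<in> K. \<sigma> \<subseteq> V}"
    then obtain \<sigma> where "\<rho> = Inl ` \<sigma>" "\<sigma> \<in> K" "\<sigma> \<subseteq> V" by auto
    moreover from this have "\<rho> \<in> ?M"
      using free_Z2_complexD(3)[OF K] by (intro cylinderI) auto
    ultimately show "\<rho> \<in> {\<rho> \<in> M1. \<rho> \<inter> range Inr = {}}"
      unfolding M1 by auto
  qed
  ultimately show ?thesis using Z2_collapses_trans[OF c1] by simp
qed


section \<open>The double mapping cylinder and its two collapses\<close>

definition disjoint_union :: "'v set set \<Rightarrow> 'w set set \<Rightarrow> ('v + 'w) set set" where
  "disjoint_union K L = image Inl ` K \<union> image Inr ` L"

lemma free_Z2_complex_disjoint_union: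
  assumes K: "free_Z2_complex K \<nu>" and L: "free_Z2_complex L \<mu>"
  shows "free_Z2_complex (disjoint_union K L) (map_sum \<nu> \<mu>)"
proof -
  note KD = free_Z2_complexD[OF K] and LD = free_Z2_complexD[OF L]
  note Ki = free_Z2_complex_involution[OF K] and Li = free_Z2_complex_involution[OF L]
  have "finite_abstract_complex (disjoint_union K L)"
    unfolding finite_abstract_complex_def
  proof (intro conjI ballI allI impI)
    show "finite (disjoint_union K L)" using KD LD by (simp add: disjoint_union_def)
    fix \<rho> assume \<rho>: "\<rho> \<in> disjoint_union K L"
    show "finite \<rho>" "\<rho> \<noteq> {}" using \<rho> KD(2,3) LD(2,3) by (auto simp: disjoint_union_def)
    fix \<rho>' assume \<rho>': "\<rho>' \<noteq> {} \<and> \<rho>' \<subseteq> \<rho>"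
    consider \<sigma> where "\<rho> = Inl ` \<sigma>" "\<sigma> \<in> K" | \<sigma> where "\<rho> = Inr ` \<sigma>" "\<sigma> \<in> L"
      using \<rho> unfolding disjoint_union_def by blast
    then show "\<rho>' \<in> disjoint_union K L"
    proof cases
      case (1 \<sigma>)
      then obtain \<sigma>' where "\<sigma>' \<subseteq> \<sigma>" "\<rho>' = Inl ` \<sigma>'"
        using \<rho>' subset_image_iff[of \<rho>' Inl \<sigma>] by blast
      moreover from this have "\<sigma>' \<in> K" using \<rho>' by (intro KD(4)[OF 1(2)]) auto
      ultimately show ?thesis unfolding disjoint_union_def by blast
    next
      case (2 \<sigma>)
      then obtain \<sigma>' where "\<sigma>' \<subseteq> \<sigma>" "\<rho>' = Inr ` \<sigma>'"
        using \<rho>' subset_image_iff[of \<rho>' Inr \<sigma>] by blast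
      moreover from this have "\<sigma>' \<in> L" using \<rho>' by (intro LD(4)[OF 2(2)]) auto
      ultimately show ?thesis unfolding disjoint_union_def by blast
    qed
  qed
  moreover have "map_sum \<nu> \<mu> (map_sum \<nu> \<mu> x) = x" if "x \<in> \<Union>(disjoint_union K L)" for x
  proof (cases x)
    case (Inl v)
    then have "v \<in> \<Union>K" using that unfolding disjoint_union_def by blast
    then show ?thesis using Inl KD(5) by simp
  next
    case (Inr v)
    then have "v \<in> \<Union>L" using that unfolding disjoint_union_def by blast
    then show ?thesis using Inr LD(5) by simp
  qed
  moreover have "map_sum \<nu> \<mu> ` \<rho> \<in> disjoint_union K L \<and> map_sum \<nu> \<mu> ` \<rho> \<noteq> \<rho>"
    if \<rho>: "\<rho> \<in> disjoint_union K L" for \<rho>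
  proof -
    consider \<sigma> where "\<rho> = Inl ` \<sigma>" "\<sigma> \<in> K" | \<sigma> where "\<rho> = Inr ` \<sigma>" "\<sigma> \<in> L"
      using \<rho> unfolding disjoint_union_def by blast
    then show ?thesis
    proof cases
      case (1 \<sigma>)
      have eq: "map_sum \<nu> \<mu> ` \<rho> = Inl ` \<nu> ` \<sigma>" unfolding 1(1) image_image by simp
      have "Inl ` \<nu> ` \<sigma> \<noteq> \<rho>" unfolding 1(1) inj_image_eq_iff[OF inj_Inl] by (rule Ki(3)[OF 1(2)])
      then show ?thesis unfolding eq disjoint_union_def
        using Ki(2)[OF 1(2)] by (intro conjI UnI1 imageI)
    next
      case (2 \<sigma>)
      have eq: "map_sum \<nu> \<mu> ` \<rho> = Inr ` \<mu> ` \<sigma>" unfolding 2(1) image_image by simp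
      have "Inr ` \<mu> ` \<sigma> \<noteq> \<rho>" unfolding 2(1) inj_image_eq_iff[OF inj_Inr] by (rule Li(3)[OF 2(2)])
      then show ?thesis unfolding eq disjoint_union_def
        using Li(2)[OF 2(2)] by (intro conjI UnI2 imageI)
    qed
  qed
  ultimately show ?thesis unfolding free_Z2_complex_def by (metis (no_types, lifting))
qed

lemma image_sum_subset_range [simp]:
  "Inl ` \<sigma> \<subseteq> range Inl" "Inr ` \<tau> \<subseteq> range Inr"
  "Inl ` \<sigma> \<subseteq> range Inr \<longleftrightarrow> \<sigma> = {}" "Inr ` \<tau> \<subseteq> range Inl \<longleftrightarrow> \<tau> = {}"
  by auto

text \<open>As an ordinary cylinder over a disjoint union it has two possible cores for
  \<open>Z2_collapses_cylinder\<close>: \<open>V = range Inl\<close> calls for the fibres of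
  \<open>f\<close>, and \<open>V = range Inr\<close> for those of the identity of
  \<open>L\<close>.\<close>

definition double_cylinder :: "('v \<Rightarrow> 'w) \<Rightarrow> 'v set set \<Rightarrow> 'w set set \<Rightarrow> (('v + 'w) + 'w set) set set" where
  "double_cylinder f K L = cylinder (case_sum f id) (disjoint_union K L) L"

definition double_cylinder_involution ::
    "('v \<Rightarrow> 'v) \<Rightarrow> ('w \<Rightarrow> 'w) \<Rightarrow> ('v + 'w) + 'w set \<Rightarrow> ('v + 'w) + 'w set" where
  "double_cylinder_involution \<nu> \<mu> = cylinder_involution (map_sum \<nu> \<mu>) \<mu>"

context
  fixes K :: "'v set set" and \<nu> :: "'v \<Rightarrow> 'v" and L :: "'w set set" and \<mu> :: "'w \<Rightarrow> 'w" and f :: "'v \<Rightarrow> 'w"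
  assumes K: "free_Z2_complex K \<nu>" and L: "free_Z2_complex L \<mu>"
    and eqv: "\<And>v. v \<in> \<Union>K \<Longrightarrow> f (\<nu> v) = \<mu> (f v)"
    and simplicial: "\<And>\<sigma>. \<sigma> \<in> K \<Longrightarrow> f ` \<sigma> \<in> L"
begin

lemma double_cylinder_eqv:
  assumes "x \<in> \<Union>(disjoint_union K L)"
  shows "case_sum f id (map_sum \<nu> \<mu> x) = \<mu> (case_sum f id x)"
proof (cases x)
  case (Inl v)
  then have "v \<in> \<Union>K" using assms unfolding disjoint_union_def by blast
  then show ?thesis using Inl eqv by simp
qed simp

lemma double_cylinder_simplicial:
  assumes "\<sigma> \<in> disjoint_union K L"
  shows "case_sum f id ` \<sigma> \<in> L"
proof -
  consider \<sigma>' where "\<sigma> = Inl ` \<sigma>'" "\<sigma>' \<in> K" | \<sigma>' where "\<sigma> = Inr ` \<sigma>'" "\<sigma>' \<in> L"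
    using assms unfolding disjoint_union_def by blast
  then show ?thesis by cases (simp_all add: image_image simplicial)
qed

lemma free_Z2_complex_double_cylinder:
  "free_Z2_complex (double_cylinder f K L) (double_cylinder_involution \<nu> \<mu>)"
  unfolding double_cylinder_def double_cylinder_involution_def
proof (rule free_Z2_complex_cylinder[OF free_Z2_complex_disjoint_union[OF K L] L])
  show "case_sum f id (map_sum \<nu> \<mu> x) = \<mu> (case_sum f id x)" if "x \<in> \<Union>(disjoint_union K L)" for x
    using that by (rule double_cylinder_eqv)
qed

lemma Z2_collapses_double_cylinder_left:
  assumes fibres: "\<And>\<tau>. \<tau> \<in> L \<Longrightarrow> removable {\<sigma> \<in> insert {} K. f ` \<sigma> \<subseteq> \<tau>}"
  shows "Z2_collapses (double_cylinder_involution \<nu> \<mu>) (double_cylinder f K L) (image (Inl \<circ> Inl) ` K)"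
proof -
  have "Z2_collapses (double_cylinder_involution \<nu> \<mu>) (double_cylinder f K L)
      (image Inl ` {\<sigma> \<in> disjoint_union K L. \<sigma> \<subseteq> range Inl})"
    unfolding double_cylinder_def double_cylinder_involution_def
  proof (rule Z2_collapses_cylinder[OF free_Z2_complex_disjoint_union[OF K L] L])
    show "case_sum f id (map_sum \<nu> \<mu> x) = \<mu> (case_sum f id x)" if "x \<in> \<Union>(disjoint_union K L)" for x
      using that by (rule double_cylinder_eqv)
    show "case_sum f id ` \<sigma> \<in> L" if "\<sigma> \<in> disjoint_union K L" for \<sigma>
      using that by (rule double_cylinder_simplicial)
    fix x assume "x \<in> \<Union>(disjoint_union K L)"
    show "map_sum \<nu> \<mu> x \<in> range Inl \<longleftrightarrow> x \<in> range Inl" by (cases x) auto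
  next
    fix \<sigma> assume "\<sigma> \<in> disjoint_union K L"
    then show "\<sigma> \<subseteq> range Inl \<or> \<sigma> \<inter> range Inl = {}" unfolding disjoint_union_def by auto
  next
    fix \<tau> assume \<tau>: "\<tau> \<in> L"
    have "{\<sigma> \<in> insert {} (disjoint_union K L). \<sigma> \<subseteq> range Inl \<and> case_sum f id ` \<sigma> \<subseteq> \<tau>} =
        image Inl ` {\<sigma> \<in> insert {} K. f ` \<sigma> \<subseteq> \<tau>}" (is "?A = ?B")
    proof (intro equalityI subsetI)
      fix \<rho> assume \<rho>: "\<rho> \<in> ?A"
      then obtain \<sigma> where \<sigma>: "\<rho> = Inl ` \<sigma>" "\<sigma> \<in> insert {} K"
        using free_Z2_complexD(3)[OF L] unfolding disjoint_union_def by auto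
      then show "\<rho> \<in> ?B" using \<rho> by (intro image_eqI[of _ _ \<sigma>]) (auto simp: image_image)
    next
      fix \<rho> assume "\<rho> \<in> ?B"
      then show "\<rho> \<in> ?A" unfolding disjoint_union_def by (auto simp: image_image)
    qed
    moreover have "removable ?B"
      by (rule removable_image[OF fibres[OF \<tau>]]) (auto simp: inj_on_def inj_image_eq_iff psubset_eq image_subset_iff)
    ultimately show "removable ?A" by simp
  qed
  moreover have "{\<sigma> \<in> disjoint_union K L. \<sigma> \<subseteq> range Inl} = image Inl ` K"
    using free_Z2_complexD(3)[OF L] unfolding disjoint_union_def by auto
  ultimately show ?thesis by (simp add: image_comp image_comp[symmetric, of _ "image Inl"] o_def image_image)
qed

text \<open>The fibre of the identity over \<open>\<tau>\<close> is a copy of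
  \<open>Pow \<tau>\<close>, which is a cone with any vertex of \<open>\<tau>\<close> as
  apex.\<close>

lemma Z2_collapses_double_cylinder_right:
  "Z2_collapses (double_cylinder_involution \<nu> \<mu>) (double_cylinder f K L) (image (Inl \<circ> Inr) ` L)"
proof -
  have "Z2_collapses (double_cylinder_involution \<nu> \<mu>) (double_cylinder f K L)
      (image Inl ` {\<sigma> \<in> disjoint_union K L. \<sigma> \<subseteq> range Inr})"
    unfolding double_cylinder_def double_cylinder_involution_def
  proof (rule Z2_collapses_cylinder[OF free_Z2_complex_disjoint_union[OF K L] L])
    show "case_sum f id (map_sum \<nu> \<mu> x) = \<mu> (case_sum f id x)" if "x \<in> \<Union>(disjoint_union K L)" for x
      using that by (rule double_cylinder_eqv)
    show "case_sum f id ` \<sigma> \<in> L" if "\<sigma> \<in> disjoint_union K L" for \<sigma>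
      using that by (rule double_cylinder_simplicial)
    fix x assume "x \<in> \<Union>(disjoint_union K L)"
    show "map_sum \<nu> \<mu> x \<in> range Inr \<longleftrightarrow> x \<in> range Inr" by (cases x) auto
  next
    fix \<sigma> assume "\<sigma> \<in> disjoint_union K L"
    then show "\<sigma> \<subseteq> range Inr \<or> \<sigma> \<inter> range Inr = {}" unfolding disjoint_union_def by auto
  next
    fix \<tau> assume \<tau>: "\<tau> \<in> L"
    have "{\<sigma> \<in> insert {} (disjoint_union K L). \<sigma> \<subseteq> range Inr \<and> case_sum f id ` \<sigma> \<subseteq> \<tau>} =
        image Inr ` Pow \<tau>" (is "?A = ?B")
    proof (intro equalityI subsetI)
      fix \<rho> assume \<rho>: "\<rho> \<in> ?A"
      then obtain \<sigma> where \<sigma>: "\<rho> = Inr ` \<sigma>"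
        using free_Z2_complexD(3)[OF K] unfolding disjoint_union_def by auto
      then show "\<rho> \<in> ?B" using \<rho> by (intro image_eqI[of _ _ \<sigma>]) (auto simp: image_image)
    next
      fix \<rho> assume "\<rho> \<in> ?B"
      then obtain \<sigma> where \<sigma>: "\<rho> = Inr ` \<sigma>" "\<sigma> \<subseteq> \<tau>" by auto
      then have "\<sigma> \<in> insert {} L" using free_Z2_complexD(4)[OF L \<tau>] by blast
      then show "\<rho> \<in> ?A" using \<sigma> unfolding disjoint_union_def by (auto simp: image_image)
    qed
    moreover have "removable ?B"
    proof (rule removable_image)
      have "finite \<tau>" "\<tau> \<noteq> {}" using free_Z2_complexD(2,3)[OF L \<tau>] .
      then show "removable (Pow \<tau>)"
        by (intro removable_cone[where v = "SOME v. v \<in> \<tau>"])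
           (auto intro: finite_subset simp: some_in_eq)
    qed (auto simp: inj_on_def inj_image_eq_iff psubset_eq image_subset_iff)
    ultimately show "removable ?A" by simp
  qed
  moreover have "{\<sigma> \<in> disjoint_union K L. \<sigma> \<subseteq> range Inr} = image Inr ` L"
    using free_Z2_complexD(3)[OF K] unfolding disjoint_union_def by auto
  ultimately show ?thesis by (simp add: image_comp image_comp[symmetric, of _ "image Inl"] o_def image_image)
qed

end


section \<open>Simple homotopy equivalence\<close>

text \<open>Conjugation of \<open>\<nu>\<close> by a relabelling \<open>e\<close> that is injective
  on \<open>V\<close>; it serves to move a sequence of collapses to natural numbers. One set
  \<open>V\<close> holding all vertices that occur yields one involution for the whole
  sequence.\<close>

definition transport :: "('v \<Rightarrow> 'w) \<Rightarrow> 'v set \<Rightarrow> ('v \<Rightarrow> 'v) \<Rightarrow> 'w \<Rightarrow> 'w" where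
  "transport e V \<nu> = e \<circ> \<nu> \<circ> inv_into V e"

lemma transport_image:
  assumes "inj_on e V" "\<sigma> \<subseteq> V"
  shows "transport e V \<nu> ` e ` \<sigma> = e ` \<nu> ` \<sigma>"
  unfolding image_image transport_def using assms by (intro image_cong) auto

lemma free_Z2_complex_vertices:
  assumes "free_Z2_complex K \<nu>" "v \<in> \<Union>K"
  shows "\<nu> v \<in> \<Union>K"
  using assms free_Z2_complex_involution(2)[OF assms(1)] by blast

lemma free_Z2_complex_transport:
  assumes K: "free_Z2_complex K \<nu>" and e: "inj_on e V" and V: "\<Union>K \<subseteq> V"
  shows "free_Z2_complex (image e ` K) (transport e V \<nu>)"
proof -
  note KD = free_Z2_complexD[OF K] and Ki = free_Z2_complex_involution[OF K]
  have sub: "\<sigma> \<subseteq> V" if "\<sigma> \<in> K" for \<sigma> using that V by blast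
  have "finite_abstract_complex (image e ` K)"
    unfolding finite_abstract_complex_def
  proof (intro conjI ballI allI impI)
    show "finite (image e ` K)" using KD by simp
    fix \<rho> assume "\<rho> \<in> image e ` K"
    then obtain \<sigma> where \<sigma>: "\<rho> = e ` \<sigma>" "\<sigma> \<in> K" by blast
    show "finite \<rho>" "\<rho> \<noteq> {}" using KD(2,3)[OF \<sigma>(2)] \<sigma>(1) by simp_all
    fix \<rho>' assume \<rho>': "\<rho>' \<noteq> {} \<and> \<rho>' \<subseteq> \<rho>"
    then obtain \<sigma>' where "\<sigma>' \<subseteq> \<sigma>" "\<rho>' = e ` \<sigma>'" unfolding \<sigma>(1) by (metis subset_image_iff)
    then show "\<rho>' \<in> image e ` K" using KD(4)[OF \<sigma>(2)] \<rho>' by blast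
  qed
  moreover have "transport e V \<nu> (transport e V \<nu> x) = x" if x: "x \<in> \<Union>(image e ` K)" for x
  proof -
    from x obtain v where v: "v \<in> \<Union>K" "x = e v" by blast
    moreover have "\<nu> v \<in> V" "v \<in> V" using free_Z2_complex_vertices[OF K v(1)] V v(1) by blast+
    ultimately show ?thesis using KD(5) e by (simp add: transport_def)
  qed
  moreover have "transport e V \<nu> ` \<rho> \<in> image e ` K \<and> transport e V \<nu> ` \<rho> \<noteq> \<rho>"
    if \<rho>: "\<rho> \<in> image e ` K" for \<rho>
  proof -
    from \<rho> obtain \<sigma> where \<sigma>: "\<rho> = e ` \<sigma>" "\<sigma> \<in> K" by blast
    have "transport e V \<nu> ` \<rho> = e ` \<nu> ` \<sigma>"
      unfolding \<sigma>(1) by (rule transport_image[OF e sub[OF \<sigma>(2)]])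
    then show ?thesis
      using Ki(2,3)[OF \<sigma>(2)] \<sigma> inj_on_image_eq_iff[OF e sub sub] by auto
  qed
  ultimately show ?thesis unfolding free_Z2_complex_def by (intro conjI ballI) simp_all
qed

lemma Z2_elementary_collapse_transport:
  assumes "Z2_elementary_collapse (K, \<nu>) (L, \<nu>)" "inj_on e V" "\<Union>K \<subseteq> V"
  shows "Z2_elementary_collapse (image e ` K, transport e V \<nu>) (image e ` L, transport e V \<nu>)"
  using assms(1)
proof cases
  case (1 \<tau> \<sigma>)
  have sub: "\<rho> \<subseteq> V" if "\<rho> \<in> K" for \<rho> using that assms(3) by blast
  have \<sigma>: "\<sigma> \<in> K" using 1 by blast
  have n: "\<nu> ` \<rho> \<in> K" "transport e V \<nu> ` e ` \<rho> = e ` \<nu> ` \<rho>" if "\<rho> \<in> K" for \<rho>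
    using free_Z2_complex_involution(2)[OF 1(1) that] transport_image[OF assms(2) sub[OF that]] .
  have iff: "e ` \<rho> \<subset> e ` \<rho>' \<longleftrightarrow> \<rho> \<subset> \<rho>'" if "\<rho> \<in> K" "\<rho>' \<in> K" for \<rho> \<rho>'
  proof -
    have "e ` A \<subseteq> e ` B \<longleftrightarrow> A \<subseteq> B" if "A \<subseteq> V" "B \<subseteq> V" for A B
      using that inj_onD[OF assms(2)] by blast
    then show ?thesis using sub that by (simp add: less_le_not_le)
  qed
  show ?thesis
  proof (rule Z2_elementary_collapse.intros)
    show "free_Z2_complex (image e ` K) (transport e V \<nu>)"
      using free_Z2_complex_transport[OF 1(1) assms(2,3)] .
    show "e ` \<tau> \<in> image e ` K" using 1 by blast
    have "{\<rho> \<in> image e ` K. e ` \<tau> \<subset> \<rho>} = image e ` {\<rho> \<in> K. \<tau> \<subset> \<rho>}"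
      using iff[OF 1(2)] by (intro set_eqI) (simp add: image_iff, blast)
    then show "{\<rho> \<in> image e ` K. e ` \<tau> \<subset> \<rho>} = {e ` \<sigma>}" using 1(3) by simp
    have "inj_on (image e) K"
      using sub inj_on_image_eq_iff[OF assms(2)] by (auto intro!: inj_onI)
    then have "image e ` L = image e ` K - image e ` {\<tau>, \<sigma>, \<nu> ` \<tau>, \<nu> ` \<sigma>}"
      unfolding 1(4) using n(1) 1(2) \<sigma> by (intro inj_on_image_set_diff[of _ K]) auto
    then show "image e ` L = image e ` K - {e ` \<tau>, e ` \<sigma>, transport e V \<nu> ` e ` \<tau>, transport e V \<nu> ` e ` \<sigma>}"
      using n(2) 1(2) \<sigma> by simp
  qed simp
qed

lemma Z2_collapses_transport:
  assumes "Z2_collapses \<nu> K L" "inj_on e V" "\<Union>K \<subseteq> V"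
  shows "Z2_elementary_collapse\<^sup>*\<^sup>* (image e ` K, transport e V \<nu>) (image e ` L, transport e V \<nu>)"
    and "\<Union>L \<subseteq> V"
proof -
  have "Z2_elementary_collapse\<^sup>*\<^sup>* (image e ` K, transport e V \<nu>) (image e ` L, transport e V \<nu>) \<and> \<Union>L \<subseteq> V"
    using assms(1) unfolding Z2_collapses_def
  proof (induction rule: rtranclp_induct)
    case (step L M)
    then have "Z2_elementary_collapse (image e ` L, transport e V \<nu>) (image e ` M, transport e V \<nu>)"
      using Z2_elementary_collapse_transport[OF step.hyps(2) assms(2)] by blast
    moreover have "M \<subseteq> L" using step(2) by cases blast
    ultimately show ?case using step.IH by (metis (no_types, lifting) Union_mono rtranclp.rtrancl_into_rtrancl subset_trans)
  qed (use assms(3) in auto)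
  then show "Z2_elementary_collapse\<^sup>*\<^sup>* (image e ` K, transport e V \<nu>) (image e ` L, transport e V \<nu>)"
    and "\<Union>L \<subseteq> V" by auto
qed

lemma Z2_isomorphic_image:
  assumes "inj_on g (\<Union>K)" "\<And>v. v \<in> \<Union>K \<Longrightarrow> g (\<nu> v) = \<mu> (g v)"
  shows "Z2_isomorphic (K, \<nu>) (image g ` K, \<mu>)"
  unfolding Z2_isomorphic_def prod.case
  using assms by (intro exI[of _ g] conjI ballI) (simp_all add: bij_betw_def image_Union)

lemma Z2_isomorphic_image':
  assumes "inj_on g (\<Union>K)" "\<And>v. v \<in> \<Union>K \<Longrightarrow> g (\<nu> v) = \<mu> (g v)" "\<And>v. v \<in> \<Union>K \<Longrightarrow> \<nu> v \<in> \<Union>K"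
  shows "Z2_isomorphic (image g ` K, \<mu>) (K, \<nu>)"
  unfolding Z2_isomorphic_def prod.case
proof (intro exI[of _ "inv_into (\<Union>K) g"] conjI ballI)
  have U: "\<Union>(image g ` K) = g ` \<Union>K" by blast
  show "bij_betw (inv_into (\<Union>K) g) (\<Union>(image g ` K)) (\<Union>K)"
    unfolding U using assms(1) by (intro bij_betw_inv_into) (simp add: bij_betw_def)
  have "inv_into (\<Union>K) g ` g ` \<sigma> = \<sigma>" if "\<sigma> \<in> K" for \<sigma>
    using that assms(1) by (intro inv_into_image_cancel) auto
  then show "image (inv_into (\<Union>K) g) ` image g ` K = K" by (simp add: image_image)
  fix x assume "x \<in> \<Union>(image g ` K)"
  then obtain v where v: "v \<in> \<Union>K" "x = g v" unfolding U by blast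
  have "\<mu> x = g (\<nu> v)" using assms(2) v by simp
  then show "inv_into (\<Union>K) g (\<mu> x) = \<nu> (inv_into (\<Union>K) g x)"
    using v assms(1,3) by (metis inv_into_f_f)
qed

text \<open>The double cylinder, relabelled by natural numbers, collapses to copies of both
  complexes. Expanding from the copy of \<open>K\<close> and collapsing to the copy of
  \<open>L\<close> is the required sequence.\<close>

theorem Z2_simple_homotopy_equivalent_removable_fibres:
  assumes K: "free_Z2_complex K \<nu>" and L: "free_Z2_complex L \<mu>"
    and eqv: "\<And>v. v \<in> \<Union>K \<Longrightarrow> f (\<nu> v) = \<mu> (f v)"
    and simplicial: "\<And>\<sigma>. \<sigma> \<in> K \<Longrightarrow> f ` \<sigma> \<in> L"
    and fibres: "\<And>\<tau>. \<tau> \<in> L \<Longrightarrow> removable {\<sigma> \<in> insert {} K. f ` \<sigma> \<subseteq> \<tau>}"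
  shows "Z2_simple_homotopy_equivalent (K, \<nu>) (L, \<mu>)"
proof -
  define M where "M = double_cylinder f K L"
  define \<kappa> where "\<kappa> = double_cylinder_involution \<nu> \<mu>"
  define V where "V = \<Union>M"
  have "free_Z2_complex M \<kappa>" unfolding M_def \<kappa>_def
    by (rule free_Z2_complex_double_cylinder[OF K L]) (simp_all only: eqv simplicial)
  then have "finite V" unfolding V_def by (rule free_Z2_complexD(6))
  then obtain e :: "('a + 'b) + 'b set \<Rightarrow> nat" where e: "inj_on e V"
    using finite_imp_inj_to_nat_seg by metis
  let ?\<nu> = "transport e V \<kappa>"
  have cK: "Z2_collapses \<kappa> M (image (Inl \<circ> Inl) ` K)" unfolding M_def \<kappa>_def
    by (rule Z2_collapses_double_cylinder_left[OF K L]) (simp_all only: eqv simplicial fibres)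
  have cL: "Z2_collapses \<kappa> M (image (Inl \<circ> Inr) ` L)" unfolding M_def \<kappa>_def
    by (rule Z2_collapses_double_cylinder_right[OF K L]) (simp_all only: eqv simplicial)
  have VM: "\<Union>M \<subseteq> V" unfolding V_def by blast
  note tK = Z2_collapses_transport[OF cK e VM] and tL = Z2_collapses_transport[OF cL e VM]
  have im: "image e ` image h ` A = image (e \<circ> h) ` A" for h :: "'c \<Rightarrow> _" and A
    by (simp add: image_image image_comp o_def)
  have VK: "Inl (Inl v) \<in> V" if "v \<in> \<Union>K" for v using tK(2) that by auto
  have VL: "Inl (Inr v) \<in> V" if "v \<in> \<Union>L" for v using tL(2) that by auto
  have "Z2_isomorphic (K, \<nu>) (image (e \<circ> (Inl \<circ> Inl)) ` K, ?\<nu>)"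
  proof (rule Z2_isomorphic_image)
    show "inj_on (e \<circ> (Inl \<circ> Inl)) (\<Union>K)" using VK inj_onD[OF e] by (intro inj_onI) (simp, blast)
    fix v assume "v \<in> \<Union>K"
    then show "(e \<circ> (Inl \<circ> Inl)) (\<nu> v) = ?\<nu> ((e \<circ> (Inl \<circ> Inl)) v)"
      using VK e by (simp add: transport_def \<kappa>_def double_cylinder_involution_def)
  qed
  moreover have "Z2_isomorphic (image (e \<circ> (Inl \<circ> Inr)) ` L, ?\<nu>) (L, \<mu>)"
  proof (rule Z2_isomorphic_image')
    show "inj_on (e \<circ> (Inl \<circ> Inr)) (\<Union>L)" using VL inj_onD[OF e] by (intro inj_onI) (simp, blast)
    fix v assume v: "v \<in> \<Union>L"
    then show "(e \<circ> (Inl \<circ> Inr)) (\<mu> v) = ?\<nu> ((e \<circ> (Inl \<circ> Inr)) v)"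
      using VL e by (simp add: transport_def \<kappa>_def double_cylinder_involution_def)
    show "\<mu> v \<in> \<Union>L" using free_Z2_complex_vertices[OF L v] .
  qed
  moreover have "equivclp Z2_elementary_collapse (image e ` M, ?\<nu>) (image e ` image (Inl \<circ> Inl) ` K, ?\<nu>)"
    "equivclp Z2_elementary_collapse (image e ` M, ?\<nu>) (image e ` image (Inl \<circ> Inr) ` L, ?\<nu>)"
    using tK(1) tL(1) by (simp_all only: rtranclp_into_equivclp)
  then have "equivclp Z2_elementary_collapse (image e ` image (Inl \<circ> Inl) ` K, ?\<nu>) (image e ` image (Inl \<circ> Inr) ` L, ?\<nu>)"
    by (meson equivclp_sym equivclp_trans)
  ultimately show ?thesis
    unfolding Z2_simple_homotopy_equivalent_def im using K L by auto
qed


section \<open>$\mathbb{Z}_2$-homotopy equivalences\<close>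

lemma Z2_mapD:
  assumes "Z2_map S \<nu> T \<mu> f"
  shows "continuous_map (top_of_set S) (top_of_set T) f" "\<And>x. x \<in> S \<Longrightarrow> f x \<in> T"
    "\<And>x. x \<in> S \<Longrightarrow> f (\<nu> x) = \<mu> (f x)"
  using assms unfolding Z2_map_def equivariant_on_def by auto

lemma Z2_map_comp:
  assumes "Z2_map S \<nu> T \<mu> f" "Z2_map T \<mu> U \<kappa> g"
  shows "Z2_map S \<nu> U \<kappa> (g \<circ> f)"
proof -
  have "continuous_on S (g \<circ> f)"
    using assms unfolding Z2_map_def by (meson continuous_on_compose continuous_on_subset)
  then show ?thesis
    using Z2_mapD(2,3)[OF assms(1)] Z2_mapD(2,3)[OF assms(2)]
    unfolding Z2_map_def equivariant_on_def by auto
qed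

lemma Z2_homotopic_comp_left:
  assumes "homotopic_with_canon (equivariant_on S \<nu> \<mu>) S T g h" "Z2_map T \<mu> U \<kappa> f"
  shows "homotopic_with_canon (equivariant_on S \<nu> \<kappa>) S U (f \<circ> g) (f \<circ> h)"
proof (rule homotopic_with_compose_continuous_map_left)
  \<comment> \<open>Equivariance of \<open>f\<close> is known on \<open>T\<close> only, so the
    property carried along the homotopy must also record that the intermediate maps land in
    \<open>T\<close>.\<close>
  show "homotopic_with_canon (\<lambda>j. equivariant_on S \<nu> \<mu> j \<and> (\<forall>x\<in>S. j x \<in> T)) S T g h"
    by (rule homotopic_with_mono[OF assms(1)]) auto
  show "continuous_map (top_of_set T) (top_of_set U) f" by (rule Z2_mapD(1)[OF assms(2)])
  show "equivariant_on S \<nu> \<kappa> (f \<circ> j)" if "equivariant_on S \<nu> \<mu> j \<and> (\<forall>x\<in>S. j x \<in> T)" for j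
    using that Z2_mapD(3)[OF assms(2)] unfolding equivariant_on_def by auto
qed

lemma Z2_homotopic_comp_right:
  assumes "homotopic_with_canon (equivariant_on T \<mu> \<kappa>) T U g h" "Z2_map S \<nu> T \<mu> f"
  shows "homotopic_with_canon (equivariant_on S \<nu> \<kappa>) S U (g \<circ> f) (h \<circ> f)"
proof (rule homotopic_with_compose_continuous_map_right[OF assms(1)])
  show "continuous_map (top_of_set S) (top_of_set T) f" by (rule Z2_mapD(1)[OF assms(2)])
  show "equivariant_on S \<nu> \<kappa> (j \<circ> f)" if "equivariant_on T \<mu> \<kappa> j" for j
    using that Z2_mapD(2,3)[OF assms(2)] unfolding equivariant_on_def by auto
qed

lemma Z2_homotopic_eq:
  assumes "Z2_map S \<nu> T \<mu> f" "\<And>x. x \<in> S \<Longrightarrow> f x = g x" "\<And>x. x \<in> S \<Longrightarrow> \<nu> x \<in> S"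
  shows "homotopic_with_canon (equivariant_on S \<nu> \<mu>) S T f g"
  using assms by (intro homotopic_with_equal) (auto simp: Z2_map_def equivariant_on_def)

lemma Z2_homotopy_equivalence_comp:
  assumes f: "Z2_homotopy_equivalence S \<nu> T \<mu> f" and g: "Z2_homotopy_equivalence T \<mu> U \<kappa> g"
  shows "Z2_homotopy_equivalence S \<nu> U \<kappa> (g \<circ> f)"
proof -
  obtain f' where f': "Z2_map T \<mu> S \<nu> f'"
    "homotopic_with_canon (equivariant_on S \<nu> \<nu>) S S (f' \<circ> f) id"
    "homotopic_with_canon (equivariant_on T \<mu> \<mu>) T T (f \<circ> f') id"
    using f unfolding Z2_homotopy_equivalence_def by blast
  obtain g' where g': "Z2_map U \<kappa> T \<mu> g'"
    "homotopic_with_canon (equivariant_on T \<mu> \<mu>) T T (g' \<circ> g) id"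
    "homotopic_with_canon (equivariant_on U \<kappa> \<kappa>) U U (g \<circ> g') id"
    using g unfolding Z2_homotopy_equivalence_def by blast
  have fm: "Z2_map S \<nu> T \<mu> f" and gm: "Z2_map T \<mu> U \<kappa> g"
    using f g unfolding Z2_homotopy_equivalence_def by blast+
  have "homotopic_with_canon (equivariant_on S \<nu> \<nu>) S S (f' \<circ> ((g' \<circ> g) \<circ> f)) (f' \<circ> (id \<circ> f))"
    by (intro Z2_homotopic_comp_left[OF _ f'(1)] Z2_homotopic_comp_right[OF g'(2)] fm)
  then have 1: "homotopic_with_canon (equivariant_on S \<nu> \<nu>) S S ((f' \<circ> g') \<circ> (g \<circ> f)) id"
    using f'(2) by (simp add: o_assoc) (rule homotopic_with_trans)
  have "homotopic_with_canon (equivariant_on U \<kappa> \<kappa>) U U (g \<circ> ((f \<circ> f') \<circ> g')) (g \<circ> (id \<circ> g'))"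
    by (intro Z2_homotopic_comp_left[OF _ gm] Z2_homotopic_comp_right[OF f'(3)] g'(1))
  then have 2: "homotopic_with_canon (equivariant_on U \<kappa> \<kappa>) U U ((g \<circ> f) \<circ> (f' \<circ> g')) id"
    using g'(3) by (simp add: o_assoc) (rule homotopic_with_trans)
  show ?thesis
    unfolding Z2_homotopy_equivalence_def
    using Z2_map_comp[OF fm gm] Z2_map_comp[OF g'(1) f'(1)] 1 2 by blast
qed

text \<open>With \<open>g\<close> a homotopy inverse of \<open>i\<close>, the chain
  \<open>i r\<close>, \<open>i r i g\<close>, \<open>i g\<close>, \<open>id\<close> consists of
  homotopic maps, so \<open>i\<close> is a two-sided inverse of \<open>r\<close> up to
  homotopy.\<close>

lemma Z2_homotopy_equivalence_left_inverse:
  assumes i: "Z2_homotopy_equivalence S \<nu> T \<mu> i" and r: "Z2_map T \<mu> S \<nu> r"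
    and ri: "homotopic_with_canon (equivariant_on S \<nu> \<nu>) S S (r \<circ> i) id"
  shows "Z2_homotopy_equivalence T \<mu> S \<nu> r"
proof -
  obtain g where g: "Z2_map T \<mu> S \<nu> g"
    "homotopic_with_canon (equivariant_on T \<mu> \<mu>) T T (i \<circ> g) id"
    using i unfolding Z2_homotopy_equivalence_def by blast
  have im: "Z2_map S \<nu> T \<mu> i" using i unfolding Z2_homotopy_equivalence_def by blast
  have "homotopic_with_canon (equivariant_on T \<mu> \<mu>) T T ((i \<circ> r) \<circ> (i \<circ> g)) ((i \<circ> r) \<circ> id)"
    by (intro Z2_homotopic_comp_left[OF g(2)] Z2_map_comp[OF r im])
  moreover have "homotopic_with_canon (equivariant_on T \<mu> \<mu>) T T (i \<circ> ((r \<circ> i) \<circ> g)) (i \<circ> (id \<circ> g))"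
    by (intro Z2_homotopic_comp_left[OF _ im] Z2_homotopic_comp_right[OF ri] g(1))
  ultimately have "homotopic_with_canon (equivariant_on T \<mu> \<mu>) T T (i \<circ> r) id"
    using g(2) by (simp add: o_assoc) (metis homotopic_with_trans homotopic_with_symD)
  then show ?thesis
    unfolding Z2_homotopy_equivalence_def using r im ri by blast
qed

text \<open>Maps of realizations are total functions whose formulas agree only on the realization,
  so replacing one by another needs this form of congruence.\<close>

lemma Z2_homotopy_equivalence_cong:
  assumes f: "Z2_homotopy_equivalence S \<nu> T \<mu> f" and eq: "\<And>x. x \<in> S \<Longrightarrow> f x = g x"
    and \<nu>: "\<And>x. x \<in> S \<Longrightarrow> \<nu> x \<in> S" and \<mu>: "\<And>x. x \<in> T \<Longrightarrow> \<mu> x \<in> T"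
  shows "Z2_homotopy_equivalence S \<nu> T \<mu> g"
proof -
  have fm: "Z2_map S \<nu> T \<mu> f" using f unfolding Z2_homotopy_equivalence_def by blast
  have "continuous_on S g"
    using fm eq unfolding Z2_map_def by (metis continuous_on_cong)
  then have gm: "Z2_map S \<nu> T \<mu> g"
    using Z2_mapD(2,3)[OF fm] eq \<nu> unfolding Z2_map_def equivariant_on_def by auto
  obtain f' where f': "Z2_map T \<mu> S \<nu> f'"
    "homotopic_with_canon (equivariant_on S \<nu> \<nu>) S S (f' \<circ> f) id"
    "homotopic_with_canon (equivariant_on T \<mu> \<mu>) T T (f \<circ> f') id"
    using f unfolding Z2_homotopy_equivalence_def by blast
  have "homotopic_with_canon (equivariant_on S \<nu> \<nu>) S S (f' \<circ> g) (f' \<circ> f)"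
    using Z2_map_comp[OF gm f'(1)] eq \<nu> by (intro Z2_homotopic_eq) auto
  moreover have "homotopic_with_canon (equivariant_on T \<mu> \<mu>) T T (g \<circ> f') (f \<circ> f')"
    using Z2_map_comp[OF f'(1) gm] eq \<mu> Z2_mapD(2)[OF f'(1)] by (intro Z2_homotopic_eq) auto
  ultimately show ?thesis
    unfolding Z2_homotopy_equivalence_def
    using gm f'(1) homotopic_with_trans[OF _ f'(2)] homotopic_with_trans[OF _ f'(3)] by blast
qed


section \<open>Realizations\<close>

lemma realizationD:
  assumes "x \<in> realization K"
  shows "0 \<le> x v" "{v. x v \<noteq> 0} \<in> K" "x v \<noteq> 0 \<Longrightarrow> v \<in> \<Union>K" "v \<notin> \<Union>K \<Longrightarrow> x v = 0"
proof -
  show "0 \<le> x v" "{v. x v \<noteq> 0} \<in> K" using assms unfolding realization_def by auto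
  then show "x v \<noteq> 0 \<Longrightarrow> v \<in> \<Union>K" "v \<notin> \<Union>K \<Longrightarrow> x v = 0" by blast+
qed

lemma realization_sum:
  assumes "x \<in> realization K" "finite A" "{v. x v \<noteq> 0} \<subseteq> A"
  shows "sum x A = 1"
proof -
  have "sum x A = sum x {v. x v \<noteq> 0}"
    using assms(2,3) by (intro sum.mono_neutral_right) auto
  then show ?thesis using assms(1) unfolding realization_def by simp
qed

lemma finite_abstract_complexD:
  assumes "finite_abstract_complex K" "\<sigma> \<in> K"
  shows "finite \<sigma>" "\<sigma> \<noteq> {}" "\<And>\<tau>. \<tau> \<noteq> {} \<Longrightarrow> \<tau> \<subseteq> \<sigma> \<Longrightarrow> \<tau> \<in> K"
proof -
  have "finite \<sigma> \<and> \<sigma> \<noteq> {} \<and> (\<forall>\<tau>. \<tau> \<noteq> {} \<and> \<tau> \<subseteq> \<sigma> \<longrightarrow> \<tau> \<in> K)"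
    using assms(2) by (rule bspec[OF conjunct2[OF assms(1)[unfolded finite_abstract_complex_def]]])
  then show "finite \<sigma>" "\<sigma> \<noteq> {}" "\<And>\<tau>. \<tau> \<noteq> {} \<Longrightarrow> \<tau> \<subseteq> \<sigma> \<Longrightarrow> \<tau> \<in> K" by simp_all
qed

lemma realizationI:
  assumes "finite_abstract_complex K" "\<sigma> \<in> K" "\<And>v. 0 \<le> x v" "\<And>v. v \<notin> \<sigma> \<Longrightarrow> x v = 0" "sum x \<sigma> = 1"
  shows "x \<in> realization K"
proof -
  have sub: "{v. x v \<noteq> 0} \<subseteq> \<sigma>" using assms(4) by blast
  have "finite \<sigma>" using finite_abstract_complexD(1)[OF assms(1,2)] .
  then have s: "(\<Sum>v | x v \<noteq> 0. x v) = 1"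
    using sum.mono_neutral_right[OF \<open>finite \<sigma>\<close> sub, of x] assms(5) by auto
  then have "{v. x v \<noteq> 0} \<noteq> {}" by (metis sum.empty zero_neq_one)
  then have "{v. x v \<noteq> 0} \<in> K" using finite_abstract_complexD(3)[OF assms(1,2) _ sub] by simp
  then show ?thesis using s assms(3) unfolding realization_def by simp
qed

lemma realization_mono: "L \<subseteq> K \<Longrightarrow> realization L \<subseteq> realization K"
  unfolding realization_def by auto

text \<open>Pushing coordinates forward along \<open>\<nu>\<close> is pulling them back along its
  inverse, which is \<open>\<nu>\<close>. The pull-back is linear and continuous at sight, so it is
  used below in place of \<open>realization_map\<close>.\<close>

lemma realization_map_involution:
  assumes "\<And>v. \<nu> (\<nu> v) = v"
  shows "realization_map \<nu> x = x \<circ> \<nu>"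
proof
  fix w
  have "{v. x v \<noteq> 0 \<and> \<nu> v = w} = (if x (\<nu> w) = 0 then {} else {\<nu> w})"
    using assms by (auto simp: assms[symmetric])
  then show "realization_map \<nu> x w = (x \<circ> \<nu>) w" unfolding realization_map_def by simp
qed

lemma realization_involution:
  assumes "\<And>v. \<nu> (\<nu> v) = v" "free_Z2_complex K \<nu>" "x \<in> realization K"
  shows "x \<circ> \<nu> \<in> realization K"
proof -
  have "{v. (x \<circ> \<nu>) v \<noteq> 0} = \<nu> ` {v. x v \<noteq> 0}"
    using assms(1) by (auto simp: image_iff) metis
  moreover have "inj_on \<nu> {v. x v \<noteq> 0}" using assms(1) by (metis inj_onI)
  ultimately have "(\<Sum>v | (x \<circ> \<nu>) v \<noteq> 0. (x \<circ> \<nu>) v) = (\<Sum>v | x v \<noteq> 0. x v)"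
    using assms(1) by (simp add: sum.reindex)
  then show ?thesis
    using assms free_Z2_complex_involution(2)[OF assms(2)] \<open>{v. (x \<circ> \<nu>) v \<noteq> 0} = \<nu> ` {v. x v \<noteq> 0}\<close>
    unfolding realization_def by simp
qed

text \<open>\<open>f x\<close> and \<open>g x\<close> lie in a common closed simplex, so the segment
  between them stays in the realization. It is equivariant because the involution acts by permuting
  coordinates.\<close>

lemma contiguous_imp_Z2_homotopic:
  assumes "Z2_map S \<nu> (realization K) (\<lambda>y. y \<circ> \<mu>) f" "Z2_map S \<nu> (realization K) (\<lambda>y. y \<circ> \<mu>) g"
    and K: "finite_abstract_complex K"
    and cont: "\<And>x. x \<in> S \<Longrightarrow> \<exists>\<sigma>\<in>K. \<forall>v. v \<notin> \<sigma> \<longrightarrow> f x v = 0 \<and> g x v = 0"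
  shows "homotopic_with_canon (equivariant_on S \<nu> (\<lambda>y. y \<circ> \<mu>)) S (realization K) f g"
  unfolding homotopic_with_def
proof (intro exI conjI allI ballI)
  define H where "H = (\<lambda>p v. (1 - fst p) * f (snd p) v + fst p * g (snd p) v)"
  have cf: "continuous_on S f" and cg: "continuous_on S g" using assms(1,2) unfolding Z2_map_def by auto
  have "continuous_on ({0..1} \<times> S) H"
  proof (rule continuous_on_coordinatewise_then_product)
    fix v
    have "continuous_on ({0..1} \<times> S) (\<lambda>p. f (snd p) v)"
      using continuous_on_product_then_coordinatewise[OF cf, of v]
      by (rule continuous_on_compose2) (auto intro: continuous_intros)
    moreover have "continuous_on ({0..1} \<times> S) (\<lambda>p. g (snd p) v)"
      using continuous_on_product_then_coordinatewise[OF cg, of v]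
      by (rule continuous_on_compose2) (auto intro: continuous_intros)
    ultimately show "continuous_on ({0..1} \<times> S) (\<lambda>p. H p v)"
      unfolding H_def by (intro continuous_intros)
  qed
  moreover have "H (t, x) \<in> realization K" if t: "t \<in> {0..1}" and x: "x \<in> S" for t x
  proof -
    obtain \<sigma> where \<sigma>: "\<sigma> \<in> K" "\<And>v. v \<notin> \<sigma> \<Longrightarrow> f x v = 0 \<and> g x v = 0" using cont[OF x] by blast
    have fin: "finite \<sigma>" using finite_abstract_complexD(1)[OF K \<sigma>(1)] .
    have fx: "f x \<in> realization K" and gx: "g x \<in> realization K"
      using Z2_mapD(2)[OF assms(1) x] Z2_mapD(2)[OF assms(2) x] by auto
    have "sum (f x) \<sigma> = 1" "sum (g x) \<sigma> = 1"
      using \<sigma>(2) fin by (intro realization_sum[OF fx] realization_sum[OF gx]; blast)+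
    then have "sum (H (t, x)) \<sigma> = 1"
      unfolding H_def by (simp add: sum.distrib sum_distrib_left[symmetric])
    moreover have "0 \<le> H (t, x) v" for v
      using t realizationD(1)[OF fx, of v] realizationD(1)[OF gx, of v] unfolding H_def by simp
    moreover have "H (t, x) v = 0" if "v \<notin> \<sigma>" for v
      using \<sigma>(2)[OF that] unfolding H_def by simp
    ultimately show ?thesis by (intro realizationI[OF K \<sigma>(1)])
  qed
  ultimately show "continuous_map (prod_topology (top_of_set {0..1}) (top_of_set S))
      (top_of_set (realization K)) H"
    by auto
  show "H (0, x) = f x" "H (1, x) = g x" for x unfolding H_def by simp_all
  show "equivariant_on S \<nu> (\<lambda>y. y \<circ> \<mu>) (\<lambda>x. H (t, x))" for t
    using Z2_mapD(3)[OF assms(1)] Z2_mapD(3)[OF assms(2)]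
    unfolding equivariant_on_def H_def by (simp add: o_def)
qed

text \<open>\<open>\<phi> v\<close> lists the barycentric coordinates of the point to which
  \<open>v\<close> is sent. Summing over a fixed finite \<open>V\<close>, not over the support of
  \<open>x\<close>, makes each coordinate a finite sum of continuous functions.\<close>

definition affine_extension :: "'v set \<Rightarrow> ('v \<Rightarrow> 'w \<Rightarrow> real) \<Rightarrow> ('v \<Rightarrow> real) \<Rightarrow> 'w \<Rightarrow> real" where
  "affine_extension V \<phi> x = (\<lambda>w. \<Sum>v\<in>V. x v * \<phi> v w)"

lemma continuous_on_affine_extension: "continuous_on S (affine_extension V \<phi>)"
proof (rule continuous_on_coordinatewise_then_product)
  fix w
  have "continuous_on S (\<lambda>x :: 'a \<Rightarrow> real. x v)" for v
    by (rule continuous_on_subset[OF continuous_on_product_coordinates subset_UNIV])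
  then show "continuous_on S (\<lambda>x. affine_extension V \<phi> x w)"
    unfolding affine_extension_def by (intro continuous_intros)
qed

text \<open>The vertices of a simplex of \<open>K\<close> are sent to points of one closed simplex
  \<open>\<rho>\<close> of \<open>L\<close>, which contains all their convex combinations.\<close>

lemma affine_extension_in_realization:
  assumes L: "finite_abstract_complex L" and V: "finite V" and x: "x \<in> realization K" and KV: "\<Union>K \<subseteq> V"
    and "\<And>\<sigma>. \<sigma> \<in> K \<Longrightarrow>
      \<exists>\<rho>\<in>L. \<forall>v\<in>\<sigma>. (\<forall>w. 0 \<le> \<phi> v w) \<and> (\<forall>w. w \<notin> \<rho> \<longrightarrow> \<phi> v w = 0) \<and> sum (\<phi> v) \<rho> = 1"
  shows "affine_extension V \<phi> x \<in> realization L"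
proof -
  let ?\<sigma> = "{v. x v \<noteq> 0}"
  have sub: "?\<sigma> \<subseteq> V" using realizationD(3)[OF x] KV by blast
  then have fin: "finite ?\<sigma>" using V finite_subset by blast
  have eq: "affine_extension V \<phi> x w = (\<Sum>v\<in>?\<sigma>. x v * \<phi> v w)" for w
    unfolding affine_extension_def using V sub by (intro sum.mono_neutral_right) auto
  obtain \<rho> where \<rho>: "\<rho> \<in> L" "\<And>v w. v \<in> ?\<sigma> \<Longrightarrow> 0 \<le> \<phi> v w"
    "\<And>v w. v \<in> ?\<sigma> \<Longrightarrow> w \<notin> \<rho> \<Longrightarrow> \<phi> v w = 0" "\<And>v. v \<in> ?\<sigma> \<Longrightarrow> sum (\<phi> v) \<rho> = 1"
    using assms(5)[OF realizationD(2)[OF x]] by blast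
  show ?thesis
  proof (rule realizationI[OF L \<rho>(1)])
    show "0 \<le> affine_extension V \<phi> x w" for w
      unfolding eq using \<rho>(2) realizationD(1)[OF x] by (intro sum_nonneg mult_nonneg_nonneg) auto
    show "affine_extension V \<phi> x w = 0" if "w \<notin> \<rho>" for w
      unfolding eq using \<rho>(3) that by (intro sum.neutral) auto
    have "sum (affine_extension V \<phi> x) \<rho> = (\<Sum>v\<in>?\<sigma>. \<Sum>w\<in>\<rho>. x v * \<phi> v w)"
      unfolding eq by (rule sum.swap)
    also have "\<dots> = (\<Sum>v\<in>?\<sigma>. x v)"
      using \<rho>(4) by (intro sum.cong) (simp_all add: sum_distrib_left[symmetric])
    also have "\<dots> = 1" using realization_sum[OF x fin] by simp
    finally show "sum (affine_extension V \<phi> x) \<rho> = 1" .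
  qed
qed

text \<open>The sum in \<open>realization_map\<close> runs over a support that changes with
  \<open>x\<close>; with the index set fixed, continuity becomes available.\<close>

lemma realization_map_eq_affine_extension:
  assumes "x \<in> realization K" "finite V" "\<Union>K \<subseteq> V"
  shows "realization_map f x = affine_extension V (\<lambda>v w. if f v = w then 1 else 0) x"
proof
  fix w
  have "(\<Sum>v | x v \<noteq> 0 \<and> f v = w. x v) = (\<Sum>v\<in>{v\<in>V. f v = w}. x v)"
    using assms realizationD(3)[OF assms(1)] by (intro sum.mono_neutral_left) auto
  also have "\<dots> = (\<Sum>v\<in>V. if f v = w then x v else 0)"
    using assms(2) by (intro sum.inter_filter)
  finally show "realization_map f x w = affine_extension V (\<lambda>v w. if f v = w then 1 else 0) x w"
    unfolding realization_map_def affine_extension_def by (simp add: if_distrib cong: if_cong)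
qed

lemma affine_extension_realization_map:
  assumes x: "x \<in> realization K" and "finite (\<Union>K)" "finite V" "h ` \<Union>K \<subseteq> V"
  shows "affine_extension V \<phi> (realization_map h x) = affine_extension (\<Union>K) (\<phi> \<circ> h) x"
proof
  fix w
  have rm: "realization_map h x u = (\<Sum>v\<in>{v\<in>\<Union>K. h v = u}. x v)" for u
    unfolding realization_map_def
  proof (rule sum.mono_neutral_left)
    show "finite {v \<in> \<Union>K. h v = u}" using assms(2) by (rule finite_subset[rotated]) blast
    show "{v. x v \<noteq> 0 \<and> h v = u} \<subseteq> {v \<in> \<Union>K. h v = u}"
    proof (intro subsetI CollectI conjI)
      fix v assume v: "v \<in> {v. x v \<noteq> 0 \<and> h v = u}"
      show "v \<in> \<Union>K" by (rule realizationD(3)[OF x]) (use v in simp)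
      show "h v = u" using v by simp
    qed
  qed blast
  have "affine_extension V \<phi> (realization_map h x) w = (\<Sum>u\<in>V. \<Sum>v\<in>{v\<in>\<Union>K. h v = u}. x v * \<phi> (h v) w)"
    unfolding affine_extension_def rm sum_distrib_right by (intro sum.cong refl) simp
  also have "\<dots> = (\<Sum>v\<in>\<Union>K. x v * \<phi> (h v) w)"
    using assms(2-4) by (rule sum.group[of "\<Union>K" V h "\<lambda>v. x v * \<phi> (h v) w", OF _ _])
  finally show "affine_extension V \<phi> (realization_map h x) w = affine_extension (\<Union>K) (\<phi> \<circ> h) x w"
    unfolding affine_extension_def by simp
qed

lemma affine_extension_involution:
  assumes "\<And>v. \<nu> (\<nu> v) = v" "\<nu> ` V = V" "\<And>v w. v \<in> V \<Longrightarrow> \<phi> (\<nu> v) w = \<phi> v (\<mu> w)"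
  shows "affine_extension V \<phi> (x \<circ> \<nu>) = affine_extension V \<phi> x \<circ> \<mu>"
proof
  fix w
  have "inj_on \<nu> V" using assms(1) by (metis inj_onI)
  then have "(\<Sum>v\<in>\<nu> ` V. x (\<nu> v) * \<phi> v w) = (\<Sum>v\<in>V. x v * \<phi> (\<nu> v) w)"
    using assms(1) by (simp add: sum.reindex)
  then show "affine_extension V \<phi> (x \<circ> \<nu>) w = (affine_extension V \<phi> x \<circ> \<mu>) w"
    unfolding affine_extension_def using assms(2,3) by simp
qed


section \<open>Collapses and relabellings as equivariant homotopy equivalences of
  realizations\<close>

lemma Z2_collapses_subset: "Z2_collapses \<nu> K L \<Longrightarrow> L \<subseteq> K"
  unfolding Z2_collapses_def
proof (induction rule: rtranclp_induct)
  case (step L M)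
  from step.hyps(2) have "M \<subseteq> L" by cases blast
  then show ?case using step.IH by blast
qed simp

lemma Z2_map_realization_id:
  assumes "L \<subseteq> K"
  shows "Z2_map (realization L) (\<lambda>x. x \<circ> \<nu>) (realization K) (\<lambda>x. x \<circ> \<nu>) id"
  using realization_mono[OF assms] unfolding Z2_map_def equivariant_on_def by auto

lemma continuous_on_Min_coordinates:
  assumes "finite A" "A \<noteq> {}"
  shows "continuous_on S (\<lambda>x :: 'v \<Rightarrow> real. Min (x ` A))"
  using assms
proof (induction A rule: finite_ne_induct)
  case (singleton v)
  show ?case by (simp add: continuous_on_subset[OF continuous_on_product_coordinates])
next
  case (insert v A)
  have "continuous_on S (\<lambda>x :: 'v \<Rightarrow> real. x v)"
    by (rule continuous_on_subset[OF continuous_on_product_coordinates subset_UNIV])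
  then have "continuous_on S (\<lambda>x :: 'v \<Rightarrow> real. min (x v) (Min (x ` A)))"
    using insert.IH by (intro continuous_intros)
  then show ?case using insert.hyps by simp
qed

text \<open>
  Moves mass from the vertices of the free face \<open>\<tau>\<close> to the opposite vertex \<open>v\<close> until
  some coordinate on \<open>\<tau>\<close> vanishes.
\<close>

definition push :: "'v set \<Rightarrow> 'v \<Rightarrow> ('v \<Rightarrow> real) \<Rightarrow> 'v \<Rightarrow> real" where
  "push \<tau> v x = (\<lambda>w. Min (x ` \<tau>) * (of_bool (w = v) * real (card \<tau>) - of_bool (w \<in> \<tau>)))"

text \<open>The retraction \<open>ret\<close> performs the push at \<open>\<tau>\<close> and its
  mirror image in one formula, which makes it equivariant. The two do not interfere: at any point at
  most one of the minima over \<open>\<tau>\<close> and over its mirror image is positive. A point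
  and its retract share a simplex, so contiguity supplies the homotopy.\<close>

lemma elementary_collapse_homotopy_equivalence:
  assumes inv: "\<And>v. \<nu> (\<nu> v) = v" and free: "free_Z2_complex K \<nu>" and \<tau>: "\<tau> \<in> K"
    and cof: "{\<rho> \<in> K. \<tau> \<subset> \<rho>} = {\<sigma>}" and L: "L = K - {\<tau>, \<sigma>, \<nu> ` \<tau>, \<nu> ` \<sigma>}"
  shows "Z2_homotopy_equivalence (realization L) (\<lambda>x. x \<circ> \<nu>) (realization K) (\<lambda>x. x \<circ> \<nu>) id"
proof -
  note KD = free_Z2_complexD[OF free] and Ki = free_Z2_complex_involution[OF free]
  have freeL: "free_Z2_complex L \<nu>"
    unfolding L by (rule free_Z2_complex_elementary_collapse[OF free \<tau> cof])
  have cK: "finite_abstract_complex K" and cL: "finite_abstract_complex L"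
    using free freeL unfolding free_Z2_complex_def by blast+
  have \<sigma>: "\<sigma> \<in> K" "\<tau> \<subset> \<sigma>" using cof by blast+
  have up: "\<rho> = \<tau> \<or> \<rho> = \<sigma>" if "\<rho> \<in> K" "\<tau> \<subseteq> \<rho>" for \<rho> using that cof by blast
  have fin: "finite \<tau>" "\<tau> \<noteq> {}" using KD(2,3)[OF \<tau>] .
  obtain v where v: "v \<in> \<sigma>" "v \<notin> \<tau>" using \<sigma>(2) by blast
  \<comment> \<open>A free face has codimension one: \<open>insert v \<tau>\<close> is already a
    proper coface of \<open>\<tau>\<close>, hence equal to \<open>\<sigma>\<close>.\<close>
  have "insert v \<tau> \<in> K" using KD(4)[OF \<sigma>(1), of "insert v \<tau>"] v \<sigma>(2) by blast
  then have \<sigma>_eq: "\<sigma> = insert v \<tau>" using up[of "insert v \<tau>"] v(2) by blast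
  have inj: "inj \<nu>" using inv by (metis injI)
  have card\<sigma>: "card \<sigma> = Suc (card \<tau>)" unfolding \<sigma>_eq using fin v(2) by simp
  have cardn: "card (\<nu> ` A) = card A" for A using inj by (simp add: card_image inj_on_subset)
  \<comment> \<open>Otherwise the mirror image of \<open>\<sigma>\<close> would contain
    \<open>\<tau>\<close> and so be \<open>\<tau>\<close> or \<open>\<sigma>\<close>; the first
    fails by size, the second by freeness.\<close>
  have not_sub: "\<not> \<nu> ` \<tau> \<subseteq> \<sigma>"
  proof
    assume "\<nu> ` \<tau> \<subseteq> \<sigma>"
    then have "\<nu> ` \<nu> ` \<tau> \<subseteq> \<nu> ` \<sigma>" by (rule image_mono)
    then have "\<tau> \<subseteq> \<nu> ` \<sigma>" using Ki(1)[OF \<tau>] by simp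
    then have "\<nu> ` \<sigma> = \<tau> \<or> \<nu> ` \<sigma> = \<sigma>" using up[OF Ki(2)[OF \<sigma>(1)]] by blast
    then show False using Ki(3)[OF \<sigma>(1)] cardn[of \<sigma>] card\<sigma> by auto
  qed
  define t where "t A x = Min (x ` A)" for A and x :: "'a \<Rightarrow> real"
  define ret where "ret x = (\<lambda>w. x w + push \<tau> v x w + push (\<nu> ` \<tau>) (\<nu> v) x w)" for x
  have push: "push A u x w = t A x * (of_bool (w = u) * real (card A) - of_bool (w \<in> A))" for A u x w
    unfolding push_def t_def ..
  have t_le: "t \<tau> x \<le> x u" if "u \<in> \<tau>" for x u
    unfolding t_def using fin that by simp
  have t_attained: "\<exists>u\<in>\<tau>. x u = t \<tau> x" for x
  proof -
    have "t \<tau> x \<in> x ` \<tau>" unfolding t_def using fin by (intro Min_in) auto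
    then show ?thesis by force
  qed
  have t_nonneg: "0 \<le> t \<tau> x" if "x \<in> realization K" for x
    using t_attained[of x] realizationD(1)[OF that] by (metis)
  have t_nu: "t (\<nu> ` \<tau>) x = t \<tau> (x \<circ> \<nu>)" for x
    unfolding t_def image_image by simp
  have ret_nu: "ret (x \<circ> \<nu>) = ret x \<circ> \<nu>" for x
  proof
    fix w
    have "\<nu> w \<in> \<nu> ` \<tau> \<longleftrightarrow> w \<in> \<tau>" "\<nu> w \<in> \<tau> \<longleftrightarrow> w \<in> \<nu> ` \<tau>" "\<nu> w = \<nu> v \<longleftrightarrow> w = v" "\<nu> w = v \<longleftrightarrow> w = \<nu> v"
      using inv by (auto simp: inj_image_mem_iff[OF inj]) (metis inv image_eqI)+
    moreover have "t (\<nu> ` \<tau>) (x \<circ> \<nu>) = t \<tau> x" unfolding t_nu using inv by (simp add: o_def)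
    ultimately show "ret (x \<circ> \<nu>) w = (ret x \<circ> \<nu>) w"
      unfolding ret_def push t_nu using cardn by (simp add: o_def)
  qed
  have supp: "{u. x u \<noteq> 0} = \<tau> \<or> {u. x u \<noteq> 0} = \<sigma>" if "x \<in> realization K" "t \<tau> x > 0" for x
  proof -
    have "\<tau> \<subseteq> {u. x u \<noteq> 0}" using t_le[of _ x] that(2) by fastforce
    then show ?thesis using up realizationD(2)[OF that(1)] by blast
  qed
  \<comment> \<open>A positive minimum on \<open>\<tau>\<close> forces the support to be
    \<open>\<tau>\<close> or \<open>\<sigma>\<close>, and neither contains the mirror image of
    \<open>\<tau>\<close>; so the mirrored push is trivial there.\<close>
  have t_nu0: "t (\<nu> ` \<tau>) x = 0" if x: "x \<in> realization K" "t \<tau> x > 0" for x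
  proof -
    have "\<exists>u\<in>\<nu> ` \<tau>. x u = 0" using supp[OF x] not_sub \<sigma>(2) by blast
    moreover have "0 \<le> t (\<nu> ` \<tau>) x"
      unfolding t_nu by (rule t_nonneg[OF realization_involution[OF inv free x(1)]])
    moreover have "t (\<nu> ` \<tau>) x \<le> x u" if "u \<in> \<nu> ` \<tau>" for u
      unfolding t_def using fin that by simp
    ultimately show ?thesis by (metis order_antisym)
  qed
  have ret_pos: "ret x \<in> realization L \<and> (\<forall>u. u \<notin> \<sigma> \<longrightarrow> ret x u = 0 \<and> x u = 0)"
    if x: "x \<in> realization K" "t \<tau> x > 0" for x
  proof -
    have x0: "x u = 0" if "u \<notin> \<sigma>" for u using supp[OF x] that \<sigma>(2) by blast
    have ret: "ret x w = x w + t \<tau> x * (of_bool (w = v) * real (card \<tau>) - of_bool (w \<in> \<tau>))" for w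
      unfolding ret_def push t_nu0[OF x] by simp
    have ret0: "ret x u = 0" if "u \<notin> \<sigma>" for u unfolding ret using that x0 \<sigma>_eq by simp
    \<comment> \<open>At a vertex \<open>u\<close> where the minimum is attained the push leaves no
      mass, so the result is carried by \<open>\<sigma>\<close> without \<open>u\<close>. This face
      contains \<open>v\<close> and is none of the four removed simplices.\<close>
    obtain u where u: "u \<in> \<tau>" "x u = t \<tau> x" using t_attained by blast
    have uv: "u \<noteq> v" using u v by blast
    define \<rho> where "\<rho> = \<sigma> - {u}"
    have "v \<in> \<rho>" unfolding \<rho>_def using v(1) uv by blast
    have "\<rho> \<in> K" using KD(4)[OF \<sigma>(1), of \<rho>] \<open>v \<in> \<rho>\<close> unfolding \<rho>_def by blast
    moreover have "\<rho> \<noteq> \<tau>" "\<rho> \<noteq> \<sigma>" "\<rho> \<noteq> \<nu> ` \<tau>" "\<rho> \<noteq> \<nu> ` \<sigma>"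
      using \<open>v \<in> \<rho>\<close> v(2) u \<sigma>(2) not_sub unfolding \<rho>_def by blast+
    ultimately have \<rho>L: "\<rho> \<in> L" unfolding L by blast
    have "ret x \<in> realization L"
    proof (rule realizationI[OF cL \<rho>L])
      show "0 \<le> ret x w" for w
        using realizationD(1)[OF x(1), of w] x(2) t_le[of w x] v(2) unfolding ret by auto
      show "ret x w = 0" if "w \<notin> \<rho>" for w
      proof (cases "w = u")
        case True
        then show ?thesis unfolding ret using u uv by simp
      next
        case False
        then show ?thesis using ret0 that unfolding \<rho>_def by blast
      qed
      then have "sum (ret x) \<rho> = sum (ret x) \<sigma>"
        using KD(2)[OF \<sigma>(1)] unfolding \<rho>_def by (intro sum.mono_neutral_left) auto
      \<comment> \<open>Mass is preserved: the minimum is taken away once at each vertex of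
        \<open>\<tau>\<close> and added \<open>card \<tau>\<close> times at
        \<open>v\<close>.\<close>
      also have "\<dots> = sum x \<sigma> + t \<tau> x * (real (card \<tau>) - (\<Sum>w\<in>\<sigma>. of_bool (w \<in> \<tau>)))"
        unfolding ret sum.distrib sum_distrib_left[symmetric] sum_subtractf
        using KD(2)[OF \<sigma>(1)] v(1) by (simp add: sum_distrib_right[symmetric])
      also have "(\<Sum>w\<in>\<sigma>. of_bool (w \<in> \<tau>)) = real (card \<tau>)"
        using KD(2)[OF \<sigma>(1)] \<sigma>(2) by (simp add: Int_absorb1 psubset_imp_subset)
      also have "sum x \<sigma> = 1"
        using x0 by (intro realization_sum[OF x(1) KD(2)[OF \<sigma>(1)]]) blast
      finally show "sum (ret x) \<rho> = 1" by simp
    qed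
    then show ?thesis using ret0 x0 by blast
  qed
  have ret_id: "ret x = x" if "t \<tau> x = 0" "t (\<nu> ` \<tau>) x = 0" for x
    unfolding ret_def push that by simp
  have t_L: "t \<tau> x = 0" if "x \<in> realization L" for x
  proof (rule ccontr)
    assume "t \<tau> x \<noteq> 0"
    have xK: "x \<in> realization K" using that realization_mono[of L K] unfolding L by blast
    then have "t \<tau> x > 0" using t_nonneg[OF xK] \<open>t \<tau> x \<noteq> 0\<close> by simp
    then show False using supp[OF xK] realizationD(2)[OF that] unfolding L by auto
  qed
  have ret_L: "ret x = x" if "x \<in> realization L" for x
    using t_L[OF that] t_L[OF realization_involution[OF inv freeL that]] by (intro ret_id) (simp_all add: t_nu)
  have ret_all: "ret x \<in> realization L \<and> (\<exists>\<sigma>\<in>K. \<forall>u. u \<notin> \<sigma> \<longrightarrow> ret x u = 0 \<and> x u = 0)"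
    if x: "x \<in> realization K" for x
  proof -
    have x': "x \<circ> \<nu> \<in> realization K" by (rule realization_involution[OF inv free x])
    consider "t \<tau> x > 0" | "t \<tau> (x \<circ> \<nu>) > 0" | "t \<tau> x = 0" "t \<tau> (x \<circ> \<nu>) = 0"
      using t_nonneg[OF x] t_nonneg[OF x'] by linarith
    then show ?thesis
    proof cases
      case 1
      then show ?thesis using ret_pos[OF x] \<sigma>(1) by blast
    next
      case 2
      note r = ret_pos[OF x' 2]
      have "ret x = ret (x \<circ> \<nu>) \<circ> \<nu>" unfolding ret_nu using inv by (simp add: o_def)
      then have "ret x \<in> realization L" using realization_involution[OF inv freeL] r by metis
      moreover have "\<forall>u. u \<notin> \<nu> ` \<sigma> \<longrightarrow> ret x u = 0 \<and> x u = 0"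
      proof (intro allI impI)
        fix u assume "u \<notin> \<nu> ` \<sigma>"
        then have "\<nu> u \<notin> \<sigma>" using inv by (metis image_eqI)
        then show "ret x u = 0 \<and> x u = 0" using r inv unfolding ret_nu by (simp add: o_def) metis
      qed
      ultimately show ?thesis using Ki(2)[OF \<sigma>(1)] by blast
    next
      case 3
      then have eq: "ret x = x" by (intro ret_id) (simp_all add: t_nu)
      \<comment> \<open>A vanishing minimum means a vanishing coordinate on \<open>\<tau>\<close>,
        and likewise on the mirror image, so the support contains neither and is not among the
        removed simplices.\<close>
      have "\<rho> \<noteq> {u. x u \<noteq> 0}" if "\<tau> \<subseteq> \<rho>" for \<rho>
        using t_attained[of x] 3(1) that by auto
      moreover have "\<rho> \<noteq> {u. x u \<noteq> 0}" if "\<nu> ` \<tau> \<subseteq> \<rho>" for \<rho>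
        using t_attained[of "x \<circ> \<nu>"] 3(2) that by auto
      ultimately have "{u. x u \<noteq> 0} \<notin> {\<tau>, \<sigma>, \<nu> ` \<tau>, \<nu> ` \<sigma>}"
        using \<sigma>(2) by blast
      then have "x \<in> realization L" using x unfolding realization_def L by simp
      then show ?thesis using eq realizationD(2)[OF x] by auto
    qed
  qed
  have cont: "continuous_on S ret" for S
  proof (rule continuous_on_coordinatewise_then_product)
    fix w
    have "continuous_on S (\<lambda>x :: 'a \<Rightarrow> real. x w)"
      by (rule continuous_on_subset[OF continuous_on_product_coordinates subset_UNIV])
    then show "continuous_on S (\<lambda>x. ret x w)"
      unfolding ret_def push_def using fin
      by (intro continuous_intros continuous_on_Min_coordinates) auto
  qed
  have LK: "L \<subseteq> K" unfolding L by blast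
  have retm: "Z2_map (realization K) (\<lambda>x. x \<circ> \<nu>) (realization L) (\<lambda>x. x \<circ> \<nu>) ret"
    using ret_all ret_nu cont unfolding Z2_map_def equivariant_on_def by auto
  note idm = Z2_map_realization_id[OF LK, of \<nu>] and idK = Z2_map_realization_id[OF order_refl, of K \<nu>]
  have "homotopic_with_canon (equivariant_on (realization L) (\<lambda>x. x \<circ> \<nu>) (\<lambda>x. x \<circ> \<nu>))
      (realization L) (realization L) (ret \<circ> id) id"
    using ret_L realization_involution[OF inv freeL]
    by (intro Z2_homotopic_eq[OF Z2_map_comp[OF idm retm]]) auto
  moreover have "homotopic_with_canon (equivariant_on (realization K) (\<lambda>x. x \<circ> \<nu>) (\<lambda>x. x \<circ> \<nu>))
      (realization K) (realization K) (id \<circ> ret) id"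
    using ret_all by (intro contiguous_imp_Z2_homotopic[OF Z2_map_comp[OF retm idm] idK cK]) auto
  ultimately show ?thesis
    unfolding Z2_homotopy_equivalence_def using idm retm by blast
qed

lemma Z2_collapses_homotopy_equivalence:
  assumes inv: "\<And>v. \<nu> (\<nu> v) = v" and "Z2_collapses \<nu> K L" "free_Z2_complex K \<nu>"
  shows "Z2_homotopy_equivalence (realization L) (\<lambda>x. x \<circ> \<nu>) (realization K) (\<lambda>x. x \<circ> \<nu>) id"
  using assms(2,3) unfolding Z2_collapses_def
proof (induction rule: rtranclp_induct)
  case base
  have "Z2_map (realization K) (\<lambda>x. x \<circ> \<nu>) (realization K) (\<lambda>x. x \<circ> \<nu>) id"
    by (rule Z2_map_realization_id) simp
  moreover from this have "homotopic_with_canon (equivariant_on (realization K) (\<lambda>x. x \<circ> \<nu>) (\<lambda>x. x \<circ> \<nu>))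
      (realization K) (realization K) (id \<circ> id) id"
    unfolding Z2_map_def by simp
  ultimately show ?case unfolding Z2_homotopy_equivalence_def by blast
next
  case (step L M)
  from step.hyps(2)
  have "Z2_homotopy_equivalence (realization M) (\<lambda>x. x \<circ> \<nu>) (realization L) (\<lambda>x. x \<circ> \<nu>) id"
    by cases (simp add: elementary_collapse_homotopy_equivalence[OF inv])
  from Z2_homotopy_equivalence_comp[OF this step.IH[OF step.prems]]
  show ?case by (simp only: id_o)
qed

text \<open>Relabelling along an injection is a homeomorphism of realizations; its inverse reads off
  the coordinates at the labels \<open>h v\<close>.\<close>

lemma realization_map_embedding:
  assumes h: "inj h" and eqv: "\<And>v. h (\<nu> v) = \<kappa> (h v)" and inv: "\<And>v. \<nu> (\<nu> v) = v" "\<And>v. \<kappa> (\<kappa> v) = v"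
    and K: "free_Z2_complex K \<nu>" and K': "free_Z2_complex (image h ` K) \<kappa>"
  shows "Z2_homotopy_equivalence (realization K) (\<lambda>x. x \<circ> \<nu>) (realization (image h ` K)) (\<lambda>x. x \<circ> \<kappa>)
    (realization_map h)"
proof -
  let ?K' = "image h ` K"
  have fin: "finite (\<Union>K)" using free_Z2_complexD(6)[OF K] .
  have cK: "finite_abstract_complex K" and cK': "finite_abstract_complex ?K'"
    using K K' unfolding free_Z2_complex_def by blast+
  have rm: "realization_map h x (h v) = x v" for x :: "'a \<Rightarrow> real" and v
  proof -
    have "{u. x u \<noteq> 0 \<and> h u = h v} = (if x v = 0 then {} else {v})"
      using inj_eq[OF h] by auto
    then show ?thesis unfolding realization_map_def by simp
  qed
  have rm0: "realization_map h x w = 0" if "w \<notin> range h" for x :: "'a \<Rightarrow> real" and w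
    using that unfolding realization_map_def by (intro sum.neutral) auto
  define g where "g = (\<lambda>(y :: 'b \<Rightarrow> real) v. y (h v))"
  have mem: "realization_map h x \<in> realization ?K'" if x: "x \<in> realization K" for x
    unfolding realization_map_eq_affine_extension[OF x fin subset_refl]
    by (rule affine_extension_in_realization[OF cK' fin x subset_refl])
       (use free_Z2_complexD(2)[OF K'] in \<open>auto intro!: bexI\<close>)
  have "realization_map h (x \<circ> \<nu>) = realization_map h x \<circ> \<kappa>" for x
  proof
    fix w
    show "realization_map h (x \<circ> \<nu>) w = (realization_map h x \<circ> \<kappa>) w"
    proof (cases "w \<in> range h")
      case True
      then obtain v where "w = h v" by blast
      then show ?thesis using rm[of "x \<circ> \<nu>" v] rm[of x "\<nu> v"] eqv by simp
    next
      case False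
      then have "\<kappa> w \<notin> range h" using eqv inv by (metis rangeE rangeI)
      then show ?thesis using False rm0 by simp
    qed
  qed
  moreover have "continuous_on (realization K) (realization_map h)"
    using continuous_on_affine_extension realization_map_eq_affine_extension[OF _ fin subset_refl]
    by (metis (no_types, lifting) continuous_on_cong)
  ultimately have m: "Z2_map (realization K) (\<lambda>x. x \<circ> \<nu>) (realization ?K') (\<lambda>x. x \<circ> \<kappa>) (realization_map h)"
    using mem unfolding Z2_map_def equivariant_on_def by auto
  have g_rm: "g (realization_map h x) = x" for x unfolding g_def rm by simp
  have rm_g: "realization_map h (g y) = y" if y: "y \<in> realization ?K'" for y
  proof
    fix w
    show "realization_map h (g y) w = y w"
    proof (cases "w \<in> range h")
      case True
      then show ?thesis using rm unfolding g_def by auto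
    next
      case False
      then have "w \<notin> \<Union>?K'" by blast
      then show ?thesis using rm0[OF False] realizationD(4)[OF y] by simp
    qed
  qed
  have gm: "g y \<in> realization K" if y: "y \<in> realization ?K'" for y
  proof -
    obtain \<sigma> where \<sigma>: "\<sigma> \<in> K" "{w. y w \<noteq> 0} = h ` \<sigma>" using realizationD(2)[OF y] by blast
    show ?thesis
    proof (rule realizationI[OF cK \<sigma>(1)])
      show "0 \<le> g y v" for v using realizationD(1)[OF y] unfolding g_def by simp
      show "g y v = 0" if "v \<notin> \<sigma>" for v
        using \<sigma>(2) that inj_image_mem_iff[OF h, of v \<sigma>] unfolding g_def by auto
      have "sum (g y) \<sigma> = sum y (h ` \<sigma>)"
        unfolding g_def using h by (simp add: sum.reindex inj_on_subset)
      also have "\<dots> = 1"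
        using \<sigma>(2) free_Z2_complexD(2)[OF K \<sigma>(1)] by (intro realization_sum[OF y]) auto
      finally show "sum (g y) \<sigma> = 1" .
    qed
  qed
  have "continuous_on (realization ?K') g"
    unfolding g_def
    by (intro continuous_on_coordinatewise_then_product
        continuous_on_subset[OF continuous_on_product_coordinates subset_UNIV])
  then have g: "Z2_map (realization ?K') (\<lambda>x. x \<circ> \<kappa>) (realization K) (\<lambda>x. x \<circ> \<nu>) g"
    using gm eqv unfolding Z2_map_def equivariant_on_def by (auto simp: g_def)
  have "homotopic_with_canon (equivariant_on (realization K) (\<lambda>x. x \<circ> \<nu>) (\<lambda>x. x \<circ> \<nu>))
      (realization K) (realization K) (g \<circ> realization_map h) id"
    using g_rm realization_involution[OF inv(1) K] by (intro Z2_homotopic_eq[OF Z2_map_comp[OF m g]]) auto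
  moreover have "homotopic_with_canon (equivariant_on (realization ?K') (\<lambda>x. x \<circ> \<kappa>) (\<lambda>x. x \<circ> \<kappa>))
      (realization ?K') (realization ?K') (realization_map h \<circ> g) id"
    using rm_g realization_involution[OF inv(2) K'] by (intro Z2_homotopic_eq[OF Z2_map_comp[OF g m]]) auto
  ultimately show ?thesis unfolding Z2_homotopy_equivalence_def using m g by blast
qed

text \<open>The inverse of \<open>realization_map f\<close> up to homotopy is never written down: it
  is the inclusion of the realization of \<open>L\<close> into that of \<open>M\<close>, followed by
  the homotopy inverse of the inclusion of that of \<open>K\<close> which the collapse
  provides.\<close>

theorem Z2_homotopy_equivalence_removable_fibres:
  assumes inv: "\<And>v. \<nu> (\<nu> v) = v" "\<And>v. \<mu> (\<mu> v) = v"
    and K: "free_Z2_complex K \<nu>" and L: "free_Z2_complex L \<mu>"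
    and eqv: "\<And>v. v \<in> \<Union>K \<Longrightarrow> f (\<nu> v) = \<mu> (f v)"
    and simplicial: "\<And>\<sigma>. \<sigma> \<in> K \<Longrightarrow> f ` \<sigma> \<in> L"
    and fibres: "\<And>\<tau>. \<tau> \<in> L \<Longrightarrow> removable {\<sigma> \<in> insert {} K. f ` \<sigma> \<subseteq> \<tau>}"
  shows "Z2_homotopy_equivalence (realization K) (realization_map \<nu>) (realization L) (realization_map \<mu>)
    (realization_map f)"
proof -
  define M where "M = double_cylinder f K L"
  define \<kappa> where "\<kappa> = double_cylinder_involution \<nu> \<mu>"
  define iK where "iK = (Inl \<circ> Inl :: 'a \<Rightarrow> ('a + 'b) + 'b set)"
  define iL where "iL = (Inl \<circ> Inr :: 'b \<Rightarrow> ('a + 'b) + 'b set)"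
  have freeM: "free_Z2_complex M \<kappa>" unfolding M_def \<kappa>_def
    by (rule free_Z2_complex_double_cylinder[OF K L]) (simp_all only: eqv simplicial)
  have cK: "Z2_collapses \<kappa> M (image iK ` K)" unfolding M_def \<kappa>_def iK_def
    by (rule Z2_collapses_double_cylinder_left[OF K L]) (simp_all only: eqv simplicial fibres)
  have cL: "Z2_collapses \<kappa> M (image iL ` L)" unfolding M_def \<kappa>_def iL_def
    by (rule Z2_collapses_double_cylinder_right[OF K L]) (simp_all only: eqv simplicial)
  have inv\<kappa>: "\<kappa> (\<kappa> x) = x" for x
  proof -
    have "\<mu> ` \<mu> ` \<tau> = \<tau>" for \<tau> using inv by (simp add: image_image)
    then show ?thesis unfolding \<kappa>_def double_cylinder_involution_def
      using inv by (cases x; cases "projl x") auto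
  qed
  let ?R = realization
  let ?n = "\<lambda>x :: 'a \<Rightarrow> real. x \<circ> \<nu>" and ?m = "\<lambda>x :: 'b \<Rightarrow> real. x \<circ> \<mu>"
  let ?k = "\<lambda>x :: ('a + 'b) + 'b set \<Rightarrow> real. x \<circ> \<kappa>"
  have "Z2_homotopy_equivalence (?R K) ?n (?R (image iK ` K)) ?k (realization_map iK)"
    by (rule realization_map_embedding[OF _ _ inv(1) inv\<kappa> K Z2_collapses_free[OF cK freeM]])
       (auto simp: iK_def \<kappa>_def double_cylinder_involution_def inj_on_def)
  from Z2_homotopy_equivalence_comp[OF this Z2_collapses_homotopy_equivalence[OF inv\<kappa> cK freeM]]
  have heK: "Z2_homotopy_equivalence (?R K) ?n (?R M) ?k (realization_map iK)" by simp
  have "Z2_homotopy_equivalence (?R L) ?m (?R (image iL ` L)) ?k (realization_map iL)"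
    by (rule realization_map_embedding[OF _ _ inv(2) inv\<kappa> L Z2_collapses_free[OF cL freeM]])
       (auto simp: iL_def \<kappa>_def double_cylinder_involution_def inj_on_def)
  from Z2_homotopy_equivalence_comp[OF this Z2_collapses_homotopy_equivalence[OF inv\<kappa> cL freeM]]
  have heL: "Z2_homotopy_equivalence (?R L) ?m (?R M) ?k (realization_map iL)" by simp
  define \<phi> where "\<phi> = case_sum (\<lambda>y w. of_bool (case_sum f id y = w)) (\<lambda>\<tau> w. of_bool (w \<in> \<tau>) / real (card \<tau>))"
  define V where "V = \<Union>M"
  define r where "r = affine_extension V \<phi>"
  have finV: "finite V" unfolding V_def using free_Z2_complexD(6)[OF freeM] .
  have cL': "finite_abstract_complex L" using L unfolding free_Z2_complex_def by blast
  have r_mem: "r x \<in> ?R L" if x: "x \<in> ?R M" for x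
    unfolding r_def
  proof (rule affine_extension_in_realization[OF cL' finV x])
    show "\<Union>M \<subseteq> V" unfolding V_def by simp
    fix \<rho> assume \<rho>: "\<rho> \<in> M"
    note c = cylinderD[OF \<rho>[unfolded M_def double_cylinder_def]]
    have fin\<rho>: "finite \<rho>" using free_Z2_complexD(2)[OF freeM \<rho>] .
    \<comment> \<open>The simplex of \<open>L\<close> that receives all of \<open>\<rho>\<close> is
      the largest member of the chain, or the image of the remaining part if there is no
      chain.\<close>
    have ex: "\<exists>\<theta>\<in>L. case_sum f id ` (Inl -` \<rho>) \<subseteq> \<theta> \<and> (\<forall>\<tau>\<in>Inr -` \<rho>. \<tau> \<subseteq> \<theta>)"
    proof (cases "Inr -` \<rho> = {}")
      case True
      then have "Inl -` \<rho> \<noteq> {}" using c(1) sum_set_decomp[of \<rho>] by (metis Un_empty image_empty)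
      then have *: "Inl -` \<rho> \<in> disjoint_union K L" using c(2) by blast
      have "case_sum f id ` (Inl -` \<rho>) \<in> L"
        by (rule double_cylinder_simplicial[OF K L _ _ *]) (simp_all only: eqv simplicial)
      then show ?thesis using True by blast
    next
      case False
      have "finite (Inr -` \<rho>)" using fin\<rho> by (intro finite_vimageI) (auto simp: inj_Inr)
      then obtain \<theta> where \<theta>: "\<theta> \<in> Inr -` \<rho>" "\<And>\<tau>. \<tau> \<in> Inr -` \<rho> \<Longrightarrow> \<theta> \<subseteq> \<tau> \<Longrightarrow> \<theta> = \<tau>"
        using finite_has_maximal[OF _ False] by blast
      have "\<tau> \<subseteq> \<theta>" if "\<tau> \<in> Inr -` \<rho>" for \<tau> using c(6)[OF that \<theta>(1)] \<theta>(2)[OF that] by blast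
      then show ?thesis using c(3) c(5)[OF \<theta>(1)] \<theta>(1) by blast
    qed
    then obtain \<theta> where \<theta>: "\<theta> \<in> L" "case_sum f id ` (Inl -` \<rho>) \<subseteq> \<theta>"
      and \<theta>': "\<forall>\<tau>\<in>Inr -` \<rho>. \<tau> \<subseteq> \<theta>" by (elim bexE conjE)
    have fin\<theta>: "finite \<theta>" using free_Z2_complexD(2)[OF L \<theta>(1)] .
    have "(\<forall>w. 0 \<le> \<phi> v w) \<and> (\<forall>w. w \<notin> \<theta> \<longrightarrow> \<phi> v w = 0) \<and> sum (\<phi> v) \<theta> = 1" if v: "v \<in> \<rho>" for v
    proof (cases v)
      case (Inl y)
      then have "case_sum f id y \<in> \<theta>" using v \<theta>(2) by blast
      then show ?thesis unfolding \<phi>_def Inl using fin\<theta> by auto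
    next
      case (Inr \<tau>)
      then have \<tau>: "\<tau> \<in> Inr -` \<rho>" using v by simp
      then have "\<tau> \<in> L" using c(3) by blast
      then have "card \<tau> \<noteq> 0" using free_Z2_complexD(2,3)[OF L] by (metis card_0_eq)
      moreover have "(\<Sum>w\<in>\<theta>. of_bool (w \<in> \<tau>)) = real (card \<tau>)"
        using fin\<theta> bspec[OF \<theta>' \<tau>] by (simp add: Int_absorb1)
      ultimately show ?thesis unfolding \<phi>_def Inr using bspec[OF \<theta>' \<tau>]
        by (auto simp: sum_divide_distrib[symmetric])
    qed
    then show "\<exists>\<theta>\<in>L. \<forall>v\<in>\<rho>. (\<forall>w. 0 \<le> \<phi> v w) \<and> (\<forall>w. w \<notin> \<theta> \<longrightarrow> \<phi> v w = 0) \<and> sum (\<phi> v) \<theta> = 1"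
      using \<theta>(1) by blast
  qed
  have inj\<mu>: "inj \<mu>" using inv(2) by (metis injI)
  have "r (x \<circ> \<kappa>) = r x \<circ> \<mu>" for x
    unfolding r_def
  proof (rule affine_extension_involution[OF inv\<kappa>])
    show "\<kappa> ` V = V"
      unfolding V_def using free_Z2_complex_vertices[OF freeM] inv\<kappa> by (auto simp: image_iff) (metis UnionI)+
    fix v w assume v: "v \<in> V"
    show "\<phi> (\<kappa> v) w = \<phi> v (\<mu> w)"
    proof (cases v)
      case (Inl y)
      have "case_sum f id (map_sum \<nu> \<mu> y) = \<mu> (case_sum f id y)"
      proof (cases y)
        case y: (Inl u)
        \<comment> \<open>\<open>f\<close> commutes with the involutions only on vertices of
          \<open>K\<close>, so \<open>u\<close> has to be traced back to a simplex.\<close>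
        obtain \<rho> where "\<rho> \<in> M" "y \<in> Inl -` \<rho>" using v Inl unfolding V_def by blast
        then have "y \<in> \<Union>(disjoint_union K L)"
          using cylinderD(4) unfolding M_def double_cylinder_def by blast
        then have "u \<in> \<Union>K" using y unfolding disjoint_union_def by blast
        then show ?thesis using eqv y by simp
      qed simp
      then show ?thesis
        unfolding \<phi>_def Inl \<kappa>_def double_cylinder_involution_def using inv(2) by auto
    next
      case (Inr \<tau>)
      have "w \<in> \<mu> ` \<tau> \<longleftrightarrow> \<mu> w \<in> \<tau>" using inv(2) by (metis image_iff)
      then show ?thesis
        unfolding \<phi>_def Inr \<kappa>_def double_cylinder_involution_def
        using card_image[OF inj_on_subset[OF inj\<mu>], of \<tau>] by simp
    qed
  qed
  then have rm: "Z2_map (?R M) ?k (?R L) ?m r"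
    using r_mem continuous_on_affine_extension unfolding Z2_map_def equivariant_on_def r_def by auto
  have iV: "iK ` \<Union>K \<subseteq> V" "iL ` \<Union>L \<subseteq> V"
  proof -
    have "image iK ` K \<subseteq> M" "image iL ` L \<subseteq> M"
      using Z2_collapses_subset cK cL by metis+
    then show "iK ` \<Union>K \<subseteq> V" "iL ` \<Union>L \<subseteq> V" unfolding V_def by blast+
  qed
  note finK = free_Z2_complexD(6)[OF K] and finL = free_Z2_complexD(6)[OF L]
  have r_iK: "r (realization_map iK x) = realization_map f x" if x: "x \<in> ?R K" for x
  proof -
    have "r (realization_map iK x) = affine_extension (\<Union>K) (\<phi> \<circ> iK) x"
      unfolding r_def by (rule affine_extension_realization_map[OF x finK finV iV(1)])
    also have "\<phi> \<circ> iK = (\<lambda>v w. if f v = w then 1 else 0)"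
      by (simp add: \<phi>_def iK_def fun_eq_iff)
    also have "affine_extension (\<Union>K) \<dots> x = realization_map f x"
      by (rule realization_map_eq_affine_extension[OF x finK subset_refl, symmetric])
    finally show ?thesis .
  qed
  have r_iL: "r (realization_map iL x) = x" if x: "x \<in> ?R L" for x
  proof -
    have "r (realization_map iL x) = affine_extension (\<Union>L) (\<phi> \<circ> iL) x"
      unfolding r_def by (rule affine_extension_realization_map[OF x finL finV iV(2)])
    also have "\<phi> \<circ> iL = (\<lambda>v w. if id v = w then 1 else 0)"
      by (simp add: \<phi>_def iL_def fun_eq_iff)
    also have "affine_extension (\<Union>L) \<dots> x = realization_map id x"
      by (rule realization_map_eq_affine_extension[OF x finL subset_refl, symmetric])
    \<comment> \<open>The identity counts as an involution here, so its realization is composition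
      with \<open>id\<close>.\<close>
    also have "\<dots> = x" using realization_map_involution[of id] by simp
    finally show ?thesis .
  qed
  have him: "Z2_map (?R L) ?m (?R M) ?k (realization_map iL)"
    using heL unfolding Z2_homotopy_equivalence_def by blast
  have "homotopic_with_canon (equivariant_on (?R L) ?m ?m) (?R L) (?R L) (r \<circ> realization_map iL) id"
    using r_iL realization_involution[OF inv(2) L] by (intro Z2_homotopic_eq[OF Z2_map_comp[OF him rm]]) auto
  then have "Z2_homotopy_equivalence (?R M) ?k (?R L) ?m r"
    by (rule Z2_homotopy_equivalence_left_inverse[OF heL rm])
  then have "Z2_homotopy_equivalence (?R K) ?n (?R L) ?m (r \<circ> realization_map iK)"
    by (rule Z2_homotopy_equivalence_comp[OF heK])
  then have "Z2_homotopy_equivalence (?R K) ?n (?R L) ?m (realization_map f)"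
    by (rule Z2_homotopy_equivalence_cong)
       (simp_all add: r_iK realization_involution[OF inv(1) K] realization_involution[OF inv(2) L])
  moreover have "realization_map \<nu> = ?n" "realization_map \<mu> = ?m"
    using realization_map_involution inv by blast+
  ultimately show ?thesis by simp
qed


section \<open>Box complexes of symmetric graphs\<close>

text \<open>The box condition with both colours treated alike, for symmetric graphs. Membership of
  vertices and absence of isolated ones are implied by the arcs to \<open>w\<close>. The empty set
  qualifies too, as wanted for the fibres.\<close>

definition box_simplex :: "'v pair_pre_digraph \<Rightarrow> ('v \<times> bool) set \<Rightarrow> bool" where
  "box_simplex H \<sigma> \<longleftrightarrow>
     (\<forall>a b c. (a, c) \<in> \<sigma> \<longrightarrow> (b, \<not> c) \<in> \<sigma> \<longrightarrow> (a, b) \<in> parcs H) \<and>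
     (\<forall>c. \<exists>w. \<forall>a. (a, c) \<in> \<sigma> \<longrightarrow> (a, w) \<in> parcs H)"

lemma box_simplexI:
  assumes "\<And>a b c. (a, c) \<in> \<sigma> \<Longrightarrow> (b, \<not> c) \<in> \<sigma> \<Longrightarrow> (a, b) \<in> parcs H"
    and "\<And>c. \<exists>w. \<forall>a. (a, c) \<in> \<sigma> \<longrightarrow> (a, w) \<in> parcs H"
  shows "box_simplex H \<sigma>"
  using assms unfolding box_simplex_def by simp

lemma box_simplexD:
  assumes "box_simplex H \<sigma>"
  shows "\<And>a b c. (a, c) \<in> \<sigma> \<Longrightarrow> (b, \<not> c) \<in> \<sigma> \<Longrightarrow> (a, b) \<in> parcs H"
    and "\<And>c. \<exists>w. \<forall>a. (a, c) \<in> \<sigma> \<longrightarrow> (a, w) \<in> parcs H"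
  using assms unfolding box_simplex_def by simp_all

lemma box_simplex_subset:
  assumes "box_simplex H \<sigma>" "\<rho> \<subseteq> \<sigma>"
  shows "box_simplex H \<rho>"
proof (rule box_simplexI)
  show "(a, b) \<in> parcs H" if "(a, c) \<in> \<rho>" "(b, \<not> c) \<in> \<rho>" for a b c
    using box_simplexD(1)[OF assms(1), of a c b] that assms(2) by blast
  show "\<exists>w. \<forall>a. (a, c) \<in> \<rho> \<longrightarrow> (a, w) \<in> parcs H" for c
    using box_simplexD(2)[OF assms(1), of c] assms(2) by blast
qed

lemma box_complex_iff:
  assumes "pair_pseudo_graph H"
  shows "\<sigma> \<in> box_complex H \<longleftrightarrow> \<sigma> \<noteq> {} \<and> box_simplex H \<sigma>"
proof -
  interpret pair_pseudo_graph H by fact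
  have sym: "(b, a) \<in> parcs H" if "(a, b) \<in> parcs H" for a b
    using that arcs_symmetric by blast
  have wf: "a \<in> pverts H" "b \<in> pverts H" if "(a, b) \<in> parcs H" for a b
    using that in_arcsD1 in_arcsD2 by blast+
  let ?N = "\<lambda>c. \<exists>v. v \<in> pverts H \<and> (\<exists>w. (v, w) \<in> parcs H) \<and> (\<forall>a. (a, c) \<in> \<sigma> \<longrightarrow> (a, v) \<in> parcs H)"
  have def: "\<sigma> \<in> box_complex H \<longleftrightarrow> \<sigma> \<noteq> {} \<and> (\<forall>(a, c)\<in>\<sigma>. a \<in> pverts H \<and> (\<exists>w. (a, w) \<in> parcs H)) \<and>
      (\<forall>a b. (a, False) \<in> \<sigma> \<longrightarrow> (b, True) \<in> \<sigma> \<longrightarrow> (a, b) \<in> parcs H) \<and> ?N False \<and> ?N True"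
    unfolding box_complex_def Let_def complete_to_def common_nbhd_def delete_isolated_def by auto
  show ?thesis
  proof
    assume \<sigma>: "\<sigma> \<in> box_complex H"
    have "box_simplex H \<sigma>"
    proof (rule box_simplexI)
      show "(a, b) \<in> parcs H" if "(a, c) \<in> \<sigma>" "(b, \<not> c) \<in> \<sigma>" for a b c
        using \<sigma>[unfolded def] that sym by (cases c) auto
      show "\<exists>w. \<forall>a. (a, c) \<in> \<sigma> \<longrightarrow> (a, w) \<in> parcs H" for c
        using \<sigma>[unfolded def] by (cases c) auto
    qed
    then show "\<sigma> \<noteq> {} \<and> box_simplex H \<sigma>" using \<sigma>[unfolded def] by blast
  next
    assume \<sigma>: "\<sigma> \<noteq> {} \<and> box_simplex H \<sigma>"
    then have nb: "\<exists>w. \<forall>a. (a, c) \<in> \<sigma> \<longrightarrow> (a, w) \<in> parcs H" for c using box_simplexD(2) by blast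
    have v: "a \<in> pverts H \<and> (\<exists>w. (a, w) \<in> parcs H)" if "(a, c) \<in> \<sigma>" for a c
      using nb[of c] that wf by blast
    have N: "?N c" for c
    proof (cases "\<exists>a. (a, c) \<in> \<sigma>")
      case True
      then show ?thesis using nb[of c] wf sym by blast
    next
      \<comment> \<open>For an empty colour class any non-isolated vertex is a common neighbour; one
        occurs in the other class because \<open>\<sigma>\<close> is nonempty.\<close>
      case False
      obtain a c' where "(a, c') \<in> \<sigma>" using \<sigma> by auto
      then show ?thesis using v False by blast
    qed
    show "\<sigma> \<in> box_complex H"
      unfolding def using \<sigma> v N box_simplexD(1)[of H \<sigma> _ False] by auto
  qed
qed

lemma box_involution_simps [simp]:
  "box_involution (a, c) = (a, \<not> c)" "box_involution (box_involution v) = v"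
  unfolding box_involution_def by (auto simp: apsnd_def map_prod_def split: prod.splits)

lemma mem_box_involution_image: "(a, c) \<in> box_involution ` \<sigma> \<longleftrightarrow> (a, \<not> c) \<in> \<sigma>"
  by (metis box_involution_simps image_iff)

text \<open>An invariant simplex contains some vertex in both colours, and completeness between the
  colours would make it a loop.\<close>

lemma free_Z2_complex_box:
  assumes "pair_pseudo_graph H" "\<And>v. (v, v) \<notin> parcs H"
  shows "free_Z2_complex (box_complex H) box_involution"
proof -
  interpret pair_pseudo_graph H by fact
  note iff = box_complex_iff[OF assms(1)]
  have sub: "\<sigma> \<subseteq> pverts H \<times> UNIV" if "\<sigma> \<in> box_complex H" for \<sigma>
    using box_simplexD(2)[of H \<sigma>] that[unfolded iff] in_arcsD1 by auto
  have fin: "finite (pverts H \<times> (UNIV :: bool set))" using pair_finite_verts by simp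
  have "finite_abstract_complex (box_complex H)"
    unfolding finite_abstract_complex_def
  proof (intro conjI ballI allI impI)
    have "box_complex H \<subseteq> Pow (pverts H \<times> UNIV)" using sub by blast
    then show "finite (box_complex H)" using fin by (meson finite_Pow_iff finite_subset)
    fix \<sigma> assume \<sigma>: "\<sigma> \<in> box_complex H"
    show "finite \<sigma>" using sub[OF \<sigma>] fin by (rule finite_subset)
    show "\<sigma> \<noteq> {}" using \<sigma>[unfolded iff] by blast
    show "\<rho> \<in> box_complex H" if "\<rho> \<noteq> {} \<and> \<rho> \<subseteq> \<sigma>" for \<rho>
      using that \<sigma> box_simplex_subset unfolding iff by blast
  qed
  moreover have "box_involution ` \<sigma> \<in> box_complex H" if "\<sigma> \<in> box_complex H" for \<sigma>
  proof -
    have b: "box_simplex H \<sigma>" "\<sigma> \<noteq> {}" using that[unfolded iff] by blast+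
    have "box_simplex H (box_involution ` \<sigma>)"
      by (rule box_simplexI) (unfold mem_box_involution_image, rule box_simplexD[OF b(1)], assumption+,
          rule box_simplexD[OF b(1)])
    then show ?thesis unfolding iff using b by blast
  qed
  moreover have "box_involution ` \<sigma> \<noteq> \<sigma>" if "\<sigma> \<in> box_complex H" for \<sigma>
  proof
    assume eq: "box_involution ` \<sigma> = \<sigma>"
    have b: "box_simplex H \<sigma>" "\<sigma> \<noteq> {}" using that[unfolded iff] by blast+
    then obtain a c where a: "(a, c) \<in> \<sigma>" by auto
    then have "(a, \<not> c) \<in> \<sigma>" using eq mem_box_involution_image[of a c \<sigma>] by simp
    then have "(a, a) \<in> parcs H" by (rule box_simplexD(1)[OF b(1) a])
    then show False using assms(2) by blast
  qed
  ultimately show ?thesis unfolding free_Z2_complex_def by (intro conjI ballI) simp_all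
qed

lemma box_simplex_hom:
  assumes "graph_hom H H' h" "box_simplex H \<sigma>"
  shows "box_simplex H' (apfst h ` \<sigma>)"
proof (rule box_simplexI)
  have h: "(h a, h b) \<in> parcs H'" if "(a, b) \<in> parcs H" for a b
    using assms(1) that unfolding graph_hom_def by auto
  have mem: "\<exists>a'. a = h a' \<and> (a', c) \<in> \<sigma>" if "(a, c) \<in> apfst h ` \<sigma>" for a c
    using that by auto
  show "(a, b) \<in> parcs H'" if "(a, c) \<in> apfst h ` \<sigma>" "(b, \<not> c) \<in> apfst h ` \<sigma>" for a b c
    using mem[OF that(1)] mem[OF that(2)] h box_simplexD(1)[OF assms(2)] by blast
  show "\<exists>w. \<forall>a. (a, c) \<in> apfst h ` \<sigma> \<longrightarrow> (a, w) \<in> parcs H'" for c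
    using box_simplexD(2)[OF assms(2), of c] mem h by metis
qed


section \<open>The graphs $\Omega_{2k-1}(G)$ and $\Omega_{2k+1}(G)$\<close>

context
  fixes G :: "'a pair_pre_digraph"
  assumes G: "pair_graph G"
begin

interpretation pair_graph G by (rule G)

lemma complete_to_sym: "complete_to G A B \<longleftrightarrow> complete_to G B A"
  unfolding complete_to_def using arcs_symmetric by blast

lemma complete_to_mono: "complete_to G A B \<Longrightarrow> A' \<subseteq> A \<Longrightarrow> B' \<subseteq> B \<Longrightarrow> complete_to G A' B'"
  unfolding complete_to_def by blast

lemma complete_to_Union: "complete_to G A (\<Union>(f ` B)) \<longleftrightarrow> (\<forall>b\<in>B. complete_to G A (f b))"
  unfolding complete_to_def by blast

lemma complete_to_common_nbhd: "complete_to G A (common_nbhd G A)"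
  unfolding complete_to_def common_nbhd_def by blast

lemma subset_common_nbhd_iff: "B \<subseteq> common_nbhd G A \<longleftrightarrow> B \<subseteq> pverts G \<and> complete_to G A B"
  unfolding complete_to_def common_nbhd_def by blast

lemma Omega_odd:
  "(A, B) \<in> parcs (Omega (2 * l + 1) G) \<longleftrightarrow>
     A \<in> Omega_tuples l G \<and> B \<in> Omega_tuples l G \<and> Omega_adj l G A B"
  "pverts (Omega (2 * l + 1) G) = Omega_tuples l G"
  unfolding Omega_def Let_def by simp_all

lemma Omega_pair_pseudo_graph: "pair_pseudo_graph (Omega (2 * l + 1) G)"
proof
  show "fst e \<in> pverts (Omega (2 * l + 1) G)" "snd e \<in> pverts (Omega (2 * l + 1) G)"
    if "e \<in> parcs (Omega (2 * l + 1) G)" for e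
    using that Omega_odd by (cases e; simp)+
  have "Omega_tuples l G \<subseteq> {A. set A \<subseteq> Pow (pverts G) \<and> length A = l + 1}"
  proof (intro subsetI CollectI conjI)
    fix A B assume A: "A \<in> Omega_tuples l G" and "B \<in> set A"
    then obtain i where "i \<le> l" "B = A ! i"
      unfolding Omega_tuples_def by (auto simp: in_set_conv_nth less_Suc_eq_le)
    then show "B \<in> Pow (pverts G)" using A unfolding Omega_tuples_def by blast
  qed (simp add: Omega_tuples_def)
  moreover have "finite {A. set A \<subseteq> Pow (pverts G) \<and> length A = l + 1}"
    by (intro finite_lists_length_eq) simp
  ultimately show fin: "finite (pverts (Omega (2 * l + 1) G))"
    unfolding Omega_odd(2) by (rule finite_subset)
  have "parcs (Omega (2 * l + 1) G) \<subseteq> pverts (Omega (2 * l + 1) G) \<times> pverts (Omega (2 * l + 1) G)"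
    using Omega_odd by auto
  then show "finite (parcs (Omega (2 * l + 1) G))" using fin by (meson finite_SigmaI finite_subset)
  have "Omega_adj l G B A" if "Omega_adj l G A B" for A B
    using that complete_to_sym unfolding Omega_adj_def by blast
  then show "symmetric (with_proj (Omega (2 * l + 1) G))"
    using Omega_odd by (auto simp: symmetric_def intro!: symI)
qed

text \<open>Adjacency of \<open>A\<close> to itself makes its entries increasing, so the single
  vertex of \<open>A ! 0\<close> lies in the last entry; that entry is complete to itself, which
  would give a loop in \<open>G\<close>.\<close>

lemma Omega_no_loops: "(A, A) \<notin> parcs (Omega (2 * l + 1) G)"
proof
  assume "(A, A) \<in> parcs (Omega (2 * l + 1) G)"
  then have A: "A \<in> Omega_tuples l G" "Omega_adj l G A A" unfolding Omega_odd by blast+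
  then obtain v where v: "A ! 0 = {v}" unfolding Omega_tuples_def by (auto simp: card_1_singleton_iff)
  have "v \<in> A ! i" if "i \<le> l" for i
    using that
  proof (induction i)
    case (Suc i)
    have "A ! (Suc i - 1) \<subseteq> A ! Suc i"
      using bspec[OF conjunct1[OF A(2)[unfolded Omega_adj_def]], of "Suc i"] Suc.prems by simp
    then show ?case using Suc by auto
  qed (simp add: v)
  then have "(v, v) \<in> parcs G" using A(2) unfolding Omega_adj_def complete_to_def by blast
  then show False using pair_no_loops by fastforce
qed

lemma Omega_tuples_length: "A \<in> Omega_tuples l G \<Longrightarrow> length A = Suc l"
  unfolding Omega_tuples_def by simp

lemma Omega_tuples_snoc:
  assumes "length A = Suc l"
  shows "A @ [X] \<in> Omega_tuples (Suc l) G \<longleftrightarrow>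
    A \<in> Omega_tuples l G \<and> X \<subseteq> pverts G \<and> complete_to G (last A) X"
proof -
  have l: "last A = A ! l" using assms by (metis diff_Suc_1 last_conv_nth length_0_conv nat.distinct(1))
  have n: "(A @ [X]) ! i = A ! i" if "i \<le> l" for i using that assms by (simp add: nth_append)
  have n': "(A @ [X]) ! (i - 1) = A ! (i - 1)" if "1 \<le> i \<and> i \<le> l" for i
    by (rule n) (use that in linarith)
  have nl: "(A @ [X]) ! Suc l = X" using assms by (metis nth_append_length)
  have 1: "(\<forall>i\<le>Suc l. (A @ [X]) ! i \<subseteq> pverts G) \<longleftrightarrow> (\<forall>i\<le>l. A ! i \<subseteq> pverts G) \<and> X \<subseteq> pverts G"
    using n nl by (metis le_Suc_eq)
  have 2: "(\<forall>i\<in>{1..Suc l}. complete_to G ((A @ [X]) ! (i - 1)) ((A @ [X]) ! i)) \<longleftrightarrow>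
      (\<forall>i\<in>{1..l}. complete_to G (A ! (i - 1)) (A ! i)) \<and> complete_to G (A ! l) X"
  proof -
    have "(\<forall>i\<in>{1..l}. complete_to G ((A @ [X]) ! (i - 1)) ((A @ [X]) ! i)) \<longleftrightarrow>
        (\<forall>i\<in>{1..l}. complete_to G (A ! (i - 1)) (A ! i))"
      by (intro ball_cong refl) (simp only: atLeastAtMost_iff n n')
    moreover have "{1..Suc l} = insert (Suc l) {1..l}" by auto
    ultimately show ?thesis using n[OF order_refl] nl by auto
  qed
  show ?thesis
    unfolding Omega_tuples_def mem_Collect_eq 1 2 l using assms n[of 0] by auto
qed

lemma Omega_adj_snoc:
  assumes "length A = Suc l" "length B = Suc l"
  shows "Omega_adj (Suc l) G (A @ [X]) (B @ [Y]) \<longleftrightarrow>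
    (\<forall>i\<in>{1..l}. A ! (i - 1) \<subseteq> B ! i \<and> B ! (i - 1) \<subseteq> A ! i) \<and>
    last A \<subseteq> Y \<and> last B \<subseteq> X \<and> complete_to G X Y"
proof -
  have l: "last A = A ! l" "last B = B ! l"
    using assms by (metis diff_Suc_1 last_conv_nth length_0_conv nat.distinct(1))+
  have n: "(A @ [X]) ! i = A ! i" "(B @ [Y]) ! i = B ! i" if "i \<le> l" for i
    using that assms by (simp_all add: nth_append)
  have nl: "(A @ [X]) ! Suc l = X" "(B @ [Y]) ! Suc l = Y" using assms by (metis nth_append_length)+
  have n': "(A @ [X]) ! (i - 1) = A ! (i - 1)" "(B @ [Y]) ! (i - 1) = B ! (i - 1)"
    if "1 \<le> i \<and> i \<le> l" for i
    by (rule n, use that in linarith)+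
  have "(\<forall>i\<in>{1..l}. (A @ [X]) ! (i - 1) \<subseteq> (B @ [Y]) ! i \<and> (B @ [Y]) ! (i - 1) \<subseteq> (A @ [X]) ! i) \<longleftrightarrow>
      (\<forall>i\<in>{1..l}. A ! (i - 1) \<subseteq> B ! i \<and> B ! (i - 1) \<subseteq> A ! i)"
    by (intro ball_cong refl) (simp only: atLeastAtMost_iff n n')
  moreover have "{1..Suc l} = insert (Suc l) {1..l}" by auto
  ultimately show ?thesis unfolding Omega_adj_def l using n[OF order_refl] nl by auto
qed

text \<open>Adjacency of the longer tuples no longer mentions completeness of \<open>last A\<close>
  to \<open>last B\<close>. It is recovered from \<open>last A \<subseteq> Y\<close> and
  completeness of \<open>last B\<close> to \<open>Y\<close>, which is why truncation is a
  homomorphism.\<close>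

lemma Omega_arc_snoc:
  "(A @ [X], B @ [Y]) \<in> parcs (Omega (2 * Suc l + 1) G) \<longleftrightarrow>
     (A, B) \<in> parcs (Omega (2 * l + 1) G) \<and> X \<subseteq> pverts G \<and> Y \<subseteq> pverts G \<and>
     complete_to G (last A) X \<and> complete_to G (last B) Y \<and>
     last A \<subseteq> Y \<and> last B \<subseteq> X \<and> complete_to G X Y"
proof (cases "length A = Suc l \<and> length B = Suc l")
  case True
  then have l: "last A = A ! l" "last B = B ! l"
    by (metis diff_Suc_1 last_conv_nth length_0_conv nat.distinct(1))+
  have "complete_to G (A ! l) (B ! l)" if "complete_to G (last B) Y" "last A \<subseteq> Y"
    using that complete_to_sym complete_to_mono unfolding l by blast
  then show ?thesis
    using True unfolding Omega_odd Omega_tuples_snoc[OF conjunct1[OF True]] Omega_tuples_snoc[OF conjunct2[OF True]]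
      Omega_adj_snoc[OF conjunct1[OF True] conjunct2[OF True]] Omega_adj_def[of l] by blast
next
  case False
  then show ?thesis unfolding Omega_odd using Omega_tuples_length by fastforce
qed

lemma Omega_arc_last:
  assumes "(A, B) \<in> parcs (Omega (2 * l + 1) G)"
  shows "complete_to G (last A) (last B)" "last A \<subseteq> pverts G"
proof -
  have AB: "A \<in> Omega_tuples l G" "B \<in> Omega_tuples l G" "Omega_adj l G A B"
    using assms unfolding Omega_odd by blast+
  then have l: "last A = A ! l" "last B = B ! l"
    using Omega_tuples_length by (metis diff_Suc_1 last_conv_nth length_0_conv nat.distinct(1))+
  show "complete_to G (last A) (last B)" unfolding l using AB(3) unfolding Omega_adj_def by blast
  show "last A \<subseteq> pverts G" unfolding l using AB(1) unfolding Omega_tuples_def by blast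
qed

lemma Omega_arc_obtain_snoc:
  assumes "(A', B') \<in> parcs (Omega (2 * Suc l + 1) G)"
  obtains A X B Y where "A' = A @ [X]" "B' = B @ [Y]"
proof -
  have "length A' = Suc (Suc l)" "length B' = Suc (Suc l)"
    using assms Omega_tuples_length unfolding Omega_odd by blast+
  then have "A' = butlast A' @ [last A']" "B' = butlast B' @ [last B']"
    by (metis append_butlast_last_id length_0_conv nat.distinct(1))+
  then show thesis by (rule that)
qed

lemma graph_hom_butlast:
  "graph_hom (Omega (2 * Suc l + 1) G) (Omega (2 * l + 1) G) butlast"
  unfolding graph_hom_def
proof (intro conjI ballI)
  fix A' assume A': "A' \<in> pverts (Omega (2 * Suc l + 1) G)"
  then obtain A X where A: "A' = A @ [X]" "length A = Suc l"
    using Omega_tuples_length[of A' "Suc l"] unfolding Omega_odd by (metis length_Suc_conv_rev)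
  then show "butlast A' \<in> pverts (Omega (2 * l + 1) G)"
    using A' Omega_tuples_snoc[OF A(2)] unfolding Omega_odd by simp
next
  fix e assume "e \<in> parcs (Omega (2 * Suc l + 1) G)"
  then show "case e of (A, B) \<Rightarrow> (butlast A, butlast B) \<in> parcs (Omega (2 * l + 1) G)"
  proof (cases e)
    case (Pair A' B')
    assume "e \<in> parcs (Omega (2 * Suc l + 1) G)"
    then have arc: "(A', B') \<in> parcs (Omega (2 * Suc l + 1) G)" using Pair by simp
    obtain A X B Y where "A' = A @ [X]" "B' = B @ [Y]" by (rule Omega_arc_obtain_snoc[OF arc])
    then show ?thesis using arc unfolding Pair prod.case by (simp only: butlast_snoc Omega_arc_snoc)
  qed
qed

end


section \<open>The fibres of the truncation\<close>

context
  fixes G :: "'a pair_pre_digraph" and l :: nat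
  assumes G: "pair_graph G"
begin

private abbreviation E :: "'a set list \<Rightarrow> 'a set list \<Rightarrow> bool" where
  "E A B \<equiv> (A, B) \<in> parcs (Omega (2 * l + 1) G)"

private abbreviation E' :: "'a set list \<Rightarrow> 'a set list \<Rightarrow> bool" where
  "E' A B \<equiv> (A, B) \<in> parcs (Omega (2 * Suc l + 1) G)"

private lemmas snoc = Omega_arc_snoc[OF G, where l = l]
private lemmas arc_last = Omega_arc_last[OF G, where l = l]
private lemmas sym = complete_to_sym[OF G]
private lemmas mono = complete_to_mono[OF G]

lemma Omega_arc_sym: "(A, B) \<in> parcs (Omega (2 * m + 1) G) \<Longrightarrow> (B, A) \<in> parcs (Omega (2 * m + 1) G)"
proof -
  interpret pair_pseudo_graph "Omega (2 * m + 1) G" by (rule Omega_pair_pseudo_graph[OF G])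
  show "(A, B) \<in> parcs (Omega (2 * m + 1) G) \<Longrightarrow> (B, A) \<in> parcs (Omega (2 * m + 1) G)"
    using arcs_symmetric by blast
qed

private lemma E'_snoc: "E' a b \<Longrightarrow> a = butlast a @ [last a]"
  by (rule Omega_arc_obtain_snoc[OF G]) auto

text \<open>Cutting down \<open>Z\<close> preserves every condition on it except that it contain the
  preceding entry of \<open>a\<close>; that entry is complete to \<open>N\<close>, so it survives
  the cut.\<close>

lemma Omega_arc_shrink:
  assumes "E' a (C @ [Z])" "complete_to G (last (butlast a)) N"
  shows "E' a (C @ [Z \<inter> common_nbhd G N])"
proof -
  define A X where "A = butlast a" and "X = last a"
  have a: "a = A @ [X]" using E'_snoc[OF assms(1)] unfolding A_def X_def .
  have arc: "E A C" "X \<subseteq> pverts G" "Z \<subseteq> pverts G" "complete_to G (last A) X" "complete_to G (last C) Z"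
    "last A \<subseteq> Z" "last C \<subseteq> X" "complete_to G X Z"
    using assms(1) unfolding a snoc by blast+
  have "last A \<subseteq> common_nbhd G N"
    unfolding subset_common_nbhd_iff[OF G] using arc_last(2)[OF arc(1)] assms(2) sym unfolding A_def by blast
  moreover have "complete_to G (last C) (Z \<inter> common_nbhd G N)" "complete_to G X (Z \<inter> common_nbhd G N)"
    using arc(5,8) mono by blast+
  ultimately show ?thesis unfolding a snoc using arc by blast
qed

text \<open>Counterpart of \<open>Omega_arc_shrink\<close>: the shrunken neighbour is complete to
  \<open>N\<close> as well, so it stays adjacent when \<open>N\<close> joins the last entry of
  \<open>a\<close>. Together they let the enlarged tuple join any simplex containing
  \<open>a\<close> whose other members tolerate the same cut.\<close>

lemma Omega_arc_enlarge:
  assumes "E' a (C @ [Z])" "complete_to G (last (butlast a)) N" "N \<subseteq> pverts G"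
  shows "E' (butlast a @ [last a \<union> N]) (C @ [Z \<inter> common_nbhd G N])"
proof -
  define A X where "A = butlast a" and "X = last a"
  have a: "a = A @ [X]" using E'_snoc[OF assms(1)] unfolding A_def X_def .
  have arc: "E A C" "X \<subseteq> pverts G" "Z \<inter> common_nbhd G N \<subseteq> pverts G" "complete_to G (last A) X"
    "complete_to G (last C) (Z \<inter> common_nbhd G N)" "last A \<subseteq> Z \<inter> common_nbhd G N" "last C \<subseteq> X"
    "complete_to G X (Z \<inter> common_nbhd G N)"
    using Omega_arc_shrink[OF assms(1,2)] unfolding a snoc by blast+
  have "complete_to G (last A) (X \<union> N)"
    using arc(4) assms(2) unfolding complete_to_def A_def by blast
  moreover have "complete_to G (X \<union> N) (Z \<inter> common_nbhd G N)"
    using arc(8) complete_to_common_nbhd[OF G, of N] unfolding complete_to_def by blast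
  ultimately show ?thesis
    unfolding A_def[symmetric] X_def[symmetric] snoc using arc assms(3) by blast
qed

private lemma finite_E': "finite (pverts (Omega (2 * Suc l + 1) G))"
  using Omega_pair_pseudo_graph[OF G] by (rule pair_fin_digraph.pair_finite_verts[OF pair_pseudo_graph.axioms(1)])

private lemma E'_verts: "E' a b \<Longrightarrow> a \<in> pverts (Omega (2 * Suc l + 1) G)"
  unfolding Omega_odd[OF G] by blast

text \<open>
  With \<open>n\<close> the common neighbourhood of the last entries in \<open>S\<close>, a tuple \<open>A @ [X]\<close> is dominated by
  \<open>A @ [X \<union> n]\<close>; once every last entry contains \<open>n\<close>, it is dominated by \<open>A @ [n]\<close>; and the tuples
  \<open>A @ [n]\<close> span a full simplex.
\<close>

lemma removable_common_neighbours:
  assumes A0: "A0 \<in> S" and Y: "\<And>A. A \<in> S \<Longrightarrow> E A Y"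
  shows "removable {S'. butlast ` S' \<subseteq> S \<and> (\<exists>w. \<forall>a\<in>S'. E' a w)}" (is "removable ?F")
proof -
  define n where "n = common_nbhd G (\<Union>(last ` S))"
  have nP: "n \<subseteq> pverts G" unfolding n_def common_nbhd_def by blast
  have Sn: "complete_to G (last A) n" if "A \<in> S" for A
    using complete_to_common_nbhd[OF G, of "\<Union>(last ` S)"] that unfolding n_def complete_to_def by blast
  have Yn: "last Y \<subseteq> n"
  proof -
    have "last Y \<subseteq> pverts G" using arc_last(2)[OF Omega_arc_sym[OF Y[OF A0]]] .
    moreover have "complete_to G (\<Union>(last ` S)) (last Y)"
      using arc_last(1)[OF Y] unfolding complete_to_def by blast
    ultimately show ?thesis unfolding n_def subset_common_nbhd_iff[OF G] by blast
  qed
  have sub: "S' \<subseteq> pverts (Omega (2 * Suc l + 1) G)" if "S' \<in> ?F" for S'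
    using that E'_verts by blast
  then have "?F \<subseteq> Pow (pverts (Omega (2 * Suc l + 1) G))" by blast
  then have finF: "finite ?F" using finite_E' by (meson finite_Pow_iff finite_subset)
  have fin: "finite S'" if "S' \<in> ?F" for S' using sub[OF that] finite_E' by (rule finite_subset)
  have down: "R \<in> ?F" if "S' \<in> ?F" "R \<subseteq> S'" for S' R using that by blast
  let ?D = "{a. \<not> n \<subseteq> last a}" and ?D2 = "{a. last a \<noteq> n}"
  let ?F1 = "{S' \<in> ?F. S' \<inter> ?D = {}}"
  let ?F2 = "{S' \<in> ?F1. S' \<inter> ?D2 = {}}"
  \<comment> \<open>One neighbour serves all tuples ending in \<open>n\<close>: \<open>n\<close> is
    by definition complete to the union of the last entries, and \<open>Y\<close> is adjacent to
    everything in \<open>S\<close>.\<close>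
  have n_arc: "E' (A @ [n]) (Y @ [\<Union>(last ` S)])" if A: "A \<in> S" for A
  proof -
    have "\<Union>(last ` S) \<subseteq> pverts G" using arc_last(2)[OF Y] by blast
    moreover have "complete_to G (last Y) (\<Union>(last ` S))"
      using arc_last(1)[OF Y] sym unfolding complete_to_Union[OF G] by blast
    moreover have "complete_to G n (\<Union>(last ` S))"
      using complete_to_common_nbhd[OF G] sym unfolding n_def by blast
    ultimately show ?thesis unfolding snoc using Y[OF A] nP Sn[OF A] Yn A by blast
  qed
  have "removable ?F2"
  proof (rule removable_cone[where v = "A0 @ [n]"])
    fix S' assume S': "S' \<in> ?F2"
    have "E' a (Y @ [\<Union>(last ` S)])" if a: "a \<in> S'" for a
    proof -
      have "butlast a \<in> S" "last a = n" using S' a by blast+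
      moreover obtain w where "E' a w" using S' a by blast
      then have "a = butlast a @ [last a]" by (rule E'_snoc)
      ultimately show ?thesis using n_arc by metis
    qed
    then have "insert (A0 @ [n]) S' \<in> ?F" using S' A0 n_arc[OF A0] by auto
    then show "insert (A0 @ [n]) S' \<in> ?F2" using S' by simp
    show "S' - {A0 @ [n]} \<in> ?F2" using S' by blast
    show "finite S'" using S' fin by blast
  next
    show "finite ?F2" by (rule finite_subset[OF _ finF]) blast
  qed
  have "removable ?F1"
  proof (rule removable_dominated[where D = ?D2 and d = "\<lambda>a. butlast a @ [n]"])
    fix S' a assume S': "S' \<in> ?F1" and a: "a \<in> S'"
    obtain w where w: "\<And>b. b \<in> S' \<Longrightarrow> E' b w" using S' by blast
    obtain C Z where CZ: "w = C @ [Z]" using E'_snoc[OF Omega_arc_sym[OF w[OF a]]] by blast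
    \<comment> \<open>\<open>W\<close> is the least last entry a common neighbour can have. Being
      contained in \<open>Z\<close> it is complete to all last entries of \<open>S'\<close>. The
      other entries may then be taken from \<open>Y\<close>, since
      \<open>last Y \<subseteq> n\<close> lies in every last entry by now.\<close>
    define W where "W = (\<Union>b\<in>S'. last (butlast b))"
    have bS: "butlast b \<in> S" "n \<subseteq> last b" if "b \<in> S'" for b using S' that by blast+
    have arc: "last b \<subseteq> pverts G" "complete_to G (last (butlast b)) (last b)"
      "last (butlast b) \<subseteq> Z" "complete_to G (last b) Z" if "b \<in> S'" for b
    proof -
      have "E' (butlast b @ [last b]) (C @ [Z])" using E'_snoc[OF w[OF that]] w[OF that] CZ by simp
      then show "last b \<subseteq> pverts G" "complete_to G (last (butlast b)) (last b)"
        "last (butlast b) \<subseteq> Z" "complete_to G (last b) Z" unfolding snoc by blast+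
    qed
    have WZ: "W \<subseteq> Z" using arc(3) unfolding W_def by blast
    have WP: "W \<subseteq> pverts G" using arc_last(2)[OF Y] bS(1) unfolding W_def by blast
    have YW: "complete_to G (last Y) W"
      using arc_last(1)[OF Y] bS(1) sym unfolding W_def complete_to_Union[OF G] by blast
    have nbr: "E' b (Y @ [W])" if b: "b \<in> S'" for b
    proof -
      have "complete_to G (last b) W" using arc(4)[OF b] WZ mono by blast
      moreover have "last (butlast b) \<subseteq> W" using b unfolding W_def by blast
      moreover have "last Y \<subseteq> last b" using Yn bS(2)[OF b] by blast
      ultimately have "E' (butlast b @ [last b]) (Y @ [W])"
        unfolding snoc using Y[OF bS(1)[OF b]] arc(1,2)[OF b] WP YW by blast
      then show ?thesis using E'_snoc[OF w[OF b]] by simp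
    qed
    have "complete_to G n W"
      using bS(2)[OF a] arc(4)[OF a] WZ mono by blast
    moreover have "last (butlast a) \<subseteq> W" using a unfolding W_def by blast
    ultimately have "E' (butlast a @ [n]) (Y @ [W])"
      unfolding snoc using Y[OF bS(1)[OF a]] nP Sn[OF bS(1)[OF a]] WP YW Yn by blast
    then have "insert (butlast a @ [n]) S' \<in> ?F" using nbr S' bS(1)[OF a] by auto
    then show "insert (butlast a @ [n]) S' \<in> ?F1" using S' by simp
    show "S' - {butlast a @ [n]} \<in> ?F1" using S' by blast
  next
    show "finite ?F1" by (rule finite_subset[OF _ finF]) blast
    show "finite S'" if "S' \<in> ?F1" for S' using that fin by blast
    show "butlast a @ [n] \<notin> ?D2" for a by simp
  qed fact
  show ?thesis
  proof (rule removable_dominated[where F = ?F and D = ?D and d = "\<lambda>a. butlast a @ [last a \<union> n]"])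
    fix S' a assume S': "S' \<in> ?F" and a: "a \<in> S'"
    obtain w where w: "\<And>b. b \<in> S' \<Longrightarrow> E' b w" using S' by blast
    obtain C Z where CZ: "w = C @ [Z]" using E'_snoc[OF Omega_arc_sym[OF w[OF a]]] by blast
    have bS: "butlast b \<in> S" if "b \<in> S'" for b using S' that by blast
    \<comment> \<open>Every member of \<open>S'\<close> lies over \<open>S\<close>, hence tolerates
      the same cut by \<open>n\<close>, and the shrunken neighbour stays common to all.\<close>
    have "E' b (C @ [Z \<inter> common_nbhd G n])" if "b \<in> S'" for b
      using Omega_arc_shrink w[OF that] Sn[OF bS[OF that]] unfolding CZ by blast
    moreover have "E' (butlast a @ [last a \<union> n]) (C @ [Z \<inter> common_nbhd G n])"
      using Omega_arc_enlarge w[OF a] Sn[OF bS[OF a]] nP unfolding CZ by blast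
    ultimately show "insert (butlast a @ [last a \<union> n]) S' \<in> ?F" using S' bS[OF a] by auto
    show "S' - {butlast a @ [last a \<union> n]} \<in> ?F" using S' by blast
  next
    show "finite S'" if "S' \<in> ?F" for S' using that by (rule fin)
    show "butlast a @ [last a \<union> n] \<notin> ?D" for a by simp
  qed fact+
qed

text \<open>With a single colour present the completeness between colours is vacuous and only the
  common neighbour counts, so the fibre is a copy of the family of
  \<open>removable_common_neighbours\<close>. Here \<open>\<tau>\<close> itself may have both
  colours.\<close>

lemma removable_one_coloured_fibre:
  assumes \<tau>: "box_simplex (Omega (2 * l + 1) G) \<tau>" and A0: "(A0, c) \<in> \<tau>"
  shows "removable {\<sigma>. box_simplex (Omega (2 * Suc l + 1) G) \<sigma> \<and> apfst butlast ` \<sigma> \<subseteq> \<tau> \<and> (\<forall>a. (a, \<not> c) \<notin> \<sigma>)}"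
proof -
  let ?S = "{A. (A, c) \<in> \<tau>}"
  let ?F = "{S'. butlast ` S' \<subseteq> ?S \<and> (\<exists>w. \<forall>a\<in>S'. E' a w)}"
  obtain Y where Y: "\<And>A. (A, c) \<in> \<tau> \<Longrightarrow> E A Y" using box_simplexD(2)[OF \<tau>, of c] by blast
  have "removable ?F"
    by (rule removable_common_neighbours[of A0 _ Y]) (use A0 Y in auto)
  then have "removable ((\<lambda>S'. S' \<times> {c}) ` ?F)"
    by (rule removable_image) (auto simp: inj_on_def)
  moreover have "{\<sigma>. box_simplex (Omega (2 * Suc l + 1) G) \<sigma> \<and> apfst butlast ` \<sigma> \<subseteq> \<tau> \<and> (\<forall>a. (a, \<not> c) \<notin> \<sigma>)} =
      (\<lambda>S'. S' \<times> {c}) ` ?F" (is "?A = ?B")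
  proof (intro equalityI subsetI)
    fix \<sigma> assume \<sigma>: "\<sigma> \<in> ?A"
    have "c' = c" if "(a, c') \<in> \<sigma>" for a c'
      using \<sigma> that by (cases "c' = (\<not> c)") auto
    then have "\<sigma> = {a. (a, c) \<in> \<sigma>} \<times> {c}" by auto
    moreover have "{a. (a, c) \<in> \<sigma>} \<in> ?F"
      using \<sigma> box_simplexD(2)[of "Omega (2 * Suc l + 1) G" \<sigma> c] by (auto simp: image_subset_iff)
    ultimately show "\<sigma> \<in> ?B" by (rule image_eqI)
  next
    fix \<sigma> assume "\<sigma> \<in> ?B"
    then obtain S' w where S': "\<sigma> = S' \<times> {c}" "butlast ` S' \<subseteq> ?S" "\<And>a. a \<in> S' \<Longrightarrow> E' a w" by auto
    have "box_simplex (Omega (2 * Suc l + 1) G) \<sigma>"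
    proof (rule box_simplexI)
      show "\<exists>w. \<forall>a. (a, c') \<in> \<sigma> \<longrightarrow> E' a w" for c' using S' by blast
    qed (use S' in auto)
    then show "\<sigma> \<in> ?A" using S' by auto
  qed
  ultimately show ?thesis by simp
qed

text \<open>
  In \<open>C\<close>, the simplices whose part of colour \<open>c\<close> has no common neighbour over \<open>\<tau>\<close>, enlarging a last entry
  by \<open>m\<close> gives a dominating vertex. The other simplices with a given nonempty part of colour \<open>c\<close>
  form a full simplex on the common neighbours of that part, and those in which it is empty form
  a fibre of a single colour.
\<close>

lemma removable_two_coloured_fibre:
  assumes \<tau>: "box_simplex (Omega (2 * l + 1) G) \<tau>" and A0: "(A0, c) \<in> \<tau>" and B0: "(B0, \<not> c) \<in> \<tau>"
  shows "removable {\<sigma>. box_simplex (Omega (2 * Suc l + 1) G) \<sigma> \<and> apfst butlast ` \<sigma> \<subseteq> \<tau>}" (is "removable ?F")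
proof -
  let ?H' = "Omega (2 * Suc l + 1) G"
  \<comment> \<open>A neighbour lying over \<open>B\<close> requires \<open>last B\<close> to be
    contained in the last entry. A tuple whose last entry contains \<open>m\<close> meets this
    requirement for every \<open>B\<close> of the other colour in \<open>\<tau>\<close>.\<close>
  define m where "m = (\<Union>B\<in>{B. (B, \<not> c) \<in> \<tau>}. last B)"
  have AB: "E A B" if "(A, c) \<in> \<tau>" "(B, \<not> c) \<in> \<tau>" for A B using box_simplexD(1)[OF \<tau> that] .
  have mP: "m \<subseteq> pverts G"
    using arc_last(2)[OF Omega_arc_sym[OF AB[OF A0]]] unfolding m_def by blast
  have Am: "complete_to G (last A) m" if "(A, c) \<in> \<tau>" for A
    using arc_last(1)[OF AB[OF that]] unfolding m_def complete_to_Union[OF G] by blast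
  have \<sigma>\<tau>: "(butlast a, c') \<in> \<tau>" if "\<sigma> \<in> ?F" "(a, c') \<in> \<sigma>" for \<sigma> a c'
    using that by (auto simp: image_subset_iff)
  have sub: "\<sigma> \<subseteq> pverts ?H' \<times> UNIV" if "\<sigma> \<in> ?F" for \<sigma>
  proof
    fix x assume "x \<in> \<sigma>"
    then show "x \<in> pverts ?H' \<times> UNIV"
      using that box_simplexD(2)[of ?H' \<sigma> "snd x"] E'_verts by (cases x) auto
  qed
  have finV: "finite (pverts ?H' \<times> (UNIV :: bool set))" using finite_E' by simp
  have "?F \<subseteq> Pow (pverts ?H' \<times> UNIV)" using sub by blast
  then have finF: "finite ?F" using finV by (meson finite_Pow_iff finite_subset)
  have fin: "finite \<sigma>" if "\<sigma> \<in> ?F" for \<sigma> using sub[OF that] finV by (rule finite_subset)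
  have down: "\<rho> \<in> ?F" if "\<sigma> \<in> ?F" "\<rho> \<subseteq> \<sigma>" for \<sigma> \<rho>
    using that box_simplex_subset by (blast intro: order_trans[OF image_mono])
  define nbr where "nbr \<sigma> b \<longleftrightarrow> (butlast b, \<not> c) \<in> \<tau> \<and> (\<forall>a. (a, c) \<in> \<sigma> \<longrightarrow> E' a b)" for \<sigma> b
  let ?C = "{\<sigma> \<in> ?F. \<forall>b. \<not> nbr \<sigma> b}"
  \<comment> \<open>A vertex of the other colour would itself be a common neighbour over
    \<open>\<tau>\<close>, so simplices in \<open>?C\<close> have colour \<open>c\<close>
    only.\<close>
  have C_colour: "(b, \<not> c) \<notin> \<sigma>" if "\<sigma> \<in> ?C" for \<sigma> b
  proof
    assume b: "(b, \<not> c) \<in> \<sigma>"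
    then have "nbr \<sigma> b"
      using that \<sigma>\<tau>[of \<sigma> b] box_simplexD(1)[of ?H' \<sigma> _ c b] unfolding nbr_def by blast
    then show False using that by blast
  qed
  let ?D = "{a. \<not> m \<subseteq> last a} \<times> {c}"
  let ?d = "\<lambda>v. (butlast (fst v) @ [last (fst v) \<union> m], c)"
  have "removable ?C"
  proof (rule removable_dominated[where D = ?D and d = ?d])
    \<comment> \<open>No member of \<open>?C\<close> avoids \<open>?D\<close>: if all last entries
      contain \<open>m\<close>, the tuple \<open>B0\<close> extended by the least possible last
      entry \<open>W\<close> is a common neighbour over \<open>\<tau>\<close>.\<close>
    have "\<exists>v\<in>\<sigma>. v \<in> ?D" if \<sigma>: "\<sigma> \<in> ?C" for \<sigma>
    proof (rule ccontr)
      assume "\<not> (\<exists>v\<in>\<sigma>. v \<in> ?D)"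
      then have m: "m \<subseteq> last a" if "(a, c) \<in> \<sigma>" for a using that by auto
      obtain w where w: "\<And>a. (a, c) \<in> \<sigma> \<Longrightarrow> E' a w"
        using \<sigma> box_simplexD(2)[of ?H' \<sigma> c] by blast
      define W where "W = (\<Union>a\<in>{a. (a, c) \<in> \<sigma>}. last (butlast a))"
      have "E' a (B0 @ [W])" if a: "(a, c) \<in> \<sigma>" for a
      proof -
        have A: "(butlast b, c) \<in> \<tau>" if "(b, c) \<in> \<sigma>" for b using \<sigma>\<tau> \<sigma> that by blast
        have snoc_w: "w = butlast w @ [last w]" using E'_snoc[OF Omega_arc_sym[OF w[OF a]]] .
        have arc: "last b \<subseteq> pverts G" "complete_to G (last (butlast b)) (last b)"
          "last (butlast b) \<subseteq> last w" "complete_to G (last b) (last w)" if "(b, c) \<in> \<sigma>" for b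
        proof -
          have "E' (butlast b @ [last b]) (butlast w @ [last w])"
            using E'_snoc[OF w[OF that]] w[OF that] snoc_w by simp
          then show "last b \<subseteq> pverts G" "complete_to G (last (butlast b)) (last b)"
            "last (butlast b) \<subseteq> last w" "complete_to G (last b) (last w)" unfolding snoc by blast+
        qed
        have "W \<subseteq> last w" using arc(3) unfolding W_def by blast
        then have "complete_to G (last a) W" using arc(4)[OF a] mono by blast
        moreover have "W \<subseteq> pverts G" using arc_last(2)[OF AB[OF A B0]] unfolding W_def by blast
        moreover have "complete_to G (last B0) W"
          using arc_last(1)[OF AB[OF A B0]] sym unfolding W_def complete_to_Union[OF G] by blast
        moreover have "last (butlast a) \<subseteq> W" using a unfolding W_def by blast
        moreover have "last B0 \<subseteq> last a" using m[OF a] B0 unfolding m_def by blast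
        ultimately have "E' (butlast a @ [last a]) (B0 @ [W])"
          unfolding snoc using AB[OF A[OF a] B0] arc(1,2)[OF a] by blast
        then show ?thesis using E'_snoc[OF w[OF a]] by simp
      qed
      then have "nbr \<sigma> (B0 @ [W])" unfolding nbr_def using B0 by simp
      then show False using \<sigma> by blast
    qed
    then have "{\<sigma> \<in> ?C. \<sigma> \<inter> ?D = {}} = {}" by blast
    then show "removable {\<sigma> \<in> ?C. \<sigma> \<inter> ?D = {}}" using removable.empty by metis
  next
    fix \<sigma> v assume \<sigma>: "\<sigma> \<in> ?C" and v: "v \<in> \<sigma>" "v \<in> ?D"
    obtain a where a: "v = (a, c)" "(a, c) \<in> \<sigma>" using v by auto
    have A: "(butlast b, c) \<in> \<tau>" if "(b, c) \<in> \<sigma>" for b using \<sigma>\<tau> \<sigma> that by blast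
    have dv: "?d v = (butlast a @ [last a \<union> m], c)" unfolding a by simp
    obtain w where w: "\<And>b. (b, c) \<in> \<sigma> \<Longrightarrow> E' b w"
      using \<sigma> box_simplexD(2)[of ?H' \<sigma> c] by blast
    obtain C Z where CZ: "w = C @ [Z]" using E'_snoc[OF Omega_arc_sym[OF w[OF a(2)]]] by blast
    have 1: "E' b (C @ [Z \<inter> common_nbhd G m])" if "(b, c) \<in> \<sigma>" for b
      using Omega_arc_shrink w[OF that] Am[OF A[OF that]] unfolding CZ by blast
    have 2: "E' (butlast a @ [last a \<union> m]) (C @ [Z \<inter> common_nbhd G m])"
      using Omega_arc_enlarge w[OF a(2)] Am[OF A[OF a(2)]] mP unfolding CZ by blast
    \<comment> \<open>As only colour \<open>c\<close> occurs, the one thing to provide is a common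
      neighbour, namely the given one with its last entry cut down by \<open>m\<close>.\<close>
    have "box_simplex ?H' (insert (?d v) \<sigma>)"
      unfolding dv
    proof (rule box_simplexI)
      fix x y c' assume "(x, c') \<in> insert (butlast a @ [last a \<union> m], c) \<sigma>"
        "(y, \<not> c') \<in> insert (butlast a @ [last a \<union> m], c) \<sigma>"
      then show "E' x y" using C_colour[OF \<sigma>] by (cases "c' = c") auto
    next
      fix c'
      show "\<exists>w. \<forall>b. (b, c') \<in> insert (butlast a @ [last a \<union> m], c) \<sigma> \<longrightarrow> E' b w"
      proof (cases "c' = c")
        case True
        then show ?thesis using 1 2 by blast
      next
        case False
        then have "c' = (\<not> c)" by simp
        then show ?thesis using C_colour[OF \<sigma>] by blast
      qed
    qed
    then have "insert (?d v) \<sigma> \<in> ?F" unfolding dv using \<sigma> A[OF a(2)] by simp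
    moreover have "\<not> nbr (insert (?d v) \<sigma>) b" for b using \<sigma> unfolding nbr_def by blast
    ultimately show "insert (?d v) \<sigma> \<in> ?C" by blast
    \<comment> \<open>Fewer vertices might acquire a common neighbour over \<open>\<tau>\<close>.
      But such a neighbour is adjacent to \<open>a\<close>, and cutting its last entry makes it
      adjacent to the enlarged \<open>a\<close> too, without changing its truncation; so it would
      serve all of \<open>\<sigma>\<close>.\<close>
    have "\<not> nbr (\<sigma> - {?d v}) b" for b
    proof
      assume b: "nbr (\<sigma> - {?d v}) b"
      have "a \<noteq> butlast a @ [last a \<union> m]" using v unfolding a by (metis (no_types, lifting) SigmaE Un_upper2 last_snoc mem_Collect_eq prod.inject)
      then have "E' a b" using b a(2) unfolding nbr_def dv by blast
      obtain B Z where BZ: "b = B @ [Z]" using E'_snoc[OF Omega_arc_sym[OF \<open>E' a b\<close>]] by blast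
      have "E' x (B @ [Z \<inter> common_nbhd G m])" if x: "(x, c) \<in> \<sigma>" for x
      proof (cases "x = butlast a @ [last a \<union> m]")
        case True
        then show ?thesis
          using Omega_arc_enlarge \<open>E' a b\<close> Am[OF A[OF a(2)]] mP unfolding BZ by blast
      next
        case False
        then have "E' x b" using b x unfolding nbr_def dv by blast
        then show ?thesis using Omega_arc_shrink Am[OF A[OF x]] unfolding BZ by blast
      qed
      then have "nbr \<sigma> (B @ [Z \<inter> common_nbhd G m])" using b unfolding nbr_def BZ by simp
      then show False using \<sigma> by blast
    qed
    then show "\<sigma> - {?d v} \<in> ?C" using \<sigma> down by blast
  next
    show "finite ?C" by (rule finite_subset[OF _ finF]) blast
    show "finite \<sigma>" if "\<sigma> \<in> ?C" for \<sigma> using that fin by blast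
    show "?d v \<notin> ?D" for v by simp
  qed
  moreover have "removable (?F - ?C)"
  proof (rule removable_parts[where D = "UNIV \<times> {c}"])
    fix q
    show "removable {\<sigma> \<in> ?F - ?C. \<sigma> \<inter> UNIV \<times> {c} = q}" (is "removable ?P")
    proof (cases "q = {}")
      case True
      \<comment> \<open>With no vertex of colour \<open>c\<close> adjacency is vacuous, and only the
        truncation \<open>B0\<close> of the witness matters; no simplex of this part belongs to
        \<open>?C\<close>.\<close>
      have "nbr \<sigma> (B0 @ [{}])" if "\<sigma> \<inter> UNIV \<times> {c} = {}" for \<sigma>
        using that B0 unfolding nbr_def by auto
      then have "?P = {\<sigma>. box_simplex ?H' \<sigma> \<and> apfst butlast ` \<sigma> \<subseteq> \<tau> \<and> (\<forall>a. (a, \<not> \<not> c) \<notin> \<sigma>)}"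
        unfolding True by auto
      then show ?thesis using removable_one_coloured_fibre[OF \<tau> B0] by simp
    next
      case False
      show ?thesis
      proof (cases "?P = {}")
        case True
        show ?thesis unfolding True by (rule removable.empty)
      next
        case P: False
        then obtain \<sigma>0 where \<sigma>0: "\<sigma>0 \<in> ?P" by blast
        \<comment> \<open>\<open>nbr\<close> depends only on the part of colour \<open>c\<close>,
          which is \<open>q\<close> throughout \<open>?P\<close>; a neighbour found for one simplex
          therefore serves as apex for all.\<close>
        then obtain b where "nbr \<sigma>0 b" by blast
        then have b: "(butlast b, \<not> c) \<in> \<tau>" "\<And>a. (a, c) \<in> q \<Longrightarrow> E' a b"
          using \<sigma>0 unfolding nbr_def by blast+
        obtain a0 where a0: "(a0, c) \<in> q" using False \<sigma>0 by auto
        have q: "(a, c) \<in> \<sigma> \<longleftrightarrow> (a, c) \<in> q" if "\<sigma> \<in> ?P" for \<sigma> a using that by auto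
        show ?thesis
        proof (rule removable_cone[where v = "(b, \<not> c)"])
          fix \<sigma> assume \<sigma>: "\<sigma> \<in> ?P"
          note box = box_simplexD(1)[of ?H' \<sigma>]
          have "box_simplex ?H' (insert (b, \<not> c) \<sigma>)"
          proof (rule box_simplexI)
            fix x y c' assume xy: "(x, c') \<in> insert (b, \<not> c) \<sigma>" "(y, \<not> c') \<in> insert (b, \<not> c) \<sigma>"
            show "E' x y"
            proof (cases "c' = c")
              case True
              then have "(x, c) \<in> \<sigma>" "y = b \<or> (y, \<not> c) \<in> \<sigma>" using xy by auto
              then show ?thesis using b(2) q[OF \<sigma>] box[of x c y] \<sigma> by blast
            next
              case False
              then have "c' = (\<not> c)" by simp
              then have "(y, c) \<in> \<sigma>" "x = b \<or> (x, \<not> c) \<in> \<sigma>" using xy by auto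
              then have "E' y x" using b(2) q[OF \<sigma>] box[of y c x] \<sigma> by blast
              then show ?thesis by (rule Omega_arc_sym)
            qed
          next
            fix c'
            show "\<exists>w. \<forall>x. (x, c') \<in> insert (b, \<not> c) \<sigma> \<longrightarrow> E' x w"
            proof (cases "c' = c")
              case True
              then show ?thesis using b(2) q[OF \<sigma>] by auto
            next
              case False
              then have c': "c' = (\<not> c)" by simp
              \<comment> \<open>Any vertex of the nonempty part \<open>q\<close> is a common
                neighbour of the other colour, including the new vertex \<open>b\<close>.\<close>
              have "E' x a0" if "(x, c') \<in> insert (b, \<not> c) \<sigma>" for x
              proof -
                have "x = b \<or> (x, \<not> c) \<in> \<sigma>" using that c' by auto
                then have "E' a0 x" using b(2)[OF a0] q[OF \<sigma>, of a0] a0 box[of a0 c x] \<sigma> by blast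
                then show ?thesis by (rule Omega_arc_sym)
              qed
              then show ?thesis by blast
            qed
          qed
          then have "insert (b, \<not> c) \<sigma> \<in> ?F" using \<sigma> b(1) by simp
          moreover have "nbr (insert (b, \<not> c) \<sigma>) b" unfolding nbr_def using b q[OF \<sigma>] by simp
          moreover have "insert (b, \<not> c) \<sigma> \<inter> UNIV \<times> {c} = q" using \<sigma> by auto
          ultimately show "insert (b, \<not> c) \<sigma> \<in> ?P" by blast
          have "\<sigma> - {(b, \<not> c)} \<in> ?F" using \<sigma> down by blast
          moreover have "nbr (\<sigma> - {(b, \<not> c)}) b" unfolding nbr_def using b q[OF \<sigma>] by simp
          moreover have "(\<sigma> - {(b, \<not> c)}) \<inter> UNIV \<times> {c} = q" using \<sigma> by auto
          ultimately show "\<sigma> - {(b, \<not> c)} \<in> ?P" by blast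
          show "finite \<sigma>" using \<sigma> fin by blast
        next
          show "finite ?P" by (rule finite_subset[OF _ finF]) blast
        qed
      qed
    qed
  next
    show "finite (?F - ?C)" using finF by (rule finite_Diff)
    show "finite \<sigma>" if "\<sigma> \<in> ?F - ?C" for \<sigma> using that fin by blast
  qed
  \<comment> \<open>A common neighbour passes to subsets, so \<open>?C\<close> is closed upwards in
    the fibre and must be removed first.\<close>
  moreover have "\<not> \<rho> \<subset> \<rho>'" if C: "\<rho> \<in> ?C" and FC: "\<rho>' \<in> ?F - ?C" for \<rho> \<rho>'
  proof
    assume "\<rho> \<subset> \<rho>'"
    obtain b where "nbr \<rho>' b" using FC by blast
    then have "nbr \<rho> b" using \<open>\<rho> \<subset> \<rho>'\<close> unfolding nbr_def by blast
    then show False using C by blast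
  qed
  ultimately have "removable (?C \<union> (?F - ?C))" by (intro removable_Un) auto
  moreover have "?C \<union> (?F - ?C) = ?F" by blast
  ultimately show ?thesis by simp
qed

text \<open>As \<open>box_simplex\<close> admits the empty set, the fibre together with the empty
  simplex is the family treated above. Taking for \<open>c\<close> a colour that occurs in
  \<open>\<tau>\<close>, the two cases are whether the other colour occurs as well.\<close>

lemma removable_butlast_fibre:
  assumes \<tau>: "\<tau> \<in> box_complex (Omega (2 * l + 1) G)"
  shows "removable {\<sigma> \<in> insert {} (box_complex (Omega (2 * Suc l + 1) G)). apfst butlast ` \<sigma> \<subseteq> \<tau>}"
proof -
  have box\<tau>: "\<tau> \<noteq> {}" "box_simplex (Omega (2 * l + 1) G) \<tau>"
    using \<tau> unfolding box_complex_iff[OF Omega_pair_pseudo_graph[OF G]] by blast+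
  have empty: "box_simplex (Omega (2 * Suc l + 1) G) {}" by (rule box_simplexI) simp_all
  have "\<sigma> \<in> insert {} (box_complex (Omega (2 * Suc l + 1) G)) \<longleftrightarrow> box_simplex (Omega (2 * Suc l + 1) G) \<sigma>" for \<sigma>
    using empty unfolding insert_iff box_complex_iff[OF Omega_pair_pseudo_graph[OF G]]
    by (cases "\<sigma> = {}") simp_all
  then have "{\<sigma> \<in> insert {} (box_complex (Omega (2 * Suc l + 1) G)). apfst butlast ` \<sigma> \<subseteq> \<tau>} =
      {\<sigma>. box_simplex (Omega (2 * Suc l + 1) G) \<sigma> \<and> apfst butlast ` \<sigma> \<subseteq> \<tau>}" (is "_ = ?F")
    by (simp only:)
  moreover obtain A c where A: "(A, c) \<in> \<tau>" using box\<tau>(1) by auto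
  have "removable ?F"
  proof (cases "\<exists>B. (B, \<not> c) \<in> \<tau>")
    case True
    then show ?thesis using removable_two_coloured_fibre[OF box\<tau>(2) A] by blast
  next
    case False
    then have "?F = {\<sigma>. box_simplex (Omega (2 * Suc l + 1) G) \<sigma> \<and> apfst butlast ` \<sigma> \<subseteq> \<tau> \<and> (\<forall>a. (a, \<not> c) \<notin> \<sigma>)}"
      by (auto simp: image_subset_iff)
    then show ?thesis using removable_one_coloured_fibre[OF box\<tau>(2) A] by simp
  qed
  ultimately show ?thesis by simp
qed

end

theorem theorem5p5:
  fixes G :: "'a pair_pre_digraph" and k :: nat
  assumes "pair_graph G" and "k \<ge> 1"
  shows "Z2_simple_homotopy_equivalent
           (box_Z2_complex (Omega (2 * k + 1) G)) (box_Z2_complex (Omega (2 * k - 1) G)) \<and>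
         graph_hom (Omega (2 * k + 1) G) (Omega (2 * k - 1) G) butlast \<and>
         Z2_homotopy_equivalence
           (realization (box_complex (Omega (2 * k + 1) G))) (realization_map box_involution)
           (realization (box_complex (Omega (2 * k - 1) G))) (realization_map box_involution)
           (box_map butlast)"
proof -
  note G = assms(1)
  \<comment> \<open>With \<open>k = Suc l\<close> the subtraction on natural numbers in
    \<open>2 * k - 1\<close> is a genuine one and gives \<open>2 * l + 1\<close>, so truncation goes
    from tuples of length \<open>l + 2\<close> to tuples of length \<open>l + 1\<close>.\<close>
  obtain l where k: "k = Suc l" using assms(2) by (cases k) auto
  let ?H' = "Omega (2 * Suc l + 1) G" and ?H = "Omega (2 * l + 1) G"
  have H: "2 * k - 1 = 2 * l + 1" unfolding k by simp
  have free: "free_Z2_complex (box_complex (Omega (2 * m + 1) G)) box_involution" for m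
    by (rule free_Z2_complex_box[OF Omega_pair_pseudo_graph[OF G] Omega_no_loops[OF G]])
  have hom: "graph_hom ?H' ?H butlast" by (rule graph_hom_butlast[OF G])
  have simplicial: "apfst butlast ` \<sigma> \<in> box_complex ?H" if "\<sigma> \<in> box_complex ?H'" for \<sigma>
    using that box_simplex_hom[OF hom] unfolding box_complex_iff[OF Omega_pair_pseudo_graph[OF G]] by blast
  have eqv: "apfst butlast (box_involution v) = box_involution (apfst butlast v)"
    for v :: "'a set list \<times> bool" by (cases v) simp
  note fibres = removable_butlast_fibre[OF G, of _ l]
  have "Z2_simple_homotopy_equivalent (box_complex ?H', box_involution) (box_complex ?H, box_involution)"
    by (rule Z2_simple_homotopy_equivalent_removable_fibres[OF free free eqv simplicial fibres])
  moreover have "Z2_homotopy_equivalence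
      (realization (box_complex ?H')) (realization_map box_involution)
      (realization (box_complex ?H)) (realization_map box_involution) (realization_map (apfst butlast))"
    by (rule Z2_homotopy_equivalence_removable_fibres[OF _ _ free free eqv simplicial fibres]) simp_all
  ultimately show ?thesis
    using hom unfolding H unfolding k box_Z2_complex_def box_map_def by blast
qed

end
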